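(* Let $n$ be a positive integer, let $\lambda$ be a partition of $n$, and let $h:[n]\to\{0,1,\dots,n-1\}$ be a nondecreasing function with $h(i)<i$ for all $i\in[n]$. Let $w\in S_n$ be such that $C_w\cap\mathrm{Hess}(X_\lambda,h)\ne\emptyset$ (equivalently $R(w)\in\mathrm{RS}_h(\lambda)$) and such that $\dim(C_w\cap\mathrm{Hess}(X_\lambda,h))=|\mathrm{inv}_{\lambda,h}(w)|$ is maximal among all $w\in S_n$ for which this intersection is nonempty. Then $R(w)$ is a standard tableau.
   Context: Notation: $[n]=\{1,\dots,n\}$; $\mathbf{e}_1,\dots,\mathbf{e}_n$ is the standard basis of $\mathbb{C}^n$; $E_{ab}$ is the elementary matrix with $E_{ab}\mathbf{e}_b=\mathbf{e}_a$; permutations are identified with permutation matrices, $w\mathbf{e}_j=\mathbf{e}_{w(j)}$. $B\subset GL_n(\mathbb{C})$ is the group of upper triangular matrices. $\mathrm{Flags}(\mathbb{C}^n)\cong GL_n(\mathbb{C})/B$ is the variety of full flags $V_\bullet=(V_1\subset\cdots\subset V_n=\mathbb{C}^n)$, $\dim V_i=i$, $V_0=\{0\}$; $E_\bullet$ is the standard flag; $C_w=BwE_\bullet$ is the Schubert cell. $\mathrm{Hess}(X,h)=\{V_\bullet: X(V_i)\subseteq V_{h(i)}\ \forall i\in[n]\}$. Tableaux: the diagram of the partition $\lambda$ is left-justified with $\lambda_i$ boxes in the $i$-th row from the top. The base filling $R(e)$ labels the boxes by $1,\dots,n$, column by column from the leftmost column to the right, and from bottom to top in each column. $X_\lambda=\sum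 E_{ab}$, summed over all pairs $(a,b)$ such that $b$ labels the box directly to the right of the box labeled $a$ in $R(e)$. For $w\in S_n$, $R(w)$ is the filling of $\lambda$ in which the box labeled $i$ in $R(e)$ is labeled $w^{-1}(i)$. $R(w)$ is $h$-strict if $\ell\le h(r)$ whenever $\ell$ labels the box directly to the left of the box labeled $r$; $\mathrm{RS}_h(\lambda)$ is the set of $h$-strict fillings. A filling is a standard tableau if entries strictly increase from left to right in rows and from top to bottom in columns. Hessenberg inversions: $(k,\ell)\in\mathrm{inv}_{\lambda,h}(w)$ iff $k>\ell$, (i) $k$ occurs in a box below $\ell$ in the same column, or in any column strictly to the left of the column containing $\ell$, in $R(w)$, and (ii) if the box directly to the right of $\ell$ in $R(w)$ exists and is labeled $r$, then $k\le h(r)$. When $R(w)\in\mathrm{RS}_h(\lambda)$, $C_w\cap\mathrm{Hess}(X_\lambda,h)$ is isomorphic to an affine space of dimension $|\mathrm{inv}_{\lambda,h}(w)|$. *)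

theory Defs
  imports
    "Jordan_Normal_Form.VS_Connect"
    "HOL-Analysis.Abstract_Topology"
    "HOL-Library.Extended_Nat"
    "HOL-Library.FuncSet"
    "HOL-Combinatorics.Permutations"
begin

text \<open>
  Labels and flag indices are 1-based, as in \<open>[n] = {1..n}\<close>. Matrix and vector entries are
  0-based, as in the matrix library, so the basis vector \<open>e\<^sub>j\<close> is \<open>unit_vec n (j - 1)\<close>. Rows and
  columns of Young diagrams are 0-based: \<open>(i, j)\<close> is the box in row \<open>i\<close> (counted from the top)
  and column \<open>j\<close> (counted from the left).
\<close>

section \<open>Tableaux\<close>

definition is_partition :: "nat list \<Rightarrow> nat \<Rightarrow> bool" where
  "is_partition lam n \<longleftrightarrow> sorted_wrt (\<ge>) lam \<and> 0 \<notin> set lam \<and> sum_list lam = n"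

definition diagram :: "nat list \<Rightarrow> (nat \<times> nat) set" where
  "diagram lam = {(i, j). i < length lam \<and> j < lam ! i}"

text \<open>
  The base filling \<open>R(e)\<close>: the label of a box is the number of boxes read up to and including it,
  reading columns from left to right and each column from bottom to top.
\<close>

definition base_filling :: "nat list \<Rightarrow> nat \<times> nat \<Rightarrow> nat" where
  "base_filling lam = (\<lambda>(i, j).
     card {(i', j') \<in> diagram lam. j' < j \<or> (j' = j \<and> i' \<ge> i)})"

definition filling_of :: "nat list \<Rightarrow> (nat \<Rightarrow> nat) \<Rightarrow> nat \<times> nat \<Rightarrow> nat" where
  "filling_of lam w = (\<lambda>p. inv_into UNIV w (base_filling lam p))"

definition h_strict :: "nat list \<Rightarrow> (nat \<Rightarrow> nat) \<Rightarrow> (nat \<times> nat \<Rightarrow> nat) \<Rightarrow> bool" where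
  "h_strict lam h T \<longleftrightarrow>
     (\<forall>i j. (i, j) \<in> diagram lam \<and> (i, Suc j) \<in> diagram lam \<longrightarrow> T (i, j) \<le> h (T (i, Suc j)))"

text \<open>
  Fillings are total functions on \<open>nat \<times> nat\<close>; their values outside the diagram are irrelevant.
\<close>

definition RS :: "nat \<Rightarrow> (nat \<Rightarrow> nat) \<Rightarrow> nat list \<Rightarrow> (nat \<times> nat \<Rightarrow> nat) set" where
  "RS n h lam = {T. bij_betw T (diagram lam) {1..n} \<and> h_strict lam h T}"

definition standard_tableau :: "nat \<Rightarrow> nat list \<Rightarrow> (nat \<times> nat \<Rightarrow> nat) \<Rightarrow> bool" where
  "standard_tableau n lam T \<longleftrightarrow>
     bij_betw T (diagram lam) {1..n} \<and>
     (\<forall>i j j'. (i, j) \<in> diagram lam \<and> (i, j') \<in> diagram lam \<and> j < j' \<longrightarrow> T (i, j) < T (i, j')) \<and>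
     (\<forall>i i' j. (i, j) \<in> diagram lam \<and> (i', j) \<in> diagram lam \<and> i < i' \<longrightarrow> T (i, j) < T (i', j))"

text \<open>The pair \<open>(k, l)\<close> is recorded through the boxes \<open>(a, b)\<close> of \<open>k\<close> and \<open>(i, j)\<close> of \<open>l\<close>.\<close>

definition hess_inversions ::
    "nat list \<Rightarrow> (nat \<Rightarrow> nat) \<Rightarrow> (nat \<Rightarrow> nat) \<Rightarrow> (nat \<times> nat) set" where
  "hess_inversions lam h w = (let T = filling_of lam w in
     {(k, l). \<exists>a b i j.
        (a, b) \<in> diagram lam \<and> T (a, b) = k \<and>
        (i, j) \<in> diagram lam \<and> T (i, j) = l \<and>
        k > l \<and>
        ((b = j \<and> a > i) \<or> b < j) \<and>
        ((i, Suc j) \<in> diagram lam \<longrightarrow> k \<le> h (T (i, Suc j)))})"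


section \<open>Matrices\<close>

definition elem_mat :: "nat \<Rightarrow> nat \<Rightarrow> nat \<Rightarrow> complex mat" where
  "elem_mat n a b = mat n n (\<lambda>(r, c). if r + 1 = a \<and> c + 1 = b then 1 else 0)"

definition adjacent_labels :: "nat list \<Rightarrow> (nat \<times> nat) set" where
  "adjacent_labels lam = {(base_filling lam (i, j), base_filling lam (i, Suc j)) | i j.
     (i, j) \<in> diagram lam \<and> (i, Suc j) \<in> diagram lam}"

text \<open>
  The type of matrices of varying size is not a monoid, so the sum of the matrices \<open>E\<^sub>a\<^sub>b\<close> is
  taken entrywise.
\<close>

definition X_mat :: "nat \<Rightarrow> nat list \<Rightarrow> complex mat" where
  "X_mat n lam = mat n n (\<lambda>(r, c). \<Sum>(a, b) \<in> adjacent_labels lam. elem_mat n a b $$ (r, c))"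

definition perm_mat :: "nat \<Rightarrow> (nat \<Rightarrow> nat) \<Rightarrow> complex mat" where
  "perm_mat n w = mat n n (\<lambda>(r, c). if r + 1 = w (c + 1) then 1 else 0)"

definition GL :: "nat \<Rightarrow> complex mat set" where
  "GL n = {g \<in> carrier_mat n n. invertible_mat g}"

definition Borel :: "nat \<Rightarrow> complex mat set" where
  "Borel n = {b \<in> GL n. upper_triangular b}"


section \<open>Flags\<close>

text \<open>
  A flag is the sequence \<open>V\<^sub>0, \<dots>, V\<^sub>n\<close>, encoded as a function on \<open>nat\<close> that is \<open>undefined\<close>
  outside \<open>{0..n}\<close>.
\<close>

type_synonym flag = "nat \<Rightarrow> complex vec set"

definition Flags :: "nat \<Rightarrow> flag set" where
  "Flags n = {V \<in> extensional {0..n}.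
     (\<forall>i\<in>{0..n}. VectorSpace.subspace class_ring (V i) (module_vec TYPE(complex) n) \<and>
        vectorspace.dim class_ring ((module_vec TYPE(complex) n)\<lparr>carrier := V i\<rparr>) = i) \<and>
     (\<forall>i\<in>{0..<n}. V i \<subseteq> V (Suc i))}"

definition flag_act :: "nat \<Rightarrow> complex mat \<Rightarrow> flag \<Rightarrow> flag" where
  "flag_act n g V = (\<lambda>i\<in>{0..n}. (\<lambda>v. g *\<^sub>v v) ` V i)"

definition std_flag :: "nat \<Rightarrow> flag" where
  "std_flag n = (\<lambda>i\<in>{0..n}.
     LinearCombinations.module.span class_ring (module_vec TYPE(complex) n)
       ((\<lambda>j. unit_vec n (j - 1)) ` {1..i}))"

definition schubert_cell :: "nat \<Rightarrow> (nat \<Rightarrow> nat) \<Rightarrow> flag set" where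
  "schubert_cell n w = {flag_act n (b * perm_mat n w) (std_flag n) | b. b \<in> Borel n}"

definition Hess :: "nat \<Rightarrow> complex mat \<Rightarrow> (nat \<Rightarrow> nat) \<Rightarrow> flag set" where
  "Hess n X h = {V \<in> Flags n. \<forall>i\<in>{1..n}. (\<lambda>v. X *\<^sub>v v) ` V i \<subseteq> V (h i)}"


section \<open>Zariski topology and dimension\<close>

inductive_set poly_fun :: "nat \<Rightarrow> (complex mat \<Rightarrow> complex) set" for n :: nat where
  const: "(\<lambda>_. c) \<in> poly_fun n"
| entry: "r < n \<Longrightarrow> c < n \<Longrightarrow> (\<lambda>g. g $$ (r, c)) \<in> poly_fun n"
| add: "f \<in> poly_fun n \<Longrightarrow> f' \<in> poly_fun n \<Longrightarrow> (\<lambda>g. f g + f' g) \<in> poly_fun n"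
| mult: "f \<in> poly_fun n \<Longrightarrow> f' \<in> poly_fun n \<Longrightarrow> (\<lambda>g. f g * f' g) \<in> poly_fun n"

text \<open>
  The Zariski topology on \<open>GL\<^sub>n\<close>, as an open subset of the affine space of matrices: the open sets
  are the complements of zero loci of families of polynomials in the matrix entries.
\<close>

definition zariski_GL :: "nat \<Rightarrow> complex mat topology" where
  "zariski_GL n = topology (\<lambda>U. \<exists>F \<subseteq> poly_fun n. U = {g \<in> GL n. \<exists>f\<in>F. f g \<noteq> 0})"

lemma istopology_zariski_GL:
  "istopology (\<lambda>U. \<exists>F \<subseteq> poly_fun n. U = {g \<in> GL n. \<exists>f\<in>F. f g \<noteq> 0})"
  unfolding istopology_def
proof (intro conjI allI impI)
  fix S T
  assume "\<exists>F\<subseteq>poly_fun n. S = {g \<in> GL n. \<exists>f\<in>F. f g \<noteq> 0}"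
    and "\<exists>F\<subseteq>poly_fun n. T = {g \<in> GL n. \<exists>f\<in>F. f g \<noteq> 0}"
  then obtain F G where F: "F \<subseteq> poly_fun n" "S = {g \<in> GL n. \<exists>f\<in>F. f g \<noteq> 0}"
    and G: "G \<subseteq> poly_fun n" "T = {g \<in> GL n. \<exists>f\<in>G. f g \<noteq> 0}" by blast
  let ?H = "(\<lambda>(f, f'). (\<lambda>g. f g * f' g)) ` (F \<times> G)"
  have "?H \<subseteq> poly_fun n" using F G by (auto intro: poly_fun.mult)
  moreover have "S \<inter> T = {g \<in> GL n. \<exists>f\<in>?H. f g \<noteq> 0}"
    unfolding F(2) G(2) by (auto simp: split_beta)
  ultimately show "\<exists>F\<subseteq>poly_fun n. S \<inter> T = {g \<in> GL n. \<exists>f\<in>F. f g \<noteq> 0}" by blast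
next
  fix K
  assume K: "\<forall>S\<in>K. \<exists>F\<subseteq>poly_fun n. S = {g \<in> GL n. \<exists>f\<in>F. f g \<noteq> 0}"
  let ?F = "{f \<in> poly_fun n. {g \<in> GL n. f g \<noteq> 0} \<subseteq> \<Union>K}"
  have "\<Union>K \<subseteq> {g \<in> GL n. \<exists>f\<in>?F. f g \<noteq> 0}"
  proof
    fix g assume "g \<in> \<Union>K"
    then obtain S where S: "S \<in> K" "g \<in> S" by (rule UnionE)
    obtain F where F: "F \<subseteq> poly_fun n" "S = {g \<in> GL n. \<exists>f\<in>F. f g \<noteq> 0}"
      using bspec[OF K S(1)] by (elim exE conjE)
    obtain f where f: "f \<in> F" "f g \<noteq> 0" "g \<in> GL n" using S(2) unfolding F(2) by blast
    have "{g \<in> GL n. f g \<noteq> 0} \<subseteq> S" unfolding F(2) using f(1) by blast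
    with S(1) F(1) f(1) have "f \<in> ?F" by blast
    with f show "g \<in> {g \<in> GL n. \<exists>f\<in>?F. f g \<noteq> 0}" by blast
  qed
  moreover have "{g \<in> GL n. \<exists>f\<in>?F. f g \<noteq> 0} \<subseteq> \<Union>K" by blast
  ultimately have "\<Union>K = {g \<in> GL n. \<exists>f\<in>?F. f g \<noteq> 0}" by (rule subset_antisym)
  moreover have "?F \<subseteq> poly_fun n" by (rule Collect_restrict)
  ultimately show "\<exists>F\<subseteq>poly_fun n. \<Union>K = {g \<in> GL n. \<exists>f\<in>F. f g \<noteq> 0}"
    by (intro exI[of _ ?F] conjI)
qed

lemma openin_zariski_GL:
  "openin (zariski_GL n) U \<longleftrightarrow> (\<exists>F \<subseteq> poly_fun n. U = {g \<in> GL n. \<exists>f\<in>F. f g \<noteq> 0})"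
  unfolding zariski_GL_def by (simp add: topology_inverse'[OF istopology_zariski_GL])

lemma topspace_zariski_GL: "topspace (zariski_GL n) = GL n"
proof
  show "topspace (zariski_GL n) \<subseteq> GL n"
    unfolding topspace_def openin_zariski_GL by blast
  have "openin (zariski_GL n) (GL n)"
    unfolding openin_zariski_GL
    by (rule exI[of _ "{\<lambda>_. 1}"]) (auto intro: poly_fun.const)
  thus "GL n \<subseteq> topspace (zariski_GL n)" by (rule openin_subset)
qed

text \<open>
  The flag variety \<open>GL\<^sub>n/B\<close>: the quotient topology along \<open>g \<mapsto> g E\<^sub>\<bullet>\<close>.
\<close>

definition flag_variety :: "nat \<Rightarrow> flag topology" where
  "flag_variety n = topology (\<lambda>U. U \<subseteq> Flags n \<and>
     openin (zariski_GL n) {g \<in> GL n. flag_act n g (std_flag n) \<in> U})"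

lemma istopology_flag_variety:
  "istopology (\<lambda>U. U \<subseteq> Flags n \<and>
     openin (zariski_GL n) {g \<in> GL n. flag_act n g (std_flag n) \<in> U})"
  unfolding istopology_def
proof (intro conjI allI impI)
  fix S T
  assume S: "S \<subseteq> Flags n \<and> openin (zariski_GL n) {g \<in> GL n. flag_act n g (std_flag n) \<in> S}"
    and T: "T \<subseteq> Flags n \<and> openin (zariski_GL n) {g \<in> GL n. flag_act n g (std_flag n) \<in> T}"
  show "S \<inter> T \<subseteq> Flags n" using S by blast
  have "{g \<in> GL n. flag_act n g (std_flag n) \<in> S \<inter> T} =
      {g \<in> GL n. flag_act n g (std_flag n) \<in> S} \<inter> {g \<in> GL n. flag_act n g (std_flag n) \<in> T}"
    by blast
  thus "openin (zariski_GL n) {g \<in> GL n. flag_act n g (std_flag n) \<in> S \<inter> T}"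
    by (simp only:) (intro openin_Int conjunct2[OF S] conjunct2[OF T])
next
  fix K
  assume K: "\<forall>S\<in>K. S \<subseteq> Flags n \<and> openin (zariski_GL n) {g \<in> GL n. flag_act n g (std_flag n) \<in> S}"
  show "\<Union>K \<subseteq> Flags n" using K by blast
  have "{g \<in> GL n. flag_act n g (std_flag n) \<in> \<Union>K} =
      \<Union>((\<lambda>S. {g \<in> GL n. flag_act n g (std_flag n) \<in> S}) ` K)"
    by blast
  thus "openin (zariski_GL n) {g \<in> GL n. flag_act n g (std_flag n) \<in> \<Union>K}"
    by (simp only:) (rule openin_Union, erule imageE, use K in simp)
qed

lemma openin_flag_variety:
  "openin (flag_variety n) U \<longleftrightarrow>
     U \<subseteq> Flags n \<and> openin (zariski_GL n) {g \<in> GL n. flag_act n g (std_flag n) \<in> U}"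
  unfolding flag_variety_def by (simp add: topology_inverse'[OF istopology_flag_variety])

definition irreducible_in :: "'a topology \<Rightarrow> 'a set \<Rightarrow> bool" where
  "irreducible_in X Z \<longleftrightarrow> Z \<subseteq> topspace X \<and> Z \<noteq> {} \<and>
     (\<forall>A B. closedin X A \<and> closedin X B \<and> Z \<subseteq> A \<union> B \<longrightarrow> Z \<subseteq> A \<or> Z \<subseteq> B)"

text \<open>
  Krull dimension: the supremum of the lengths \<open>k\<close> of chains \<open>Z\<^sub>0 \<subset> \<dots> \<subset> Z\<^sub>k\<close> of irreducible
  closed subsets. (The empty space gets dimension 0 here; it is only used for nonempty spaces.)
\<close>

definition krull_dim :: "'a topology \<Rightarrow> enat" where
  "krull_dim X = Sup {enat k | k. \<exists>Z :: nat \<Rightarrow> 'a set.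
     (\<forall>i\<le>k. closedin X (Z i) \<and> irreducible_in X (Z i)) \<and> (\<forall>i<k. Z i \<subset> Z (Suc i))}"

definition flag_dim :: "nat \<Rightarrow> flag set \<Rightarrow> enat" where
  "flag_dim n S = krull_dim (subtopology (flag_variety n) S)"

end

theory Submission
  imports Defs "Jordan_Normal_Form.DL_Rank"
begin

text \<open>
  In the basis \<open>f\<^sub>k = e\<^bsub>w(k)\<^esub>\<close>, a flag of the cell of \<open>w\<close> has a unique basis
  \<open>v\<^sub>j = f\<^sub>j + \<Sum>\<^sub>k a\<^bsub>kj\<^esub> f\<^sub>k\<close>, the sum being over the \<open>k > j\<close> whose box precedes that of \<open>j\<close> in the
  base filling. The coordinates \<open>a\<^bsub>kj\<^esub>\<close> are quotients of minors, so the cell is an affine space also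
  topologically. Give \<open>a\<^bsub>kj\<^esub>\<close> the displacement from box \<open>k\<close> to box \<open>j\<close> as weight. The Hessenberg
  condition is then a system of weighted homogeneous equations: for \<open>l\<close> directly left of \<open>r\<close> and
  \<open>k > h(r)\<close> there is one equation, and it expresses \<open>a\<^bsub>kl\<^esub>\<close> by coordinates of smaller weight or
  further to the right. Hence the intersection is the graph of a polynomial map, and the free
  coordinates are the Hessenberg inversions.

  If the columns of an \<open>h\<close>-strict filling are sorted, it remains \<open>h\<close>-strict. Sorting preserves the
  number of pairs that satisfy the conditions on an inversion except the one on the order of the two
  entries within a common column, because this number depends only on the sets of entries of the
  columns; in a sorted filling all these pairs are inversions, whereas in the rightmost unsorted
  column some adjacent pair is not.

  An affine space has the expected Krull dimension because functions separating the members of a chain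
  of irreducible closed sets are algebraically independent, which bounds their number by counting
  monomials.
\<close>

section \<open>Polynomial functions and the dimension of affine space\<close>

text \<open>The flag variety carries a quotient topology of \<open>GL n\<close>, so a bijection of
  the cell with an affine space does not yet compare closed sets. Every polynomial in the
  coordinates has to be realized on an open set of flags; this is why the coordinates are extended,
  as quotients of minors invariant under the Borel group, to all flags on which the denominators do
  not vanish.

  The weights work because positions of boxes are chosen so that right neighbours lie at one
  constant distance: \<open>X\<close> moves every box one column to the left and hence respects
  displacements. The equations can be solved because \<open>X v_r\<close> has leading term
  \<open>v_l\<close> with coefficient 1, so that \<open>a_kl\<close> enters with coefficient -1. The
  only other coordinate of the same weight is \<open>a_sr\<close> with \<open>s\<close> directly
  right of \<open>k\<close>, whence the tie-break "further to the right".

  The hypothesis \<open>h i < i\<close> makes the rows of an \<open>h\<close>-strict filling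
  increase, so a nonstandard filling must fail in a column.\<close>

inductive_set mpoly_fun :: "'i set \<Rightarrow> (('i \<Rightarrow> complex) \<Rightarrow> complex) set" for I :: "'i set" where
  const: "(\<lambda>_. c) \<in> mpoly_fun I"
| coord: "i \<in> I \<Longrightarrow> (\<lambda>x. x i) \<in> mpoly_fun I"
| add: "f \<in> mpoly_fun I \<Longrightarrow> g \<in> mpoly_fun I \<Longrightarrow> (\<lambda>x. f x + g x) \<in> mpoly_fun I"
| mult: "f \<in> mpoly_fun I \<Longrightarrow> g \<in> mpoly_fun I \<Longrightarrow> (\<lambda>x. f x * g x) \<in> mpoly_fun I"

text \<open>Points are total functions vanishing off \<open>I\<close>, so that the spaces of smaller
  index sets are literally subsets of it; the chain of coordinate subspaces relies on this.\<close>

definition coord_space :: "'i set \<Rightarrow> ('i \<Rightarrow> complex) set" where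
  "coord_space I = {x. \<forall>i. i \<notin> I \<longrightarrow> x i = 0}"

lemma mpoly_fun_mono: "f \<in> mpoly_fun I \<Longrightarrow> I \<subseteq> J \<Longrightarrow> f \<in> mpoly_fun J"
  by (induction rule: mpoly_fun.induct) (auto intro: mpoly_fun.intros)

lemma mpoly_fun_diff:
  assumes "f \<in> mpoly_fun I" "g \<in> mpoly_fun I"
  shows "(\<lambda>x. f x - g x) \<in> mpoly_fun I"
  using mpoly_fun.add[OF assms(1) mpoly_fun.mult[OF mpoly_fun.const[of "-1"] assms(2)]] by simp

lemma mpoly_fun_sum:
  assumes "\<And>j. j \<in> J \<Longrightarrow> f j \<in> mpoly_fun I"
  shows "(\<lambda>x. \<Sum>j\<in>J. f j x) \<in> mpoly_fun I"
  using assms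
  by (induction J rule: infinite_finite_induct) (auto intro: mpoly_fun.intros)

lemma mpoly_fun_prod:
  assumes "\<And>j. j \<in> J \<Longrightarrow> f j \<in> mpoly_fun I"
  shows "(\<lambda>x. \<Prod>j\<in>J. f j x) \<in> mpoly_fun I"
  using assms
  by (induction J rule: infinite_finite_induct) (auto intro: mpoly_fun.intros)

lemma mpoly_fun_power: "f \<in> mpoly_fun I \<Longrightarrow> (\<lambda>x. f x ^ k) \<in> mpoly_fun I"
  by (induction k) (auto intro: mpoly_fun.intros)

lemma mpoly_fun_compose:
  assumes "f \<in> mpoly_fun I" and "\<And>i. i \<in> I \<Longrightarrow> (\<lambda>x. g x i) \<in> mpoly_fun J"
  shows "(\<lambda>x. f (g x)) \<in> mpoly_fun J"
  using assms by (induction rule: mpoly_fun.induct) (auto intro: mpoly_fun.intros)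

lemma mpoly_fun_cong:
  assumes "f \<in> mpoly_fun I" and "\<And>i. i \<in> I \<Longrightarrow> x i = y i"
  shows "f x = f y"
  using assms by (induction rule: mpoly_fun.induct) auto

lemma mpoly_fun_on_line:
  assumes "f \<in> mpoly_fun I"
  obtains p where "\<And>t. poly p t = f (\<lambda>i. x i + t * (y i - x i))"
proof -
  from assms have "\<exists>p. \<forall>t. poly p t = f (\<lambda>i. x i + t * (y i - x i))"
  proof (induction rule: mpoly_fun.induct)
    case (const c)
    show ?case by (rule exI[of _ "[:c:]"]) simp
  next
    case (coord i)
    show ?case by (rule exI[of _ "[:x i, y i - x i:]"]) simp
  next
    case (add f g)
    then show ?case by (metis poly_add)
  next
    case (mult f g)
    then show ?case by (metis poly_mult)
  qed
  then show thesis using that by blast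
qed

text \<open>If \<open>f x\<close> and \<open>g y\<close> are nonzero, then \<open>f\<close> and
  \<open>g\<close> restrict to nonzero univariate polynomials on the line through \<open>x\<close>
  and \<open>y\<close>, and their product cannot vanish at every complex number.\<close>

lemma mpoly_fun_no_zero_divisors:
  assumes f: "f \<in> mpoly_fun I" and g: "g \<in> mpoly_fun I"
    and line: "\<And>x y t. x \<in> W \<Longrightarrow> y \<in> W \<Longrightarrow> (\<lambda>i. x i + t * (y i - x i)) \<in> W"
    and fg: "\<And>x. x \<in> W \<Longrightarrow> f x * g x = 0"
  shows "(\<forall>x\<in>W. f x = 0) \<or> (\<forall>x\<in>W. g x = 0)"
proof (rule ccontr)
  assume "\<not> ?thesis"
  then obtain x y where xy: "x \<in> W" "y \<in> W" "f x \<noteq> 0" "g y \<noteq> 0" by blast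
  obtain p where p: "poly p t = f (\<lambda>i. x i + t * (y i - x i))" for t
    by (rule mpoly_fun_on_line[OF f, of x y]) blast
  obtain q where q: "poly q t = g (\<lambda>i. x i + t * (y i - x i))" for t
    by (rule mpoly_fun_on_line[OF g, of x y]) blast
  have "poly (p * q) t = 0" for t
    using fg[OF line[OF xy(1,2), of t]] p[of t] q[of t] by simp
  then have "p * q = 0" by (simp only: poly_all_0_iff_0[symmetric]) simp
  moreover have "p \<noteq> 0" using p[of 0] xy(3) by auto
  moreover have "q \<noteq> 0" using q[of 1] xy(4) by auto
  ultimately show False by simp
qed

text \<open>Gaussian elimination: an equation with a nonzero coefficient is solved for one unknown
  and substituted into the others, which lowers the number of equations and of unknowns by
  one.\<close>

lemma homogeneous_system_nontrivial_solution:
  fixes A :: "'i \<Rightarrow> 'j \<Rightarrow> 'a::field"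
  assumes "finite J" "finite I" "card J < card I"
  shows "\<exists>c. (\<exists>i\<in>I. c i \<noteq> 0) \<and> (\<forall>j\<in>J. (\<Sum>i\<in>I. c i * A i j) = 0)"
  using assms
proof (induction J arbitrary: I A rule: finite_induct)
  case empty
  then obtain i where "i \<in> I" by fastforce
  then show ?case by (intro exI[of _ "\<lambda>_. 1"]) auto
next
  case (insert b J)
  show ?case
  proof (cases "\<forall>i\<in>I. A i b = 0")
    case True
    have "card J < card I" using insert by simp
    from insert.IH[OF insert.prems(1) this, of A] True show ?thesis by auto
  next
    case False
    then obtain m where m: "m \<in> I" "A m b \<noteq> 0" by blast
    let ?I = "I - {m}"
    have "finite ?I" "card J < card ?I" using insert m by auto
    \<comment> \<open>These coefficients remain after the unknown \<open>m\<close> has been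
      eliminated by means of equation \<open>b\<close>.\<close>
    from insert.IH[OF this, of "\<lambda>i j. A i j - A i b / A m b * A m j"]
    obtain c where c: "\<exists>i\<in>?I. c i \<noteq> 0"
      "\<And>j. j \<in> J \<Longrightarrow> (\<Sum>i\<in>?I. c i * (A i j - A i b / A m b * A m j)) = 0" by blast
    let ?c = "c(m := - (\<Sum>i\<in>?I. c i * A i b) / A m b)"
    have sum: "(\<Sum>i\<in>I. ?c i * A i j) =
        (\<Sum>i\<in>?I. c i * (A i j - A i b / A m b * A m j))" for j
    proof -
      have "(\<Sum>i\<in>I. ?c i * A i j) = ?c m * A m j + (\<Sum>i\<in>?I. ?c i * A i j)"
        using insert.prems(1) m(1) by (rule sum.remove)
      also have "(\<Sum>i\<in>?I. ?c i * A i j) = (\<Sum>i\<in>?I. c i * A i j)"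
        by (rule sum.cong) auto
      also have "?c m * A m j + \<dots> = (\<Sum>i\<in>?I. c i * A i j)
          - (\<Sum>i\<in>?I. c i * A i b) * (A m j / A m b)"
        by simp
      also have "\<dots> = (\<Sum>i\<in>?I. c i * (A i j - A i b / A m b * A m j))"
        unfolding sum_distrib_right sum_subtractf[symmetric]
        by (rule sum.cong) (auto simp: field_simps)
      finally show ?thesis .
    qed
    have "(\<Sum>i\<in>I. ?c i * A i b) = 0"
      unfolding sum using m(2) by simp
    moreover have "\<exists>i\<in>I. ?c i \<noteq> 0" using c(1) by auto
    ultimately show ?thesis using c(2) by (intro exI[of _ ?c]) (auto simp only: sum)
  qed
qed

section \<open>Degree bounds and counting of monomials\<close>

definition bounded_exponents :: "'i set \<Rightarrow> nat \<Rightarrow> ('i \<Rightarrow> nat) set" where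
  "bounded_exponents I d = I \<rightarrow>\<^sub>E {..d}"

lemma finite_bounded_exponents: "finite I \<Longrightarrow> finite (bounded_exponents I d)"
  unfolding bounded_exponents_def by (rule finite_PiE) auto

lemma card_bounded_exponents: "finite I \<Longrightarrow> card (bounded_exponents I d) = Suc d ^ card I"
  unfolding bounded_exponents_def by (simp add: card_PiE)

text \<open>The degree is bounded in each variable separately, because the admissible exponents then
  form a product set whose size is exactly a power.\<close>

inductive_set bounded_degree :: "'i set \<Rightarrow> nat \<Rightarrow> (('i \<Rightarrow> complex) \<Rightarrow> complex) set"
  for I :: "'i set" and d :: nat where
  zero: "(\<lambda>_. 0) \<in> bounded_degree I d"
| add: "f \<in> bounded_degree I d \<Longrightarrow> m \<in> bounded_exponents I d \<Longrightarrow>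
    (\<lambda>x. f x + c * (\<Prod>i\<in>I. x i ^ m i)) \<in> bounded_degree I d"

lemma bounded_degree_add:
  assumes "g \<in> bounded_degree I d" "f \<in> bounded_degree I d"
  shows "(\<lambda>x. f x + g x) \<in> bounded_degree I d"
  using assms
proof (induction rule: bounded_degree.induct)
  case (add g m c)
  from bounded_degree.add[OF add.IH[OF add.prems] add.hyps(2), of c] show ?case
    by (simp add: add.assoc)
qed auto

lemma bounded_degree_mono:
  assumes "f \<in> bounded_degree I d" "d \<le> e"
  shows "f \<in> bounded_degree I e"
  using assms
proof (induction rule: bounded_degree.induct)
  case (add f m c)
  have "m \<in> bounded_exponents I e"
    using add.hyps(2) add.prems unfolding bounded_exponents_def PiE_iff by fastforce
  from bounded_degree.add[OF add.IH[OF add.prems] this] show ?case .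
qed (rule bounded_degree.zero)

lemma bounded_degree_mult_monomial:
  assumes "finite I" "f \<in> bounded_degree I d" "m \<in> bounded_exponents I e"
  shows "(\<lambda>x. f x * (c * (\<Prod>i\<in>I. x i ^ m i))) \<in> bounded_degree I (d + e)"
  using assms(2)
proof (induction rule: bounded_degree.induct)
  case (add f m' c')
  let ?m = "restrict (\<lambda>i. m' i + m i) I"
  have "?m \<in> bounded_exponents I (d + e)"
    using add.hyps(2) assms(3) unfolding bounded_exponents_def PiE_iff by (fastforce intro: add_mono)
  from bounded_degree.add[OF add.IH this, of "c' * c"]
  have "(\<lambda>x. f x * (c * (\<Prod>i\<in>I. x i ^ m i)) + c' * c * (\<Prod>i\<in>I. x i ^ ?m i))
      \<in> bounded_degree I (d + e)" .
  moreover have "(\<Prod>i\<in>I. x i ^ ?m i) = (\<Prod>i\<in>I. x i ^ m' i) * (\<Prod>i\<in>I. x i ^ m i)"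
    for x :: "'a \<Rightarrow> complex"
    unfolding prod.distrib[symmetric] by (rule prod.cong) (auto simp: power_add)
  ultimately show ?case by (simp add: algebra_simps)
qed (simp add: bounded_degree.zero)

lemma bounded_degree_mult:
  assumes "finite I" "g \<in> bounded_degree I e" "f \<in> bounded_degree I d"
  shows "(\<lambda>x. f x * g x) \<in> bounded_degree I (d + e)"
  using assms(2)
proof (induction rule: bounded_degree.induct)
  case (add g m c)
  from bounded_degree_add[OF bounded_degree_mult_monomial[OF assms(1,3) add.hyps(2), of c] add.IH]
  show ?case by (simp add: algebra_simps)
qed (simp add: bounded_degree.zero)

lemma bounded_degree_const: "(\<lambda>_. c) \<in> bounded_degree I d"
  using bounded_degree.add[OF bounded_degree.zero, of "\<lambda>i\<in>I. 0" I d c]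
  by (auto simp: bounded_exponents_def)

lemma bounded_degree_power:
  assumes "finite I" "f \<in> bounded_degree I d"
  shows "(\<lambda>x. f x ^ k) \<in> bounded_degree I (k * d)"
proof (induction k)
  case (Suc k)
  from bounded_degree_mult[OF assms(1) Suc assms(2)] show ?case by simp
qed (simp add: bounded_degree_const)

lemma bounded_degree_prod:
  assumes "finite I" "finite J" "\<And>j. j \<in> J \<Longrightarrow> f j \<in> bounded_degree I (d j)"
  shows "(\<lambda>x. \<Prod>j\<in>J. f j x) \<in> bounded_degree I (\<Sum>j\<in>J. d j)"
  using assms(2,3)
proof (induction J rule: finite_induct)
  case (insert j J)
  have "(\<lambda>x. \<Prod>j\<in>J. f j x) \<in> bounded_degree I (sum d J)" "f j \<in> bounded_degree I (d j)"
    using insert by auto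
  from bounded_degree_mult[OF assms(1) this] insert.hyps show ?case by simp
qed (simp add: bounded_degree_const)

lemma mpoly_fun_bounded_degree:
  assumes "finite I" "f \<in> mpoly_fun I"
  shows "\<exists>d. f \<in> bounded_degree I d"
  using assms(2)
proof (induction rule: mpoly_fun.induct)
  case (const c)
  show ?case using bounded_degree_const by blast
next
  case (coord i)
  let ?m = "\<lambda>j\<in>I. if j = i then 1 else 0 :: nat"
  have "?m \<in> bounded_exponents I 1" by (auto simp: bounded_exponents_def)
  from bounded_degree.add[OF bounded_degree.zero this, of 1]
  have "(\<lambda>x. \<Prod>j\<in>I. x j ^ ?m j) \<in> bounded_degree I 1" by simp
  moreover have "(\<Prod>j\<in>I. x j ^ ?m j) = x i" for x :: "'a \<Rightarrow> complex"
  proof -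
    have "(\<Prod>j\<in>I. x j ^ ?m j) = (\<Prod>j\<in>I. if j = i then x j else 1)"
      by (rule prod.cong) auto
    also have "\<dots> = x i" using assms(1) coord by (simp add: prod.delta)
    finally show ?thesis .
  qed
  ultimately show ?case by auto
next
  case (add f g)
  then obtain d e where "f \<in> bounded_degree I d" "g \<in> bounded_degree I e" by blast
  then have "f \<in> bounded_degree I (max d e)" "g \<in> bounded_degree I (max d e)"
    by (auto intro: bounded_degree_mono)
  then show ?case using bounded_degree_add by blast
next
  case (mult f g)
  then show ?case using bounded_degree_mult[OF assms(1)] by blast
qed

text \<open>Passes from the inductive description to a coefficient vector, on which the linear
  algebra can act.\<close>

lemma bounded_degree_coeffs:
  assumes "finite I" "f \<in> bounded_degree I d"
  shows "\<exists>c. \<forall>x. f x = (\<Sum>m\<in>bounded_exponents I d. c m * (\<Prod>i\<in>I. x i ^ m i))"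
  using assms(2)
proof (induction rule: bounded_degree.induct)
  case zero
  show ?case by (rule exI[of _ "\<lambda>_. 0"]) simp
next
  case (add f m a)
  then obtain c where c: "\<And>x. f x = (\<Sum>m\<in>bounded_exponents I d. c m * (\<Prod>i\<in>I. x i ^ m i))"
    by blast
  have fin: "finite (bounded_exponents I d)" using finite_bounded_exponents[OF assms(1)] .
  show ?case
  proof (intro exI allI)
    fix x :: "'a \<Rightarrow> complex"
    let ?p = "\<lambda>m. \<Prod>i\<in>I. x i ^ m i"
    have "(\<Sum>m'\<in>bounded_exponents I d. (c(m := c m + a)) m' * ?p m') =
        (\<Sum>m'\<in>bounded_exponents I d. c m' * ?p m' + (if m' = m then a * ?p m else 0))"
      by (rule sum.cong) (auto simp: algebra_simps)
    also have "\<dots> = f x + a * ?p m"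
      using fin add.hyps(2) by (simp add: sum.distrib sum.delta c)
    finally show "f x + a * ?p m =
      (\<Sum>m'\<in>bounded_exponents I d. (c(m := c m + a)) m' * ?p m')" by simp
  qed
qed

text \<open>
  A relation among the \<open>f i\<close>, ordered by powers of the last one, restricts to \<open>W k\<close> (where that
  one vanishes) after cancelling the smallest power.
\<close>

lemma chain_functions_independent:
  fixes W :: "nat \<Rightarrow> ('i \<Rightarrow> complex) set" and f :: "nat \<Rightarrow> ('i \<Rightarrow> complex) \<Rightarrow> complex"
  assumes prime: "\<And>j g g'. j \<le> k \<Longrightarrow> g \<in> mpoly_fun I \<Longrightarrow> g' \<in> mpoly_fun I \<Longrightarrow>
      (\<And>x. x \<in> W j \<Longrightarrow> g x * g' x = 0) \<Longrightarrow> (\<forall>x\<in>W j. g x = 0) \<or> (\<forall>x\<in>W j. g' x = 0)"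
    and mono: "\<And>j. j < k \<Longrightarrow> W j \<subseteq> W (Suc j)"
    and ne: "W 0 \<noteq> {}"
    and f: "\<And>j. j < k \<Longrightarrow> f j \<in> mpoly_fun I"
    and f0: "\<And>j x. j < k \<Longrightarrow> x \<in> W j \<Longrightarrow> f j x = 0"
    and f1: "\<And>j. j < k \<Longrightarrow> \<exists>x\<in>W (Suc j). f j x \<noteq> 0"
    and "\<And>x. x \<in> W k \<Longrightarrow>
      (\<Sum>e\<in>bounded_exponents {..<k} q. c e * (\<Prod>i<k. f i x ^ e i)) = 0"
    and "e \<in> bounded_exponents {..<k} q"
  shows "c e = 0"
  using assms
proof (induction k arbitrary: c e)
  case 0
  then show ?case by (auto simp: bounded_exponents_def)
next
  case (Suc k)
  let ?E = "bounded_exponents {..<k} q"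
  \<comment> \<open>\<open>S t\<close> is the coefficient of the \<open>t\<close>-th power of
    \<open>f k\<close> in the relation, itself a combination of products of the earlier
    functions.\<close>
  define S where "S = (\<lambda>t x. \<Sum>e\<in>?E. c (e(k := t)) * (\<Prod>i<k. f i x ^ e i))"
  have SI: "S t \<in> mpoly_fun I" for t
    unfolding S_def using Suc.prems(4)
    by (intro mpoly_fun_sum mpoly_fun.mult mpoly_fun.const mpoly_fun_prod mpoly_fun_power) simp
  have insert: "{..<Suc k} = insert k {..<k}" by auto
  have rel: "(\<Sum>t\<le>q. f k x ^ t * S t x) = 0" if "x \<in> W (Suc k)" for x
  proof -
    \<comment> \<open>An exponent family on \<open>{..<Suc k}\<close> splits uniquely into its value
      at \<open>k\<close> and a family on \<open>{..<k}\<close>; the latter is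
      \<open>undefined\<close> at \<open>k\<close>, so the update there loses no
      information.\<close>
    have inj: "inj_on (\<lambda>(t, e). e(k := t)) ({..q} \<times> ?E)"
    proof (rule inj_onI, clarify)
      fix t e t' e'
      assume *: "e \<in> ?E" "e' \<in> ?E" "e(k := t) = e'(k := t')"
      have "e i = e' i" for i
      proof (cases "i = k")
        case True
        then show ?thesis using *(1,2) by (auto simp: bounded_exponents_def PiE_iff extensional_def)
      next
        case False
        then show ?thesis using fun_cong[OF *(3), of i] by simp
      qed
      then show "t = t' \<and> e = e'" using fun_cong[OF *(3), of k] by auto
    qed
    have "0 = (\<Sum>e\<in>bounded_exponents {..<Suc k} q. c e * (\<Prod>i<Suc k. f i x ^ e i))"
      using Suc.prems(7)[OF that] by simp
    also have "bounded_exponents {..<Suc k} q = (\<lambda>(t, e). e(k := t)) ` ({..q} \<times> ?E)"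
      unfolding bounded_exponents_def insert PiE_insert_eq ..
    also have "(\<Sum>e\<in>\<dots>. c e * (\<Prod>i<Suc k. f i x ^ e i)) =
        (\<Sum>(t, e)\<in>{..q} \<times> ?E. c (e(k := t)) * (\<Prod>i<Suc k. f i x ^ (e(k := t)) i))"
      by (subst sum.reindex[OF inj]) (simp add: case_prod_unfold)
    also have "\<dots> = (\<Sum>t\<le>q. \<Sum>e\<in>?E. c (e(k := t)) * (\<Prod>i<Suc k. f i x ^ (e(k := t)) i))"
      by (simp add: sum.cartesian_product)
    also have "\<dots> = (\<Sum>t\<le>q. f k x ^ t * S t x)"
      unfolding S_def sum_distrib_left by (intro sum.cong) auto
    finally show ?thesis by simp
  qed
  \<comment> \<open>Since \<open>f k\<close> is not identically zero on \<open>W (Suc k)\<close>,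
    neither is any power of it, and primality lets such a power be cancelled.\<close>
  have pow: "\<not> (\<forall>x\<in>W (Suc k). f k x ^ t = 0)" for t
  proof
    assume "\<forall>x\<in>W (Suc k). f k x ^ t = 0"
    then have "\<forall>x\<in>W (Suc k). f k x = 0" by auto
    then show False using Suc.prems(6)[of k] by auto
  qed
  have zero: "\<forall>e\<in>?E. c (e(k := t)) = 0" if "t \<le> q" for t
    using that
  proof (induction t rule: less_induct)
    case (less t)
    have S0: "S s x = 0" if "s < t" for s x
    proof -
      have "\<forall>e\<in>?E. c (e(k := s)) = 0" using less.IH[OF that] less.prems that by linarith
      then show ?thesis unfolding S_def by (intro sum.neutral ballI) (simp only: mult_zero_left)
    qed
    have "f k x ^ t * (\<Sum>s\<in>{t..q}. f k x ^ (s - t) * S s x) = 0" if x: "x \<in> W (Suc k)" for x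
    proof -
      have "f k x ^ t * (\<Sum>s\<in>{t..q}. f k x ^ (s - t) * S s x) = (\<Sum>s\<in>{t..q}. f k x ^ s * S s x)"
        unfolding sum_distrib_left
        by (rule sum.cong) (auto simp: mult.assoc[symmetric] power_add[symmetric])
      also have "\<dots> = (\<Sum>s\<le>q. f k x ^ s * S s x)"
        by (rule sum.mono_neutral_left) (auto simp: S0)
      finally show ?thesis using rel[OF x] by simp
    qed
    moreover have "(\<lambda>x. \<Sum>s\<in>{t..q}. f k x ^ (s - t) * S s x) \<in> mpoly_fun I"
      using SI Suc.prems(4) by (intro mpoly_fun_sum mpoly_fun.mult mpoly_fun_power) auto
    moreover have "(\<lambda>x. f k x ^ t) \<in> mpoly_fun I"
      using Suc.prems(4) by (intro mpoly_fun_power) auto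
    ultimately have "\<forall>x\<in>W (Suc k). (\<Sum>s\<in>{t..q}. f k x ^ (s - t) * S s x) = 0"
      using Suc.prems(1)[of "Suc k" "\<lambda>x. f k x ^ t" "\<lambda>x. \<Sum>s\<in>{t..q}. f k x ^ (s - t) * S s x"] pow
      by blast
    \<comment> \<open>On \<open>W k\<close> the function \<open>f k\<close> vanishes, so only the
      summand with exponent \<open>s - t = 0\<close> survives.\<close>
    moreover have "(\<Sum>s\<in>{t..q}. f k x ^ (s - t) * S s x) = S t x" if "x \<in> W k" for x
    proof -
      have "(\<Sum>s\<in>{t..q}. f k x ^ (s - t) * S s x) = (\<Sum>s\<in>{t..q}. if s = t then S t x else 0)"
        using Suc.prems(5)[of k x] that by (intro sum.cong) auto
      then show ?thesis using less.prems by simp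
    qed
    ultimately have St: "S t x = 0" if "x \<in> W k" for x
      using Suc.prems(2)[of k] that by (metis lessI subsetD)
    show ?case
    proof
      fix e assume "e \<in> ?E"
      show "c (e(k := t)) = 0"
      proof (rule Suc.IH[of "\<lambda>e. c (e(k := t))"])
        show "(\<Sum>e\<in>?E. c (e(k := t)) * (\<Prod>i<k. f i x ^ e i)) = 0" if "x \<in> W k" for x
          using St[OF that] by (simp add: S_def)
      qed (use Suc.prems \<open>e \<in> ?E\<close> in auto)
    qed
  qed
  from Suc.prems(8) obtain t e' where "t \<le> q" "e' \<in> ?E" "e = e'(k := t)"
    unfolding bounded_exponents_def insert PiE_insert_eq by auto
  then show ?case using zero by blast
qed

text \<open>Exponents up to \<open>q\<close> give \<open>Suc q ^ k\<close> products of the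
  \<open>f i\<close>, all of them combinations of \<open>Suc (q * D) ^ card I\<close> monomials. If
  \<open>k > card I\<close>, a large \<open>q\<close> makes the products outnumber the monomials,
  and the resulting nontrivial relation contradicts independence.\<close>

lemma chain_length_le:
  fixes W :: "nat \<Rightarrow> ('i \<Rightarrow> complex) set" and f :: "nat \<Rightarrow> ('i \<Rightarrow> complex) \<Rightarrow> complex"
  assumes I: "finite I"
    and prime: "\<And>j g g'. j \<le> k \<Longrightarrow> g \<in> mpoly_fun I \<Longrightarrow> g' \<in> mpoly_fun I \<Longrightarrow>
      (\<And>x. x \<in> W j \<Longrightarrow> g x * g' x = 0) \<Longrightarrow> (\<forall>x\<in>W j. g x = 0) \<or> (\<forall>x\<in>W j. g' x = 0)"
    and mono: "\<And>j. j < k \<Longrightarrow> W j \<subseteq> W (Suc j)"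
    and ne: "W 0 \<noteq> {}"
    and f: "\<And>j. j < k \<Longrightarrow> f j \<in> mpoly_fun I"
    and f0: "\<And>j x. j < k \<Longrightarrow> x \<in> W j \<Longrightarrow> f j x = 0"
    and f1: "\<And>j. j < k \<Longrightarrow> \<exists>x\<in>W (Suc j). f j x \<noteq> 0"
  shows "k \<le> card I"
proof (rule ccontr)
  assume "\<not> k \<le> card I"
  then have kI: "Suc (card I) \<le> k" by simp
  have "\<forall>j\<in>{..<k}. \<exists>d. f j \<in> bounded_degree I d"
    using mpoly_fun_bounded_degree[OF I f] by auto
  then obtain d where d: "\<And>j. j < k \<Longrightarrow> f j \<in> bounded_degree I (d j)"
    by (metis lessThan_iff)
  \<comment> \<open>The \<open>Suc\<close> keeps \<open>D\<close> positive, which is what gives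
    \<open>Suc (q * D) \<le> Suc q * D\<close>.\<close>
  define D where "D = Suc (\<Sum>j<k. d j)"
  \<comment> \<open>With this \<open>q\<close>, the bound \<open>(Suc q * D) ^ card I\<close>
    becomes \<open>Suc q ^ card I * q\<close>, just below
    \<open>Suc q ^ Suc (card I)\<close>.\<close>
  define q where "q = D ^ card I"
  let ?E = "bounded_exponents {..<k} q" and ?M = "bounded_exponents I (q * D)"
  have "(\<lambda>x. \<Prod>i<k. f i x ^ e i) \<in> bounded_degree I (q * D)" if "e \<in> ?E" for e
  proof (rule bounded_degree_mono)
    show "(\<lambda>x. \<Prod>i<k. f i x ^ e i) \<in> bounded_degree I (\<Sum>i<k. e i * d i)"
      using d by (intro bounded_degree_prod bounded_degree_power I) auto
    have "(\<Sum>i<k. e i * d i) \<le> (\<Sum>i<k. q * d i)"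
      using that by (intro sum_mono mult_right_mono) (auto simp: bounded_exponents_def PiE_iff)
    also have "\<dots> \<le> q * D" by (simp add: D_def sum_distrib_left[symmetric])
    finally show "(\<Sum>i<k. e i * d i) \<le> q * D" .
  qed
  then have "\<forall>e\<in>?E. \<exists>a. \<forall>x. (\<Prod>i<k. f i x ^ e i) = (\<Sum>m\<in>?M. a m * (\<Prod>i\<in>I. x i ^ m i))"
    using bounded_degree_coeffs[OF I] by blast
  then obtain a where a: "\<And>e x. e \<in> ?E \<Longrightarrow>
      (\<Prod>i<k. f i x ^ e i) = (\<Sum>m\<in>?M. a e m * (\<Prod>i\<in>I. x i ^ m i))"
    by metis
  have "card ?M = Suc (q * D) ^ card I" by (rule card_bounded_exponents[OF I])
  also have "\<dots> \<le> (Suc q * D) ^ card I" by (rule power_mono) (auto simp: D_def)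
  also have "\<dots> = Suc q ^ card I * q" unfolding power_mult_distrib q_def ..
  also have "\<dots> < Suc q ^ card I * Suc q" by simp
  also have "\<dots> = Suc q ^ Suc (card I)" by simp
  also have "\<dots> \<le> Suc q ^ k" using kI by (intro power_increasing) auto
  also have "\<dots> = card ?E" by (simp add: card_bounded_exponents)
  finally have less: "card ?M < card ?E" .
  have finE: "finite ?E" and finM: "finite ?M"
    using I by (auto intro: finite_bounded_exponents)
  from homogeneous_system_nontrivial_solution[OF finM finE less, of a]
  obtain c where c: "\<exists>e\<in>?E. c e \<noteq> 0" "\<And>m. m \<in> ?M \<Longrightarrow> (\<Sum>e\<in>?E. c e * a e m) = 0" by blast
  have "(\<Sum>e\<in>?E. c e * (\<Prod>i<k. f i x ^ e i)) = 0" for x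
  proof -
    have "(\<Sum>e\<in>?E. c e * (\<Prod>i<k. f i x ^ e i)) =
        (\<Sum>e\<in>?E. \<Sum>m\<in>?M. c e * a e m * (\<Prod>i\<in>I. x i ^ m i))"
      by (rule sum.cong) (auto simp: a sum_distrib_left mult.assoc)
    also have "\<dots> = (\<Sum>m\<in>?M. (\<Sum>e\<in>?E. c e * a e m) * (\<Prod>i\<in>I. x i ^ m i))"
      by (subst sum.swap) (simp add: sum_distrib_right)
    also have "\<dots> = 0" by (simp add: c(2))
    finally show ?thesis .
  qed
  note rel = this
  have "c e = 0" if "e \<in> ?E" for e
  proof (rule chain_functions_independent[where I = I and W = W and f = f and k = k and q = q and c = c])
    show "(\<Sum>e\<in>?E. c e * (\<Prod>i<k. f i x ^ e i)) = 0" for x by (rule rel)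
    show "e \<in> ?E" by (rule that)
    show "(\<forall>x\<in>W j. g x = 0) \<or> (\<forall>x\<in>W j. g' x = 0)"
      if "j \<le> k" "g \<in> mpoly_fun I" "g' \<in> mpoly_fun I" "\<And>x. x \<in> W j \<Longrightarrow> g x * g' x = 0" for j g g'
      using that by (rule prime)
  qed (use mono ne f f0 f1 in simp_all)
  then show False using c(1) by blast
qed

section \<open>Krull dimension of an affine space\<close>

lemma coord_space_mono: "J \<subseteq> K \<Longrightarrow> coord_space J \<subseteq> coord_space K"
  unfolding coord_space_def by blast

lemma line_in_coord_space:
  "x \<in> coord_space J \<Longrightarrow> y \<in> coord_space J \<Longrightarrow> (\<lambda>i. x i + t * (y i - x i)) \<in> coord_space J"
  by (auto simp: coord_space_def)

text \<open>Matching closed sets with zero loci is all that is asked of \<open>\<phi>\<close>.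
  Closedness provides a polynomial vanishing on one member of a chain but not on the next, and
  irreducibility makes vanishing on a member a prime condition; this bounds the length. Coordinate
  subspaces along an enumeration of \<open>I\<close> form a chain that attains the bound.\<close>

lemma krull_dim_coord_space:
  fixes X :: "'a topology" and \<phi> :: "('i \<Rightarrow> complex) \<Rightarrow> 'a"
  assumes I: "finite I"
    and bij: "bij_betw \<phi> (coord_space I) (topspace X)"
    and closed: "\<And>C. C \<subseteq> topspace X \<Longrightarrow> closedin X C \<longleftrightarrow>
      (\<exists>F\<subseteq>mpoly_fun I. {x \<in> coord_space I. \<phi> x \<in> C} = {x \<in> coord_space I. \<forall>f\<in>F. f x = 0})"
  shows "krull_dim X = enat (card I)"
proof -
  let ?A = "coord_space I"
  have img: "\<phi> ` ?A = topspace X" and inj: "inj_on \<phi> ?A"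
    using bij by (auto simp: bij_betw_def)
  have closedD: "\<exists>F\<subseteq>mpoly_fun I. {x \<in> ?A. \<phi> x \<in> C} = {x \<in> ?A. \<forall>f\<in>F. f x = 0}"
    if "closedin X C" for C
    using closed[of C] closedin_subset[OF that] that by blast
  have closed_image: "closedin X (\<phi> ` {x \<in> ?A. \<forall>f\<in>F. f x = 0})" if "F \<subseteq> mpoly_fun I" for F
  proof -
    have "{x \<in> ?A. \<phi> x \<in> \<phi> ` {x \<in> ?A. \<forall>f\<in>F. f x = 0}} = {x \<in> ?A. \<forall>f\<in>F. f x = 0}"
      using inj by (auto dest: inj_onD)
    moreover have "\<phi> ` {x \<in> ?A. \<forall>f\<in>F. f x = 0} \<subseteq> topspace X" using img by blast
    ultimately show ?thesis using closed[THEN iffD2, OF _ exI, OF _ conjI, OF _ that] by simp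
  qed
  have upper: "k \<le> card I"
    if Z: "\<And>i. i \<le> k \<Longrightarrow> closedin X (Z i)" "\<And>i. i \<le> k \<Longrightarrow> irreducible_in X (Z i)"
      and less: "\<And>i. i < k \<Longrightarrow> Z i \<subset> Z (Suc i)" for k and Z :: "nat \<Rightarrow> 'a set"
  proof -
    let ?W = "\<lambda>i. {x \<in> ?A. \<phi> x \<in> Z i}"
    have ex: "\<exists>f. f \<in> mpoly_fun I \<and> (\<forall>x\<in>?W i. f x = 0) \<and> (\<exists>x\<in>?W (Suc i). f x \<noteq> 0)"
      if i: "i < k" for i
    proof -
      obtain F where F: "F \<subseteq> mpoly_fun I" "?W i = {x \<in> ?A. \<forall>f\<in>F. f x = 0}"
        using closedD[OF Z(1)[of i]] i by auto
      obtain y where y: "y \<in> Z (Suc i)" "y \<notin> Z i" using less[OF i] by blast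
      moreover have "Z (Suc i) \<subseteq> topspace X"
        using Z(1)[of "Suc i"] i by (simp add: closedin_subset)
      ultimately obtain x where x: "x \<in> ?A" "y = \<phi> x" using img by blast
      then have "x \<notin> ?W i" using y by simp
      then obtain f where "f \<in> F" "f x \<noteq> 0" using F(2) x by blast
      moreover have "x \<in> ?W (Suc i)" using x y by simp
      moreover have "\<forall>x\<in>?W i. f x = 0" using F(2) \<open>f \<in> F\<close> by blast
      ultimately show ?thesis using F(1) by blast
    qed
    define Q where "Q = (\<lambda>i f. f \<in> mpoly_fun I \<and> (\<forall>x\<in>?W i. f x = 0) \<and> (\<exists>x\<in>?W (Suc i). f x \<noteq> 0))"
    define f where "f = (\<lambda>i. SOME f. Q i f)"
    have Qf: "Q i (f i)" if "i < k" for i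
    proof -
      have "\<exists>f. Q i f" unfolding Q_def by (rule ex[OF that])
      then show ?thesis unfolding f_def by (rule someI_ex)
    qed
    have f: "f i \<in> mpoly_fun I" "\<forall>x\<in>?W i. f i x = 0" "\<exists>x\<in>?W (Suc i). f i x \<noteq> 0"
      if "i < k" for i
      using Qf[OF that] unfolding Q_def by simp_all
    have img_W: "Z i = \<phi> ` ?W i" if "i \<le> k" for i
      using closedin_subset[OF Z(1)[OF that]] img by (auto simp: image_iff)
    show "k \<le> card I"
    proof (rule chain_length_le[OF I, where W = ?W and f = f])
      show "?W 0 \<noteq> {}" using Z(2)[of 0] img_W[of 0] by (auto simp: irreducible_in_def)
    next
      fix j g g'
      assume j: "j \<le> k" and g: "g \<in> mpoly_fun I" "g' \<in> mpoly_fun I"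
        and gg: "\<And>x. x \<in> ?W j \<Longrightarrow> g x * g' x = 0"
      \<comment> \<open>The zero loci of \<open>g\<close> and \<open>g'\<close> are closed and cover
        \<open>Z j\<close>, so irreducibility puts \<open>Z j\<close> inside one of them.\<close>
      let ?Z = "\<lambda>g. \<phi> ` {x \<in> ?A. \<forall>f\<in>{g}. f x = 0}"
      have "Z j \<subseteq> ?Z g \<union> ?Z g'" using gg img_W[OF j] by fastforce
      moreover have "closedin X (?Z g)" "closedin X (?Z g')" using closed_image[of "{g}"] closed_image[of "{g'}"] g by simp_all
      ultimately have "Z j \<subseteq> ?Z g \<or> Z j \<subseteq> ?Z g'"
        using Z(2)[OF j] unfolding irreducible_in_def by blast
      then show "(\<forall>x\<in>?W j. g x = 0) \<or> (\<forall>x\<in>?W j. g' x = 0)"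
      proof
        assume "Z j \<subseteq> ?Z g"
        then have "\<forall>x\<in>?W j. g x = 0" using inj by (auto dest!: subsetD dest: inj_onD)
        then show ?thesis ..
      next
        assume "Z j \<subseteq> ?Z g'"
        then have "\<forall>x\<in>?W j. g' x = 0" using inj by (auto dest!: subsetD dest: inj_onD)
        then show ?thesis ..
      qed
    next
      show "?W j \<subseteq> ?W (Suc j)" if "j < k" for j using less[OF that] by blast
    qed (use f in simp_all)
  qed
  have lower: "\<exists>Z. (\<forall>i\<le>card I. closedin X (Z i) \<and> irreducible_in X (Z i)) \<and>
      (\<forall>i<card I. Z i \<subset> Z (Suc i))"
  proof -
    obtain \<xi> where \<xi>: "bij_betw \<xi> {0..<card I} I" using ex_bij_betw_nat_finite[OF I] by blast
    let ?J = "\<lambda>i. \<xi> ` {0..<i}"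
    have JI: "?J i \<subseteq> I" if "i \<le> card I" for i
      using \<xi> that by (auto simp: bij_betw_def)
    define Z where "Z = (\<lambda>i. \<phi> ` coord_space (?J i))"
    have sub: "coord_space (?J i) \<subseteq> ?A" if "i \<le> card I" for i
      by (rule coord_space_mono[OF JI[OF that]])
    have closedZ: "closedin X (Z i)" if "i \<le> card I" for i
    proof -
      have "coord_space (?J i) = {x \<in> ?A. \<forall>f\<in>(\<lambda>j x. x j) ` (I - ?J i). f x = 0}"
      proof (intro subset_antisym subsetI)
        fix x assume "x \<in> coord_space (?J i)"
        then show "x \<in> {x \<in> ?A. \<forall>f\<in>(\<lambda>j x. x j) ` (I - ?J i). f x = 0}"
          using sub[OF that] by (auto simp: coord_space_def)
      next
        fix x assume x: "x \<in> {x \<in> ?A. \<forall>f\<in>(\<lambda>j x. x j) ` (I - ?J i). f x = 0}"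
        have "x j = 0" if "j \<notin> ?J i" for j
          using x that by (cases "j \<in> I") (auto simp: coord_space_def)
        then show "x \<in> coord_space (?J i)" unfolding coord_space_def by blast
      qed
      moreover have "closedin X (\<phi> ` {x \<in> ?A. \<forall>f\<in>(\<lambda>j x. x j) ` (I - ?J i). f x = 0})"
        by (rule closed_image) (auto intro: mpoly_fun.coord)
      ultimately show ?thesis by (simp add: Z_def)
    qed
    have irr: "irreducible_in X (Z i)" if i: "i \<le> card I" for i
      unfolding irreducible_in_def
    proof (intro conjI allI impI)
      show "Z i \<subseteq> topspace X" using closedZ[OF i] by (rule closedin_subset)
      have "(\<lambda>_. 0) \<in> coord_space (?J i)" by (simp add: coord_space_def)
      then show "Z i \<noteq> {}" by (auto simp: Z_def)
      fix A B assume AB: "closedin X A \<and> closedin X B \<and> Z i \<subseteq> A \<union> B"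
      have AB': "closedin X A" "closedin X B" using AB by simp_all
      from closedD[OF AB'(1)] obtain F where
        F': "F \<subseteq> mpoly_fun I \<and> {x \<in> ?A. \<phi> x \<in> A} = {x \<in> ?A. \<forall>f\<in>F. f x = 0}" by (rule exE)
      from closedD[OF AB'(2)] obtain G where
        G': "G \<subseteq> mpoly_fun I \<and> {x \<in> ?A. \<phi> x \<in> B} = {x \<in> ?A. \<forall>f\<in>G. f x = 0}" by (rule exE)
      note F = conjunct1[OF F'] conjunct2[OF F'] and G = conjunct1[OF G'] conjunct2[OF G']
      show "Z i \<subseteq> A \<or> Z i \<subseteq> B"
      proof (rule ccontr)
        assume "\<not> ?thesis"
        then obtain x y where x: "x \<in> coord_space (?J i)" "\<phi> x \<notin> A"
          and y: "y \<in> coord_space (?J i)" "\<phi> y \<notin> B" by (auto simp: Z_def)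
        have "x \<in> ?A" "y \<in> ?A" using x(1) y(1) sub[OF i] by auto
        then have "x \<notin> {x \<in> ?A. \<forall>f\<in>F. f x = 0}" "y \<notin> {x \<in> ?A. \<forall>f\<in>G. f x = 0}"
          unfolding F(2)[symmetric] G(2)[symmetric] using x(2) y(2) by simp_all
        then obtain f g where f: "f \<in> F" "f x \<noteq> 0" and g: "g \<in> G" "g y \<noteq> 0"
          using \<open>x \<in> ?A\<close> \<open>y \<in> ?A\<close> by auto
        have "f z * g z = 0" if z: "z \<in> coord_space (?J i)" for z
        proof -
          have "z \<in> ?A" using z sub[OF i] by blast
          moreover have "\<phi> z \<in> A \<or> \<phi> z \<in> B" using z AB by (auto simp: Z_def)
          ultimately have "z \<in> {x \<in> ?A. \<forall>f\<in>F. f x = 0} \<or> z \<in> {x \<in> ?A. \<forall>f\<in>G. f x = 0}"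
            unfolding F(2)[symmetric] G(2)[symmetric] by simp
          then show ?thesis using f(1) g(1) by auto
        qed
        then have "(\<forall>x\<in>coord_space (?J i). f x = 0) \<or> (\<forall>x\<in>coord_space (?J i). g x = 0)"
          using F(1) G(1) f(1) g(1)
          by (intro mpoly_fun_no_zero_divisors[of f I g] line_in_coord_space) auto
        then show False using f g x y by blast
      qed
    qed
    have "Z i \<subset> Z (Suc i)" if i: "i < card I" for i
    proof -
      have "coord_space (?J i) \<subseteq> coord_space (?J (Suc i))"
        by (intro coord_space_mono image_mono) auto
      moreover have "(\<lambda>j. if j = \<xi> i then 1 else 0) \<in> coord_space (?J (Suc i)) - coord_space (?J i)"
      proof -
        have "\<xi> i \<notin> ?J i"
          using \<xi> i by (fastforce simp: bij_betw_def dest: inj_onD)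
        then show ?thesis by (auto simp: coord_space_def)
      qed
      ultimately have "coord_space (?J i) \<subset> coord_space (?J (Suc i))" by blast
      then show ?thesis unfolding Z_def
        using inj_on_subset[OF inj sub[of "Suc i"]] i by (intro image_strict_mono) simp_all
    qed
    then show ?thesis using closedZ irr by blast
  qed
  show ?thesis unfolding krull_dim_def
  proof (rule antisym)
    show "Sup {enat k | k. \<exists>Z. (\<forall>i\<le>k. closedin X (Z i) \<and> irreducible_in X (Z i)) \<and>
        (\<forall>i<k. Z i \<subset> Z (Suc i))} \<le> enat (card I)"
    proof (rule Sup_least, clarify)
      fix k and Z :: "nat \<Rightarrow> 'a set"
      assume "\<forall>i\<le>k. closedin X (Z i) \<and> irreducible_in X (Z i)" "\<forall>i<k. Z i \<subset> Z (Suc i)"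
      then have "k \<le> card I" by (intro upper[of k Z]) simp_all
      then show "enat k \<le> enat (card I)" by simp
    qed
    show "enat (card I) \<le> Sup {enat k | k. \<exists>Z. (\<forall>i\<le>k. closedin X (Z i) \<and> irreducible_in X (Z i)) \<and>
        (\<forall>i<k. Z i \<subset> Z (Suc i))}"
      using lower by (intro Sup_upper) blast
  qed
qed

section \<open>Coordinates of the Hessenberg condition\<close>

text \<open>Each \<open>q p\<close> reads only coordinates below \<open>p\<close>, so well-founded
  recursion computes the coordinates in \<open>D\<close> from the free ones. Inductions along
  \<open>R\<close> show that the result is polynomial in the free coordinates and the only
  solution.\<close>

lemma triangular_system_solution:
  fixes q :: "'i \<Rightarrow> ('i \<Rightarrow> complex) \<Rightarrow> complex"
  assumes wf: "wf R" and DP: "D \<subseteq> P"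
    and q: "\<And>p. p \<in> D \<Longrightarrow> q p \<in> mpoly_fun {p' \<in> P. (p', p) \<in> R}"
  obtains \<psi> where "bij_betw \<psi> (coord_space (P - D)) {a \<in> coord_space P. \<forall>p\<in>D. a p = q p a}"
    and "\<And>p. (\<lambda>x. \<psi> x p) \<in> mpoly_fun (P - D)"
    and "\<And>x p. p \<in> P - D \<Longrightarrow> \<psi> x p = x p"
proof -
  define \<psi> where "\<psi> = (\<lambda>x. wfrec R (\<lambda>f p. if p \<in> D then q p f else if p \<in> P then x p else 0))"
  have \<psi>: "\<psi> x p = (if p \<in> D then q p (\<psi> x) else if p \<in> P then x p else 0)" for x p
  proof -
    have "\<psi> x p = (if p \<in> D then q p (cut (\<psi> x) R p) else if p \<in> P then x p else 0)"
      unfolding \<psi>_def by (subst wfrec[OF wf]) (rule refl)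
    \<comment> \<open>The recursor supplies values truncated by \<open>cut\<close>; they agree with
      \<open>\<psi> x\<close> at the predecessors of \<open>p\<close>, and \<open>q p\<close> reads
      nothing else.\<close>
    moreover have "q p (cut (\<psi> x) R p) = q p (\<psi> x)" if "p \<in> D"
      by (rule mpoly_fun_cong[OF q[OF that]]) (simp add: cut_apply)
    ultimately show ?thesis by simp
  qed
  have poly: "(\<lambda>x. \<psi> x p) \<in> mpoly_fun (P - D)" for p
  proof (induction p rule: wf_induct_rule[OF wf])
    case (1 p)
    show ?case
    proof (cases "p \<in> D")
      case True
      have "(\<lambda>x. q p (\<psi> x)) \<in> mpoly_fun (P - D)"
        by (rule mpoly_fun_compose[OF q[OF True]]) (use 1 in simp)
      then show ?thesis using True by (subst \<psi>) simp
    next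
      case False
      then show ?thesis by (subst \<psi>) (cases "p \<in> P"; simp add: mpoly_fun.intros)
    qed
  qed
  have free: "\<psi> x p = x p" if "p \<in> P - D" for x p using that by (subst \<psi>) simp
  have unique: "\<psi> x p = a p"
    if a: "a \<in> coord_space P" "\<forall>p\<in>D. a p = q p a" and x: "\<And>p. p \<in> P - D \<Longrightarrow> x p = a p" for a x p
  proof (induction p rule: wf_induct_rule[OF wf])
    case (1 p)
    show ?case
    proof (cases "p \<in> D")
      case True
      have "q p (\<psi> x) = q p a"
        by (rule mpoly_fun_cong[OF q[OF True]]) (use 1 in simp)
      then show ?thesis using True a(2) by (subst \<psi>) simp
    next
      case False
      then show ?thesis using a(1) x by (subst \<psi>) (auto simp: coord_space_def)
    qed
  qed
  let ?S = "{a \<in> coord_space P. \<forall>p\<in>D. a p = q p a}"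
  have "\<psi> x \<in> ?S" for x
    using DP \<psi>[of x] by (auto simp: coord_space_def)
  moreover have "inj_on \<psi> (coord_space (P - D))"
  proof (rule inj_onI, rule ext)
    fix x y p assume "x \<in> coord_space (P - D)" "y \<in> coord_space (P - D)" "\<psi> x = \<psi> y"
    then show "x p = y p" using free[of p x] free[of p y] by (cases "p \<in> P - D") (auto simp: coord_space_def)
  qed
  moreover have "a \<in> \<psi> ` coord_space (P - D)" if "a \<in> ?S" for a
  proof (rule image_eqI)
    let ?x = "\<lambda>p. if p \<in> P - D then a p else 0"
    show "a = \<psi> ?x" using that unique[of a ?x] by (intro ext) auto
    show "?x \<in> coord_space (P - D)" by (auto simp: coord_space_def)
  qed
  ultimately have "bij_betw \<psi> (coord_space (P - D)) ?S" unfolding bij_betw_def by blast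
  then show thesis using that poly free by blast
qed

text \<open>
  The labels \<open>1..n\<close> stand for the boxes of a filling: \<open>pos k\<close> encodes the place of box \<open>k\<close> in the
  base filling, and \<open>adj l r\<close> says that box \<open>r\<close> is directly to the right of box \<open>l\<close>. In the basis
  \<open>f\<^sub>k = e\<^bsub>w(k)\<^esub>\<close>, \<open>unipotent a\<close> is the matrix of the vectors \<open>v\<^sub>j = f\<^sub>j + \<Sum>\<^sub>k a\<^bsub>kj\<^esub> f\<^sub>k\<close> spanning a
  flag in the cell of \<open>w\<close>, \<open>shifted a\<close> that of their images under \<open>X\<close>, and \<open>hess_entry a r k\<close> the
  coefficient of \<open>v\<^sub>k\<close> in \<open>X v\<^sub>r\<close>.
\<close>

locale label_shift =
  fixes n :: nat and pos :: "nat \<Rightarrow> int" and adj :: "nat \<Rightarrow> nat \<Rightarrow> bool" and h :: "nat \<Rightarrow> nat"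
  assumes pos_inj: "inj_on pos {1..n}"
    and adj_range: "adj l r \<Longrightarrow> l \<in> {1..n} \<and> r \<in> {1..n}"
    and adj_unique: "adj l r \<Longrightarrow> adj l r' \<Longrightarrow> r = r'"
    and adj_less: "adj l r \<Longrightarrow> pos l < pos r"
    and adj_shift: "adj k s \<Longrightarrow> adj l r \<Longrightarrow> pos s - pos k = pos r - pos l"
    and adj_first: "adj k s \<Longrightarrow> r \<in> {1..n} \<Longrightarrow> (\<And>l. \<not> adj l r) \<Longrightarrow> pos r < pos s"
begin

definition cell_pairs :: "(nat \<times> nat) set" where
  "cell_pairs = {(k, j). k \<in> {1..n} \<and> j \<in> {1..n} \<and> j < k \<and> pos k < pos j}"

text \<open>The coordinates that get determined: the equation killing the coefficient of
  \<open>v_k\<close> in \<open>X v_r\<close> is solved for the coordinate at \<open>(k, l)\<close>,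
  where \<open>l\<close> is the left neighbour of \<open>r\<close>.\<close>

definition bound_pairs :: "(nat \<times> nat) set" where
  "bound_pairs = {(k, l) \<in> cell_pairs. \<exists>r. adj l r \<and> h r < k}"

definition weight :: "nat \<times> nat \<Rightarrow> int" where
  "weight p = pos (snd p) - pos (fst p)"

definition unipotent :: "(nat \<times> nat \<Rightarrow> complex) \<Rightarrow> nat \<Rightarrow> nat \<Rightarrow> complex" where
  "unipotent a k j = (if k = j then 1 else if (k, j) \<in> cell_pairs then a (k, j) else 0)"

definition shifted :: "(nat \<times> nat \<Rightarrow> complex) \<Rightarrow> nat \<Rightarrow> nat \<Rightarrow> complex" where
  "shifted a k r = (\<Sum>s\<in>{s \<in> {1..n}. adj k s}. unipotent a s r)"

fun hess_entry :: "(nat \<times> nat \<Rightarrow> complex) \<Rightarrow> nat \<Rightarrow> nat \<Rightarrow> complex" where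
  "hess_entry a r k = shifted a k r - (\<Sum>m\<in>{1..<k}. hess_entry a r m * unipotent a k m)"

declare hess_entry.simps [simp del]

section \<open>Expansion of \<open>X v_r\<close> in the basis \<open>v_k\<close>\<close>

lemma finite_cell_pairs: "finite cell_pairs"
  by (rule finite_subset[of _ "{1..n} \<times> {1..n}"]) (auto simp: cell_pairs_def)

lemma unipotent_zero: "pos j \<le> pos k \<Longrightarrow> k \<noteq> j \<Longrightarrow> unipotent a k j = 0"
  by (auto simp: unipotent_def cell_pairs_def)

lemma unipotent_poly:
  assumes "(k, j) \<in> cell_pairs \<Longrightarrow> (k, j) \<in> J"
  shows "(\<lambda>a. unipotent a k j) \<in> mpoly_fun J"
  using assms unfolding unipotent_def
  by (cases "k = j"; cases "(k, j) \<in> cell_pairs") (simp_all add: mpoly_fun.intros)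

lemma shifted_adj:
  assumes "adj k s"
  shows "shifted a k r = unipotent a s r"
proof -
  have "{s \<in> {1..n}. adj k s} = {s}" using assms adj_range adj_unique by blast
  then show ?thesis by (simp add: shifted_def)
qed

lemma shifted_not_adj: "(\<And>s. \<not> adj k s) \<Longrightarrow> shifted a k r = 0"
  by (simp add: shifted_def)

text \<open>Here \<open>X v_r = 0\<close>: \<open>X\<close> moves each box to its left neighbour,
  and by \<open>adj_first\<close> all boxes having one come after \<open>r\<close>, whereas
  \<open>v_r\<close> involves only \<open>r\<close> and earlier boxes.\<close>

lemma hess_entry_first:
  assumes "r \<in> {1..n}" "\<And>l. \<not> adj l r"
  shows "hess_entry a r k = 0"
proof (induction k rule: less_induct)
  case (less k)
  have "shifted a k r = 0"
  proof (cases "\<exists>s. adj k s")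
    case True
    then obtain s where s: "adj k s" by blast
    have "pos r < pos s" by (rule adj_first[OF s assms])
    then show ?thesis using unipotent_zero[of r s a] by (auto simp: shifted_adj[OF s])
  qed (simp add: shifted_not_adj)
  then show ?case using less by (subst hess_entry.simps) simp
qed

text \<open>Shifting preserves the order of positions, so \<open>X v_r\<close> lies in the span of
  the \<open>f_k\<close> with \<open>k\<close> not after \<open>l\<close>. The \<open>v_k\<close> of
  the same boxes span the same space.\<close>

lemma hess_entry_beyond:
  assumes "adj l r" "pos l < pos k"
  shows "hess_entry a r k = 0"
  using assms(2)
proof (induction k rule: less_induct)
  case (less k)
  have "shifted a k r = 0"
  proof (cases "\<exists>s. adj k s")
    case True
    then obtain s where s: "adj k s" by blast
    have "pos r < pos s" using adj_shift[OF s assms(1)] less.prems by simp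
    then show ?thesis using unipotent_zero[of r s a] by (auto simp: shifted_adj[OF s])
  qed (simp add: shifted_not_adj)
  moreover have "hess_entry a r m * unipotent a k m = 0" if "m \<in> {1..<k}" for m
    using less.IH[of m] unipotent_zero[of m k a] that less.prems by (cases "pos l < pos m") auto
  then have "(\<Sum>m\<in>{1..<k}. hess_entry a r m * unipotent a k m) = 0" by (intro sum.neutral) blast
  ultimately show ?case by (subst hess_entry.simps) simp
qed

text \<open>The vector \<open>f_l\<close> occurs in \<open>X v_r\<close> with coefficient 1, and the
  other \<open>v_m\<close> in the expansion sit before \<open>l\<close>, so they do not involve
  \<open>f_l\<close>. This pivot solves the equations, and it also makes \<open>h\<close>-strictness
  necessary.\<close>

lemma hess_entry_left:
  assumes "adj l r"
  shows "hess_entry a r l = 1"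
proof -
  have "shifted a l r = 1" by (simp add: shifted_adj[OF assms] unipotent_def)
  moreover have "hess_entry a r m * unipotent a l m = 0" if "m \<in> {1..<l}" for m
    using hess_entry_beyond[OF assms, of m a] unipotent_zero[of m l a] that
    by (cases "pos l < pos m") auto
  then have "(\<Sum>m\<in>{1..<l}. hess_entry a r m * unipotent a l m) = 0" by (intro sum.neutral) blast
  ultimately show ?thesis by (subst hess_entry.simps) simp
qed

lemma shifted_poly:
  assumes lr: "adj l r" and k: "k \<noteq> l" "k \<in> {1..n}"
    and J: "\<And>s. (s, r) \<in> cell_pairs \<Longrightarrow> pos s = pos k + pos r - pos l \<Longrightarrow> (s, r) \<in> J"
  shows "(\<lambda>a. shifted a k r) \<in> mpoly_fun J"
proof (cases "\<exists>s. adj k s")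
  case True
  then obtain s where s: "adj k s" by blast
  show ?thesis unfolding shifted_adj[OF s]
    by (rule unipotent_poly) (use J adj_shift[OF s lr] in simp)
qed (simp add: shifted_not_adj mpoly_fun.const)

text \<open>Trace of homogeneity: the coefficient has weight \<open>pos l - pos k\<close>, so
  coordinates of larger weight cannot occur in it.\<close>

lemma hess_entry_poly:
  assumes lr: "adj l r" and "k \<in> {1..n}" "pos k < pos l"
  shows "(\<lambda>a. hess_entry a r k) \<in> mpoly_fun {p \<in> cell_pairs. weight p \<le> pos l - pos k}"
  using assms(2,3)
proof (induction k rule: less_induct)
  case (less k)
  let ?J = "{p \<in> cell_pairs. weight p \<le> pos l - pos k}"
  have "(\<lambda>a. shifted a k r) \<in> mpoly_fun ?J"
    by (rule shifted_poly[OF lr]) (use less.prems in \<open>auto simp: weight_def\<close>)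
  moreover have "(\<lambda>a. hess_entry a r m * unipotent a k m) \<in> mpoly_fun ?J" if m: "m \<in> {1..<k}" for m
  proof -
    have m': "m \<in> {1..n}" "m < k" using m less.prems(1) by auto
    \<comment> \<open>After \<open>l\<close> the coefficient \<open>hess_entry a r m\<close>
      vanishes; at or before \<open>k\<close> the factor \<open>unipotent a k m\<close> does. What
      remains is \<open>m = l\<close> and the boxes strictly between.\<close>
    consider "pos l < pos m" | "m = l" | "pos m < pos k" | "pos m = pos k" | "pos k < pos m" "pos m < pos l"
      using inj_onD[OF pos_inj _ m'(1), of l] adj_range[OF lr] by fastforce
    then show ?thesis
    proof cases
      case 1
      then show ?thesis by (simp add: hess_entry_beyond[OF lr] mpoly_fun.const)
    next
      case 2
      then show ?thesis
        by (simp add: hess_entry_left[OF lr]) (rule unipotent_poly, simp add: weight_def)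
    next
      case 5
      then have "(\<lambda>a. hess_entry a r m) \<in> mpoly_fun ?J"
        using less.IH[OF m'(2,1)] by (auto elim!: mpoly_fun_mono)
      moreover have "(\<lambda>a. unipotent a k m) \<in> mpoly_fun ?J"
        by (rule unipotent_poly) (use 5 in \<open>simp add: weight_def\<close>)
      ultimately show ?thesis by (rule mpoly_fun.mult)
    qed (use m' in \<open>simp_all add: unipotent_zero mpoly_fun.const\<close>)
  qed
  ultimately show ?case
    by (subst hess_entry.simps) (intro mpoly_fun_diff mpoly_fun_sum)
qed

text \<open>Weight alone does not suffice: the term \<open>shifted a k r\<close> contributes the
  coordinate at \<open>(s, r)\<close> with \<open>s\<close> right of \<open>k\<close>, of the same
  weight as \<open>(k, l)\<close>. Coordinates further to the right therefore count as
  smaller.\<close>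

definition pair_order :: "((nat \<times> nat) \<times> nat \<times> nat) set" where
  "pair_order = {(p', p) \<in> cell_pairs \<times> cell_pairs.
     weight p' < weight p \<or> (weight p' = weight p \<and> pos (snd p) < pos (snd p'))}"

lemma wf_pair_order: "wf pair_order"
proof -
  have "acyclic pair_order"
  proof (rule acyclicI, rule allI, rule notI)
    fix p assume "(p, p) \<in> pair_order\<^sup>+"
    moreover have "trans pair_order" by (auto simp: trans_def pair_order_def)
    ultimately have "(p, p) \<in> pair_order" by simp
    then show False by (simp add: pair_order_def)
  qed
  moreover have "finite pair_order"
    by (rule finite_subset[of _ "cell_pairs \<times> cell_pairs"])
      (use finite_cell_pairs in \<open>auto simp: pair_order_def\<close>)
  ultimately show ?thesis by (simp add: finite_acyclic_wf)
qed

text \<open>The summand \<open>m = l\<close> of the recursion is the coordinate at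
  \<open>(k, l)\<close> itself, because its cofactor is 1. For \<open>m\<close> strictly between,
  both factors involve only smaller weights, and the shifted term has equal weight but lies further
  right.\<close>

lemma hess_entry_affine:
  assumes lr: "adj l r" and kl: "(k, l) \<in> cell_pairs"
  obtains q where "q \<in> mpoly_fun {p \<in> cell_pairs. (p, (k, l)) \<in> pair_order}"
    and "\<And>a. hess_entry a r k = q a - a (k, l)"
proof
  let ?J = "{p \<in> cell_pairs. (p, (k, l)) \<in> pair_order}"
  let ?q = "\<lambda>a. shifted a k r - (\<Sum>m\<in>{1..<k} - {l}. hess_entry a r m * unipotent a k m)"
  have k: "k \<in> {1..n}" "l < k" "pos k < pos l" "l \<in> {1..n}" using kl by (auto simp: cell_pairs_def)
  show "hess_entry a r k = ?q a - a (k, l)" for a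
  proof -
    have "(\<Sum>m\<in>{1..<k}. hess_entry a r m * unipotent a k m) = hess_entry a r l * unipotent a k l +
        (\<Sum>m\<in>{1..<k} - {l}. hess_entry a r m * unipotent a k m)"
      using k by (intro sum.remove) auto
    also have "hess_entry a r l * unipotent a k l = a (k, l)"
      using k kl by (simp add: hess_entry_left[OF lr] unipotent_def)
    finally show ?thesis by (subst hess_entry.simps) simp
  qed
  have "(\<lambda>a. shifted a k r) \<in> mpoly_fun ?J"
    by (rule shifted_poly[OF lr])
      (use k kl adj_less[OF lr] in \<open>auto simp: weight_def pair_order_def\<close>)
  moreover have "(\<lambda>a. hess_entry a r m * unipotent a k m) \<in> mpoly_fun ?J"
    if m: "m \<in> {1..<k} - {l}" for m
  proof -
    have m': "m \<in> {1..n}" "m < k" "m \<noteq> l" using m k by auto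
    consider "pos l < pos m" | "pos m < pos k" | "pos m = pos k" | "pos k < pos m" "pos m < pos l"
      using inj_onD[OF pos_inj _ m'(1), of l] k m'(3) by fastforce
    then show ?thesis
    proof cases
      case 1
      then show ?thesis by (simp add: hess_entry_beyond[OF lr] mpoly_fun.const)
    next
      case 4
      have "(\<lambda>a. hess_entry a r m) \<in> mpoly_fun ?J"
        by (rule mpoly_fun_mono[OF hess_entry_poly[OF lr m'(1) 4(2)]])
          (use 4 kl in \<open>auto simp: weight_def pair_order_def\<close>)
      moreover have "(\<lambda>a. unipotent a k m) \<in> mpoly_fun ?J"
        by (rule unipotent_poly) (use 4 kl in \<open>simp add: weight_def pair_order_def\<close>)
      ultimately show ?thesis by (rule mpoly_fun.mult)
    qed (use m' in \<open>simp_all add: unipotent_zero mpoly_fun.const\<close>)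
  qed
  ultimately show "?q \<in> mpoly_fun ?J" by (intro mpoly_fun_diff mpoly_fun_sum)
qed

definition hess_points :: "(nat \<times> nat \<Rightarrow> complex) set" where
  "hess_points = {a \<in> coord_space cell_pairs. \<forall>r\<in>{1..n}. \<forall>k\<in>{1..n}. h r < k \<longrightarrow> hess_entry a r k = 0}"

lemma hess_points_empty:
  assumes "adj l r" "h r < l"
  shows "hess_points = {}"
  using assms adj_range[OF assms(1)] hess_entry_left[OF assms(1)] by (force simp: hess_points_def)

text \<open>Most conditions are vacuous: they hold automatically if \<open>r\<close> has no left
  neighbour \<open>l\<close> or if \<open>k\<close> comes after \<open>l\<close>. Those left over
  correspond to \<open>bound_pairs\<close>, one equation for each.\<close>

lemma hess_points_parametrization:
  assumes strict: "\<And>l r. adj l r \<Longrightarrow> l \<le> h r"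
  obtains \<psi> where "bij_betw \<psi> (coord_space (cell_pairs - bound_pairs)) hess_points"
    and "\<And>p. (\<lambda>x. \<psi> x p) \<in> mpoly_fun (cell_pairs - bound_pairs)"
    and "\<And>x p. p \<in> cell_pairs - bound_pairs \<Longrightarrow> \<psi> x p = x p"
proof -
  define Q where "Q = (\<lambda>p q. q \<in> mpoly_fun {p' \<in> cell_pairs. (p', p) \<in> pair_order} \<and>
    (\<forall>r a. adj (snd p) r \<longrightarrow> hess_entry a r (fst p) = q a - a p))"
  define q where "q = (\<lambda>p. SOME q. Q p q)"
  have q: "Q p (q p)" if p: "p \<in> bound_pairs" for p
  proof -
    obtain k l where kl: "p = (k, l)" by (cases p)
    obtain r where r: "adj l r" "(k, l) \<in> cell_pairs" using p by (auto simp: kl bound_pairs_def)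
    obtain f where f: "f \<in> mpoly_fun {p' \<in> cell_pairs. (p', (k, l)) \<in> pair_order}"
      "\<And>a. hess_entry a r k = f a - a (k, l)" using hess_entry_affine[OF r] by blast
    have "Q p f" unfolding Q_def kl using f adj_unique[OF r(1)] by auto
    then show ?thesis unfolding q_def by (rule someI[of "Q p"])
  qed
  have "hess_points = {a \<in> coord_space cell_pairs. \<forall>p\<in>bound_pairs. a p = q p a}"
  proof -
    have "(\<forall>r\<in>{1..n}. \<forall>k\<in>{1..n}. h r < k \<longrightarrow> hess_entry a r k = 0) \<longleftrightarrow> (\<forall>p\<in>bound_pairs. a p = q p a)"
      (is "?L \<longleftrightarrow> ?R") for a
    proof
      assume L: ?L
      show ?R
      proof
        fix p assume p: "p \<in> bound_pairs"
        then obtain r where "adj (snd p) r" "h r < fst p" "fst p \<in> {1..n}"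
          by (auto simp: bound_pairs_def cell_pairs_def)
        moreover from this have "r \<in> {1..n}" using adj_range by blast
        ultimately have "hess_entry a r (fst p) = 0" using L by blast
        then show "a p = q p a" using q[OF p] \<open>adj (snd p) r\<close> unfolding Q_def by auto
      qed
    next
      assume R: ?R
      show ?L
      proof (intro ballI impI)
        fix r k assume r: "r \<in> {1..n}" and k: "k \<in> {1..n}" "h r < k"
        show "hess_entry a r k = 0"
        proof (cases "\<exists>l. adj l r")
          case True
          then obtain l where l: "adj l r" by blast
          \<comment> \<open>Strictness gives \<open>l \<le> h r < k\<close>, which excludes the
            pivot \<open>k = l\<close>, where the coefficient is 1.\<close>
          have lk: "l < k" "l \<in> {1..n}" using strict[OF l] k(2) adj_range[OF l] by auto
          then consider "pos l < pos k" | "pos k < pos l"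
            using inj_onD[OF pos_inj _ lk(2) k(1)] by (cases "pos l" "pos k" rule: linorder_cases) auto
          then show ?thesis
          proof cases
            case 2
            then have "(k, l) \<in> bound_pairs"
              using l lk k by (auto simp: bound_pairs_def cell_pairs_def)
            then show ?thesis using q[of "(k, l)"] l R unfolding Q_def by auto
          qed (rule hess_entry_beyond[OF l])
        qed (use hess_entry_first[OF r] in blast)
      qed
    qed
    then show ?thesis unfolding hess_points_def by blast
  qed
  note hp = this(1)
  show thesis
  proof (rule triangular_system_solution[OF wf_pair_order])
    show "bound_pairs \<subseteq> cell_pairs" by (auto simp: bound_pairs_def)
    show "q p \<in> mpoly_fun {p' \<in> cell_pairs. (p', p) \<in> pair_order}" if "p \<in> bound_pairs" for p
      using q[OF that] unfolding Q_def by blast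
  qed (rule that, unfold hp)
qed

end

section \<open>Flags and minors\<close>

lemma GL_iff_det: "g \<in> GL n \<longleftrightarrow> g \<in> carrier_mat n n \<and> det g \<noteq> 0"
proof
  assume g: "g \<in> GL n"
  then obtain g' where g': "g * g' = 1\<^sub>m n" "g' * g = 1\<^sub>m (dim_row g')" and c: "g \<in> carrier_mat n n"
    by (auto simp: GL_def invertible_mat_def inverts_mat_def)
  have "dim_col (g * g') = n" "dim_col (g' * g) = dim_row g'" using g' by (metis index_one_mat(3))+
  then have "g' \<in> carrier_mat n n" using c by (intro carrier_matI) simp_all
  then have "det g * det g' = 1" using det_mult[OF c, of g'] g'(1) by simp
  then show "g \<in> carrier_mat n n \<and> det g \<noteq> 0" using c by auto
next
  assume g: "g \<in> carrier_mat n n \<and> det g \<noteq> 0"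
  then obtain g' where "g' \<in> carrier_mat n n" "g * g' = 1\<^sub>m n" "g' * g = 1\<^sub>m n"
    using det_non_zero_imp_unit[of g n] by (auto simp: Units_def ring_mat_def)
  then show "g \<in> GL n" using g by (auto simp: GL_def invertible_mat_def inverts_mat_def)
qed

lemma GL_carrier: "g \<in> GL n \<Longrightarrow> g \<in> carrier_mat n n"
  by (simp add: GL_def)

lemma GL_inverse:
  assumes "g \<in> GL n"
  obtains g' where "g' \<in> GL n" "g * g' = 1\<^sub>m n" "g' * g = 1\<^sub>m n"
proof -
  have g: "g \<in> carrier_mat n n" using assms by (rule GL_carrier)
  obtain g' where g': "g * g' = 1\<^sub>m n" "g' * g = 1\<^sub>m (dim_row g')"
    using assms g by (auto simp: GL_def invertible_mat_def inverts_mat_def)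
  have "dim_col (g * g') = n" "dim_col (g' * g) = dim_row g'" using g' by (metis index_one_mat(3))+
  then have c: "g' \<in> carrier_mat n n" using g by (intro carrier_matI) simp_all
  then have "g' \<in> GL n"
    using g g' by (auto simp: GL_def invertible_mat_def inverts_mat_def)
  then show thesis using that g' c by auto
qed

lemma GL_mult: "g \<in> GL n \<Longrightarrow> g' \<in> GL n \<Longrightarrow> g * g' \<in> GL n"
  by (auto simp: GL_iff_det det_mult)

lemma Borel_GL: "b \<in> Borel n \<Longrightarrow> b \<in> GL n"
  by (simp add: Borel_def)

lemma Borel_diag_nonzero:
  assumes "b \<in> Borel n" "i < n"
  shows "b $$ (i, i) \<noteq> 0"
  using assms upper_triangular_imp_det_eq_0_iff[of b n]
  by (auto simp: Borel_def GL_iff_det diag_mat_def)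

section \<open>Flags as cosets of the Borel group\<close>

definition std_space :: "nat \<Rightarrow> nat \<Rightarrow> complex vec set" where
  "std_space n i = {v \<in> carrier_vec n. \<forall>r<n. i \<le> r \<longrightarrow> v $ r = 0}"

lemma std_space_carrier: "v \<in> std_space n i \<Longrightarrow> v \<in> carrier_vec n"
  by (simp add: std_space_def)

lemma std_space_mono: "i \<le> j \<Longrightarrow> std_space n i \<subseteq> std_space n j"
  by (auto simp: std_space_def)

lemma unit_vec_std_space: "j < i \<Longrightarrow> unit_vec n j \<in> std_space n i"
  by (auto simp: std_space_def unit_vec_def)

lemma mult_unit_vec:
  fixes g :: "complex mat"
  assumes "g \<in> carrier_mat n n" "j < n"
  shows "g *\<^sub>v unit_vec n j = col g j"
  using assms by (intro eq_vecI) auto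

text \<open>Replaces spans by images of coordinate subspaces; later arguments about flags then work
  with vanishing entries instead of linear combinations.\<close>

lemma span_cols:
  assumes g: "g \<in> carrier_mat n n" and i: "i \<le> n"
  shows "LinearCombinations.module.span class_ring (module_vec TYPE(complex) n) (col g ` {..<i}) =
    (*\<^sub>v) g ` std_space n i"
proof -
  interpret vec_space "TYPE(complex)" n .
  let ?C = "col g ` {..<i}" and ?W = "(*\<^sub>v) g ` std_space n i"
  have C: "?C \<subseteq> carrier_vec n" using g by auto
  show ?thesis
  proof
    show "span ?C \<subseteq> ?W"
    proof (rule span_is_subset)
      show "?C \<subseteq> ?W"
      proof
        fix v assume "v \<in> ?C"
        then obtain j where j: "j < i" "v = col g j" by auto
        then have "v = g *\<^sub>v unit_vec n j" using mult_unit_vec[OF g, of j] i by simp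
        then show "v \<in> ?W" using unit_vec_std_space[OF j(1)] by (rule image_eqI)
      qed
      show "submodule class_ring ?W V"
      proof (unfold_locales, goal_cases)
        case 1
        then show ?case using g by (auto simp: std_space_def)
      next
        case (2 v w)
        then obtain x y where "v = g *\<^sub>v x" "w = g *\<^sub>v y" "x \<in> std_space n i" "y \<in> std_space n i" by blast
        moreover from this have "g *\<^sub>v (x + y) = v + w" "x + y \<in> std_space n i"
          using g by (auto simp: std_space_def mult_add_distrib_mat_vec)
        ultimately show ?case by (auto simp: module_vec_simps intro!: image_eqI[of _ _ "x + y"])
      next
        case 3
        show ?case using g
          by (auto simp: std_space_def module_vec_simps intro!: image_eqI[of _ _ "0\<^sub>v n"])
      next
        case (4 c v)
        then obtain x where "v = g *\<^sub>v x" "x \<in> std_space n i" by blast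
        moreover from this have "g *\<^sub>v (c \<cdot>\<^sub>v x) = c \<cdot>\<^sub>v v" "c \<cdot>\<^sub>v x \<in> std_space n i"
          using g by (auto simp: std_space_def mult_mat_vec)
        ultimately show ?case by (auto simp: module_vec_simps intro!: image_eqI[of _ _ "c \<cdot>\<^sub>v x"])
      qed
    qed
    \<comment> \<open>The induction on \<open>m\<close> splits off the last possibly nonzero entry
      of \<open>v\<close>.\<close>
    have "g *\<^sub>v v \<in> span ?C" if "v \<in> std_space n m" "m \<le> i" for v m
      using that
    proof (induction m arbitrary: v)
      case 0
      then have "v = 0\<^sub>v n" by (intro eq_vecI) (auto simp: std_space_def)
      then have "g *\<^sub>v v = 0\<^sub>v n" using g by (intro eq_vecI) auto
      then show ?case using submodule.zero_closed[OF span_is_submodule] C by simp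
    next
      case (Suc m)
      let ?v = "v - v $ m \<cdot>\<^sub>v unit_vec n m"
      have m: "m < n" "m < i" using Suc.prems i by auto
      have v: "v \<in> carrier_vec n" using Suc.prems by (simp add: std_space_def)
      have "v $ r = 0" if "m < r" "r < n" for r using Suc.prems that by (auto simp: std_space_def)
      then have "?v \<in> std_space n m" using v m by (auto simp: std_space_def unit_vec_def le_less)
      then have 1: "g *\<^sub>v ?v \<in> span ?C" using Suc m by auto
      have 2: "v $ m \<cdot>\<^sub>v col g m \<in> span ?C"
        using C m by (intro smult_in_span span_mem) auto
      have "v = ?v + v $ m \<cdot>\<^sub>v unit_vec n m" using v by (intro eq_vecI) auto
      then have "g *\<^sub>v v = g *\<^sub>v (?v + v $ m \<cdot>\<^sub>v unit_vec n m)" by simp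
      also have "\<dots> = g *\<^sub>v ?v + v $ m \<cdot>\<^sub>v col g m"
        using g v m by (simp add: mult_add_distrib_mat_vec mult_mat_vec mult_unit_vec[OF g m(1)])
      finally show ?case using span_add1[OF _ 1 2] C by (simp add: module_vec_simps)
    qed
    then show "?W \<subseteq> span ?C" by blast
  qed
qed

lemma std_flag_eq:
  assumes "i \<le> n"
  shows "std_flag n i = std_space n i"
proof -
  have "(\<lambda>j. unit_vec n (j - 1)) ` {1..i} = col (1\<^sub>m n :: complex mat) ` {..<i}"
  proof (intro equalityI subsetI)
    fix v :: "complex vec" assume "v \<in> (\<lambda>j. unit_vec n (j - 1)) ` {1..i}"
    then obtain j where "v = unit_vec n (j - 1)" "1 \<le> j" "j \<le> i" by auto
    then show "v \<in> col (1\<^sub>m n) ` {..<i}" using assms by (intro image_eqI[of _ _ "j - 1"]) auto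
  next
    fix v :: "complex vec" assume "v \<in> col (1\<^sub>m n) ` {..<i}"
    then obtain j where "v = unit_vec n j" "j < i" using assms by auto
    then show "v \<in> (\<lambda>j. unit_vec n (j - 1)) ` {1..i}" by (intro image_eqI[of _ _ "Suc j"]) auto
  qed
  moreover have "(*\<^sub>v) (1\<^sub>m n) ` std_space n i = std_space n i"
    by (auto simp: std_space_def image_iff)
  ultimately show ?thesis
    using assms span_cols[OF one_carrier_mat assms] by (simp add: std_flag_def)
qed

definition flag_of :: "nat \<Rightarrow> complex mat \<Rightarrow> flag" where
  "flag_of n g = flag_act n g (std_flag n)"

lemma flag_of_eq: "i \<le> n \<Longrightarrow> flag_of n g i = (*\<^sub>v) g ` std_space n i"
  by (simp add: flag_of_def flag_act_def std_flag_eq)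

lemma flag_of_eqI: "(\<And>i. i \<le> n \<Longrightarrow> (*\<^sub>v) g ` std_space n i = (*\<^sub>v) g' ` std_space n i) \<Longrightarrow> flag_of n g = flag_of n g'"
  unfolding flag_of_def flag_act_def by (rule restrict_ext) (simp add: std_flag_eq)

lemma flag_of_Flags:
  assumes g: "g \<in> GL n"
  shows "flag_of n g \<in> Flags n"
proof -
  interpret vec_space "TYPE(complex)" n .
  have gc: "g \<in> carrier_mat n n" and det: "det g \<noteq> 0" using g by (auto simp: GL_iff_det)
  have li: "lin_indpt (set (cols g))" using lin_dep_cols_imp_det_0[OF gc] det by blast
  have inj: "inj_on (col g) {..<n}"
  proof (rule inj_onI, rule ccontr)
    fix i j assume "i \<in> {..<n}" "j \<in> {..<n}" "col g i = col g j" "i \<noteq> j"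
    then show False using det_identical_columns[OF gc, of i j] det by auto
  qed
  have "VectorSpace.subspace class_ring (flag_of n g i) V \<and> vectorspace.dim class_ring (V\<lparr>carrier := flag_of n g i\<rparr>) = i"
    if i: "i \<le> n" for i
  proof -
    let ?C = "col g ` {..<i}"
    have C: "?C \<subseteq> carrier_vec n" using gc by auto
    have eq: "flag_of n g i = span ?C" using span_cols[OF gc i] flag_of_eq[OF i] by simp
    have "?C \<subseteq> set (cols g)" using gc i by (auto simp: cols_def)
    then have "lin_indpt ?C" using subset_li_is_li[OF li] by blast
    then have "maximal ?C (\<lambda>T. T \<subseteq> ?C \<and> lin_indpt T)" by (auto simp: maximal_def)
    then have "vectorspace.dim class_ring (span_vs ?C) = card ?C"
      using C by (intro dim_span) auto
    moreover have "card ?C = i" using inj i by (subst card_image) (auto intro: inj_on_subset)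
    moreover have "VectorSpace.subspace class_ring (span ?C) V" using C by (intro span_is_subspace) auto
    ultimately show ?thesis by (simp add: eq)
  qed
  moreover have "flag_of n g i \<subseteq> flag_of n g (Suc i)" if "i < n" for i
    using that std_space_mono[of i "Suc i" n] by (auto simp: flag_of_eq)
  moreover have "flag_of n g \<in> extensional {0..n}" by (simp add: flag_of_def flag_act_def)
  ultimately show ?thesis by (auto simp: Flags_def)
qed

text \<open>The converse is back substitution: going up from the last row, each equation has one
  unknown left, with a nonzero diagonal coefficient.\<close>

lemma upper_triangular_std_space_iff:
  assumes b: "b \<in> Borel n" and v: "v \<in> carrier_vec n"
  shows "b *\<^sub>v v \<in> std_space n i \<longleftrightarrow> v \<in> std_space n i"
proof -
  have bc: "b \<in> carrier_mat n n" using b by (simp add: Borel_GL GL_carrier)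
  have entry: "(b *\<^sub>v v) $ r = (\<Sum>s\<in>{r..<n}. b $$ (r, s) * v $ s)" if "r < n" for r
  proof -
    have "(b *\<^sub>v v) $ r = (\<Sum>s\<in>{0..<n}. b $$ (r, s) * v $ s)"
      using that bc v by (auto simp: scalar_prod_def)
    also have "\<dots> = (\<Sum>s\<in>{r..<n}. b $$ (r, s) * v $ s)"
      using b bc that by (intro sum.mono_neutral_right) (auto simp: Borel_def)
    finally show ?thesis .
  qed
  show ?thesis
  proof
    assume "v \<in> std_space n i"
    then show "b *\<^sub>v v \<in> std_space n i"
      using bc entry by (auto simp: std_space_def intro!: sum.neutral)
  next
    assume bv: "b *\<^sub>v v \<in> std_space n i"
    have "v $ r = 0" if "r < n" "i \<le> r" for r
      using that
    proof (induction "n - r" arbitrary: r rule: less_induct)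
      case less
      have "(\<Sum>s\<in>{r..<n}. b $$ (r, s) * v $ s) = b $$ (r, r) * v $ r + (\<Sum>s\<in>{r..<n} - {r}. b $$ (r, s) * v $ s)"
        using less.prems by (intro sum.remove) auto
      also have "(\<Sum>s\<in>{r..<n} - {r}. b $$ (r, s) * v $ s) = 0"
        using less by (intro sum.neutral) auto
      finally have "b $$ (r, r) * v $ r = (b *\<^sub>v v) $ r" using entry less.prems by simp
      also have "\<dots> = 0" using bv less.prems by (simp add: std_space_def)
      finally show ?case using Borel_diag_nonzero[OF b less.prems(1)] by simp
    qed
    then show "v \<in> std_space n i" using v by (simp add: std_space_def)
  qed
qed

lemma Borel_std_space:
  assumes b: "b \<in> Borel n"
  shows "(*\<^sub>v) b ` std_space n i = std_space n i"
proof
  show "(*\<^sub>v) b ` std_space n i \<subseteq> std_space n i"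
    using upper_triangular_std_space_iff[OF b] std_space_carrier by blast
  show "std_space n i \<subseteq> (*\<^sub>v) b ` std_space n i"
  proof
    fix v assume v: "v \<in> std_space n i"
    obtain c where c: "c \<in> GL n" "b * c = 1\<^sub>m n" using GL_inverse[OF Borel_GL[OF b]] by blast
    have vc: "v \<in> carrier_vec n" using v by (rule std_space_carrier)
    have cv: "c *\<^sub>v v \<in> carrier_vec n" using GL_carrier[OF c(1)] vc by simp
    have "b *\<^sub>v (c *\<^sub>v v) = v"
      using assoc_mult_mat_vec[OF GL_carrier[OF Borel_GL[OF b]] GL_carrier[OF c(1)] vc] c(2) vc by simp
    then show "v \<in> (*\<^sub>v) b ` std_space n i"
      using upper_triangular_std_space_iff[OF b cv, of i] v by (metis image_eqI)
  qed
qed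

lemma flag_of_mult_Borel:
  assumes g: "g \<in> GL n" and b: "b \<in> Borel n"
  shows "flag_of n (g * b) = flag_of n g"
proof (rule flag_of_eqI)
  fix i
  have "(*\<^sub>v) (g * b) ` std_space n i = (*\<^sub>v) g ` (*\<^sub>v) b ` std_space n i"
    unfolding image_image
    by (rule image_cong) (use assoc_mult_mat_vec[OF GL_carrier[OF g] GL_carrier[OF Borel_GL[OF b]]]
        std_space_carrier in auto)
  then show "(*\<^sub>v) (g * b) ` std_space n i = (*\<^sub>v) g ` std_space n i"
    by (simp only: Borel_std_space[OF b])
qed

lemma BorelI_columns:
  assumes "c \<in> GL n" and "\<And>j. j < n \<Longrightarrow> col c j \<in> std_space n (Suc j)"
  shows "c \<in> Borel n"
  unfolding Borel_def
proof (intro CollectI conjI upper_triangularI)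
  fix i j assume "j < i" "i < dim_row c"
  then show "c $$ (i, j) = 0"
    using assms(2)[of j] GL_carrier[OF assms(1)] by (auto simp: std_space_def)
qed (rule assms)

text \<open>The candidate is the inverse of \<open>g\<close> times \<open>g'\<close>: its columns
  hold the coordinates of the columns of \<open>g'\<close> in the basis given by \<open>g\<close>,
  and equality of the flags makes them triangular.\<close>

lemma flag_of_eq_iff:
  assumes g: "g \<in> GL n" and g': "g' \<in> GL n"
  shows "flag_of n g = flag_of n g' \<longleftrightarrow> (\<exists>b\<in>Borel n. g' = g * b)"
proof
  assume eq: "flag_of n g = flag_of n g'"
  note gc = GL_carrier[OF g] GL_carrier[OF g']
  obtain k where k: "k \<in> GL n" "g * k = 1\<^sub>m n" "k * g = 1\<^sub>m n" using GL_inverse[OF g] by blast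
  note kc = GL_carrier[OF k(1)]
  let ?b = "k * g'"
  have "?b \<in> Borel n"
  proof (rule BorelI_columns)
    show "?b \<in> GL n" using k(1) g' by (rule GL_mult)
    fix j assume j: "j < n"
    have "g' *\<^sub>v unit_vec n j \<in> flag_of n g' (Suc j)"
      using j unit_vec_std_space[of j "Suc j" n] by (simp add: flag_of_eq)
    then have "col g' j \<in> flag_of n g (Suc j)" using eq mult_unit_vec[OF gc(2) j] by simp
    then obtain v where v: "v \<in> std_space n (Suc j)" "col g' j = g *\<^sub>v v"
      using j by (auto simp: flag_of_eq)
    have "col ?b j = k *\<^sub>v col g' j" using gc kc j by (intro col_mult2) auto
    also have "\<dots> = v"
      unfolding v(2) using assoc_mult_mat_vec[OF kc gc(1), of v] k(3) std_space_carrier[OF v(1)] by simp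
    finally show "col ?b j \<in> std_space n (Suc j)" using v(1) by simp
  qed
  moreover have "g' = g * ?b"
    using assoc_mult_mat[OF gc(1) kc gc(2)] k(2) gc(2) by simp
  ultimately show "\<exists>b\<in>Borel n. g' = g * b" by blast
qed (use flag_of_mult_Borel[OF g] in auto)

text \<open>\<open>C\<close> is the matrix of \<open>X\<close> in the basis of the columns of
  \<open>g\<close>, so the condition on the space \<open>V_i\<close> concerns the first
  \<open>i\<close> columns of \<open>C\<close>.\<close>

lemma flag_of_Hess_iff:
  assumes g: "g \<in> GL n" and X: "X \<in> carrier_mat n n" and C: "C \<in> carrier_mat n n"
    and gC: "g * C = X * g"
    and h: "h \<in> {1..n} \<rightarrow> {0..n - 1}" and mono: "mono_on {1..n} h"
  shows "flag_of n g \<in> Hess n X h \<longleftrightarrow>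
    (\<forall>r\<in>{1..n}. \<forall>k\<in>{1..n}. h r < k \<longrightarrow> C $$ (k - 1, r - 1) = 0)" (is "_ \<longleftrightarrow> ?R")
proof -
  note gc = GL_carrier[OF g]
  obtain g' where g': "g' \<in> GL n" "g' * g = 1\<^sub>m n" using GL_inverse[OF g] by blast
  have hn: "h i \<le> n" if "i \<in> {1..n}" for i
    using funcset_mem[OF h that] by simp
  have act: "X *\<^sub>v (g *\<^sub>v v) = g *\<^sub>v (C *\<^sub>v v)" if "v \<in> carrier_vec n" for v
    using assoc_mult_mat_vec[OF X gc that] assoc_mult_mat_vec[OF gc C that] gC by simp
  have inj: "v = v'" if "v \<in> carrier_vec n" "v' \<in> carrier_vec n" "g *\<^sub>v v = g *\<^sub>v v'" for v v'
    using assoc_mult_mat_vec[OF GL_carrier[OF g'(1)] gc that(1)]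
      assoc_mult_mat_vec[OF GL_carrier[OF g'(1)] gc that(2)] g'(2) that by simp
  show ?thesis
  proof
    assume H: "flag_of n g \<in> Hess n X h"
    show ?R
    proof (intro ballI impI)
      fix r k assume r: "r \<in> {1..n}" and k: "k \<in> {1..n}" "h r < k"
      have u: "unit_vec n (r - 1) \<in> std_space n r" using r by (intro unit_vec_std_space) auto
      have "X *\<^sub>v (g *\<^sub>v unit_vec n (r - 1)) \<in> flag_of n g (h r)"
      proof (rule subsetD)
        show "(*\<^sub>v) X ` flag_of n g r \<subseteq> flag_of n g (h r)" using H r by (auto simp: Hess_def)
        have "r \<le> n" using r by simp
        then show "X *\<^sub>v (g *\<^sub>v unit_vec n (r - 1)) \<in> (*\<^sub>v) X ` flag_of n g r"
          unfolding flag_of_eq[OF \<open>r \<le> n\<close>] using u by blast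
      qed
      then obtain v where v: "v \<in> std_space n (h r)" "g *\<^sub>v (C *\<^sub>v unit_vec n (r - 1)) = g *\<^sub>v v"
        using hn[OF r] act[OF unit_vec_carrier] by (auto simp: flag_of_eq)
      then have "col C (r - 1) = v"
        using inj[of "C *\<^sub>v unit_vec n (r - 1)" v] C mult_unit_vec[OF C, of "r - 1"] r
        by (auto simp: std_space_carrier)
      then have "col C (r - 1) $ (k - 1) = 0" using v(1) k by (auto simp: std_space_def)
      then show "C $$ (k - 1, r - 1) = 0" using C r k by auto
    qed
  next
    assume R: ?R
    have "X *\<^sub>v (g *\<^sub>v v) \<in> flag_of n g (h i)" if i: "i \<in> {1..n}" and v: "v \<in> std_space n i" for i v
    proof -
      have "(C *\<^sub>v v) $ k = 0" if k: "k < n" "h i \<le> k" for k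
      proof -
        have "(C *\<^sub>v v) $ k = (\<Sum>s\<in>{0..<n}. C $$ (k, s) * v $ s)"
          using k C v by (auto simp: scalar_prod_def std_space_def)
        also have "C $$ (k, s) * v $ s = 0" if s: "s \<in> {0..<n}" for s
        proof (cases "s < i")
          case True
          \<comment> \<open>Monotonicity lets the conditions on single columns imply those on whole
            spaces; \<open>Suc s\<close> is the 1-based index of column \<open>s\<close>.\<close>
          have "h (Suc s) \<le> h i" using mono_onD[OF mono, of "Suc s" i] True i s by auto
          then have "C $$ (k, s) = 0" using R[rule_format, of "Suc s" "Suc k"] k s by simp
          then show ?thesis by simp
        qed (use v s in \<open>auto simp: std_space_def\<close>)
        then have "(\<Sum>s\<in>{0..<n}. C $$ (k, s) * v $ s) = 0" by (intro sum.neutral) blast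
        finally show ?thesis .
      qed
      then have "C *\<^sub>v v \<in> std_space n (h i)" using C v by (auto simp: std_space_def)
      then show ?thesis
        using act[OF std_space_carrier[OF v]] hn[OF i] by (auto simp: flag_of_eq)
    qed
    then show "flag_of n g \<in> Hess n X h"
      using flag_of_Flags[OF g] by (auto simp: Hess_def flag_of_eq)
  qed
qed

lemma topspace_flag_variety_flag_of:
  assumes "g \<in> GL n" shows "flag_of n g \<in> topspace (flag_variety n)"
proof -
  have "{g \<in> GL n. flag_act n g (std_flag n) \<in> Flags n} = topspace (zariski_GL n)"
    using flag_of_Flags by (auto simp: flag_of_def topspace_zariski_GL)
  then have "openin (flag_variety n) (Flags n)" by (simp add: openin_flag_variety)
  then show ?thesis using flag_of_Flags[OF assms] openin_subset by blast
qed

section \<open>Minors as functions on \<open>GL n\<close>\<close>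

lemma poly_fun_sum:
  "(\<And>j. j \<in> J \<Longrightarrow> f j \<in> poly_fun n) \<Longrightarrow> (\<lambda>x. \<Sum>j\<in>J. f j x) \<in> poly_fun n"
  by (induction J rule: infinite_finite_induct) (auto intro: poly_fun.intros)

lemma poly_fun_prod:
  "(\<And>j. j \<in> J \<Longrightarrow> f j \<in> poly_fun n) \<Longrightarrow> (\<lambda>x. \<Prod>j\<in>J. f j x) \<in> poly_fun n"
  by (induction J rule: infinite_finite_induct) (auto intro: poly_fun.intros)

lemma poly_fun_power: "f \<in> poly_fun n \<Longrightarrow> (\<lambda>x. f x ^ k) \<in> poly_fun n"
  by (induction k) (auto intro: poly_fun.intros)

lemma poly_fun_compose:
  assumes "f \<in> poly_fun n" and "\<And>r c. r < n \<Longrightarrow> c < n \<Longrightarrow> (\<lambda>x. g x $$ (r, c)) \<in> mpoly_fun I"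
  shows "(\<lambda>x. f (g x)) \<in> mpoly_fun I"
  using assms by (induction rule: poly_fun.induct) (auto intro: mpoly_fun.intros)

text \<open>A Pluecker coordinate: the minor with the first \<open>j\<close> columns and the rows
  \<open>w 1\<close>, ..., \<open>w (j - 1)\<close>, \<open>w k\<close>, where the row of
  \<open>k\<close> comes last.\<close>

definition left_minor :: "(nat \<Rightarrow> nat) \<Rightarrow> nat \<times> nat \<Rightarrow> complex mat \<Rightarrow> complex" where
  "left_minor w p g = (case p of (k, j) \<Rightarrow>
     det (mat j j (\<lambda>(r, c). g $$ (w (if Suc r < j then Suc r else k) - 1, c))))"

lemma left_minor_poly:
  assumes w: "w permutes {1..n}" and k: "k \<in> {1..n}" and j: "j \<le> n"
  shows "left_minor w (k, j) \<in> poly_fun n"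
proof -
  have row: "w i - 1 < n" if "i \<in> {1..n}" for i
    using permutes_in_image[OF w, of i] that by auto
  have "(\<lambda>g. \<Sum>p\<in>{p. p permutes {0..<j}}. signof p *
      (\<Prod>i\<in>{0..<j}. g $$ (w (if Suc i < j then Suc i else k) - 1, p i))) \<in> poly_fun n"
  proof (intro poly_fun_sum poly_fun.mult poly_fun.const poly_fun_prod poly_fun.entry)
    fix p i assume "p \<in> {p. p permutes {0..<j}}" and i: "i \<in> {0..<j}"
    then have "p i \<in> {0..<j}" by (simp add: permutes_in_image del: atLeastLessThan_iff)
    then show "p i < n" using j by simp
    show "w (if Suc i < j then Suc i else k) - 1 < n"
      by (rule row) (use i j k in auto)
  qed
  moreover have "left_minor w (k, j) = (\<lambda>g. \<Sum>p\<in>{p. p permutes {0..<j}}. signof p *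
      (\<Prod>i\<in>{0..<j}. g $$ (w (if Suc i < j then Suc i else k) - 1, p i)))"
  proof
    fix g
    show "left_minor w (k, j) g = (\<Sum>p\<in>{p. p permutes {0..<j}}. signof p *
        (\<Prod>i\<in>{0..<j}. g $$ (w (if Suc i < j then Suc i else k) - 1, p i)))"
      unfolding left_minor_def case_prod_conv
      by (subst det_def'[OF mat_carrier], intro sum.cong refl arg_cong2[of _ _ _ _ "(*)"] prod.cong)
        (use permutes_in_image in fastforce)+
  qed
  ultimately show ?thesis by simp
qed

text \<open>The first \<open>j\<close> columns of \<open>g * b\<close> arise from those of
  \<open>g\<close> through the leading block of \<open>b\<close>. The factor does not depend on
  \<open>k\<close>, so quotients of minors with the same \<open>j\<close> are functions of the
  flag.\<close>

lemma left_minor_mult_Borel: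
  assumes w: "w permutes {1..n}" and k: "k \<in> {1..n}" and j: "j \<le> n"
    and g: "g \<in> carrier_mat n n" and b: "b \<in> Borel n"
  shows "left_minor w (k, j) (g * b) = left_minor w (k, j) g * (\<Prod>c<j. b $$ (c, c))"
proof -
  have bc: "b \<in> carrier_mat n n" using b by (simp add: Borel_GL GL_carrier)
  have bz: "b $$ (m, c) = 0" if "c < m" "m < n" for m c
    using b bc that by (auto simp: Borel_def upper_triangularD)
  let ?row = "\<lambda>r. w (if Suc r < j then Suc r else k) - 1"
  let ?g = "mat j j (\<lambda>(r, c). g $$ (?row r, c))" and ?b = "mat j j (\<lambda>(r, c). b $$ (r, c))"
  have row: "?row r < n" if "r < j" for r
    using permutes_in_image[OF w, of "if Suc r < j then Suc r else k"] that k j by auto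
  have "mat j j (\<lambda>(r, c). (g * b) $$ (?row r, c)) = ?g * ?b"
  proof (rule eq_matI)
    fix r c assume "r < dim_row (?g * ?b)" "c < dim_col (?g * ?b)"
    then have rc: "r < j" "c < j" by simp_all
    have "(g * b) $$ (?row r, c) = (\<Sum>m\<in>{0..<n}. g $$ (?row r, m) * b $$ (m, c))"
      using row[OF rc(1)] rc j g bc by (auto simp: scalar_prod_def)
    also have "\<dots> = (\<Sum>m\<in>{0..<j}. g $$ (?row r, m) * b $$ (m, c))"
      using j rc bz by (intro sum.mono_neutral_right) auto
    also have "\<dots> = (?g * ?b) $$ (r, c)" using rc by (auto simp: scalar_prod_def)
    finally show "mat j j (\<lambda>(r, c). (g * b) $$ (?row r, c)) $$ (r, c) = (?g * ?b) $$ (r, c)"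
      using rc by simp
  qed simp_all
  moreover have "det ?b = (\<Prod>c<j. b $$ (c, c))"
  proof -
    have "upper_triangular ?b" using bz j by (intro upper_triangularI) auto
    then have "det ?b = prod_list (diag_mat ?b)" by (rule det_upper_triangular) auto
    also have "\<dots> = (\<Prod>c<j. ?b $$ (c, c))"
      by (simp add: prod_list_diag_prod lessThan_atLeast0)
    finally show ?thesis by simp
  qed
  ultimately show ?thesis
    unfolding left_minor_def case_prod_conv by (simp add: det_mult[of _ j])
qed

lemma mult_perm_mat_entry:
  assumes w: "w permutes {1..n}" and b: "b \<in> carrier_mat n n" and "i < n" "j < n"
  shows "(b * perm_mat n w) $$ (i, j) = b $$ (i, w (Suc j) - 1)"
proof -
  have wj: "w (Suc j) \<in> {1..n}" using permutes_in_image[OF w, of "Suc j"] assms by auto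
  have "(b * perm_mat n w) $$ (i, j) = (\<Sum>m\<in>{0..<n}. b $$ (i, m) * (if m + 1 = w (j + 1) then 1 else 0))"
    using assms by (auto simp: scalar_prod_def perm_mat_def)
  also have "\<dots> = (\<Sum>m\<in>{0..<n}. if m = w (Suc j) - 1 then b $$ (i, m) else 0)"
    using wj by (intro sum.cong) auto
  also have "\<dots> = b $$ (i, w (Suc j) - 1)" using wj by (auto simp: sum.delta)
  finally show ?thesis .
qed

lemma perm_mat_GL:
  assumes w: "w permutes {1..n}"
  shows "perm_mat n w \<in> GL n"
proof -
  have c: "perm_mat n w \<in> carrier_mat n n" for w by (simp add: perm_mat_def)
  have "perm_mat n w * perm_mat n (inv_into UNIV w) = 1\<^sub>m n"
  proof (rule eq_matI)
    fix i j assume "i < dim_row (1\<^sub>m n :: complex mat)" "j < dim_col (1\<^sub>m n :: complex mat)"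
    then have ij: "i < n" "j < n" by simp_all
    have "inv_into UNIV w (Suc j) \<in> {1..n}" using permutes_in_image[OF permutes_inv[OF w], of "Suc j"] ij by auto
    then have "(perm_mat n w * perm_mat n (inv_into UNIV w)) $$ (i, j) =
        (if i + 1 = w (inv_into UNIV w (Suc j)) then 1 else 0)"
      using mult_perm_mat_entry[OF permutes_inv[OF w] c ij] ij by (auto simp: perm_mat_def)
    then show "(perm_mat n w * perm_mat n (inv_into UNIV w)) $$ (i, j) = 1\<^sub>m n $$ (i, j)"
      using ij permutes_inverses(1)[OF w] by auto
  qed (simp_all add: perm_mat_def)
  then have "det (perm_mat n w) * det (perm_mat n (inv_into UNIV w)) = 1"
    using det_mult[OF c c, of w "inv_into UNIV w"] by simp
  then show ?thesis using c by (auto simp: GL_iff_det)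
qed

section \<open>Charts of Schubert cells\<close>

text \<open>\<open>X_entry\<close> says that \<open>X\<close> maps \<open>f_s\<close> to the sum of
  the \<open>f_k\<close> with \<open>adj k s\<close>. The permutation has to agree with
  \<open>pos\<close> only as an ordering, since the labels \<open>w k\<close> need not satisfy
  \<open>adj_shift\<close>.\<close>

locale schubert_chart = label_shift n pos adj h
  for n :: nat and pos :: "nat \<Rightarrow> int" and adj :: "nat \<Rightarrow> nat \<Rightarrow> bool" and h :: "nat \<Rightarrow> nat" +
  fixes w :: "nat \<Rightarrow> nat" and X :: "complex mat"
  assumes w: "w permutes {1..n}"
    and pos_less: "k \<in> {1..n} \<Longrightarrow> j \<in> {1..n} \<Longrightarrow> pos k < pos j \<longleftrightarrow> w k < w j"
    and X: "X \<in> carrier_mat n n"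
    and X_entry: "k \<in> {1..n} \<Longrightarrow> s \<in> {1..n} \<Longrightarrow> X $$ (w k - 1, w s - 1) = (if adj k s then 1 else 0)"
begin

definition chart :: "(nat \<times> nat \<Rightarrow> complex) \<Rightarrow> complex mat" where
  "chart a = mat n n (\<lambda>(i, j). unipotent a (inv_into UNIV w (Suc i)) (Suc j))"

lemma w_range: "k \<in> {1..n} \<Longrightarrow> w k \<in> {1..n}"
  using permutes_in_image[OF w] by blast

lemma w_row: "k \<in> {1..n} \<Longrightarrow> w k - 1 < n"
  using w_range[of k] by auto

lemma inv_w_row: "k \<in> {1..n} \<Longrightarrow> inv_into UNIV w (Suc (w k - 1)) = k"
  using w_range[of k] permutes_inverses(2)[OF w, of k] by simp

lemma row_cases:
  assumes "i < n"
  obtains k where "k \<in> {1..n}" "i = w k - 1"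
proof
  have "Suc i \<in> {1..n}" using assms by simp
  then show "inv_into UNIV w (Suc i) \<in> {1..n}"
    using permutes_in_image[OF permutes_inv[OF w]] by blast
  show "i = w (inv_into UNIV w (Suc i)) - 1" using permutes_inverses(1)[OF w] by simp
qed

lemma bij_betw_rows: "bij_betw (\<lambda>k. w k - 1) {1..n} {0..<n}"
  unfolding bij_betw_def
proof
  show "inj_on (\<lambda>k. w k - 1) {1..n}"
    by (rule inj_on_inverseI[of _ "\<lambda>i. inv_into UNIV w (Suc i)"]) (rule inv_w_row)
  show "(\<lambda>k. w k - 1) ` {1..n} = {0..<n}"
  proof
    show "(\<lambda>k. w k - 1) ` {1..n} \<subseteq> {0..<n}" using w_row by fastforce
    show "{0..<n} \<subseteq> (\<lambda>k. w k - 1) ` {1..n}"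
    proof
      fix i assume "i \<in> {0..<n}"
      then obtain k where "k \<in> {1..n}" "i = w k - 1" using row_cases[of i] by auto
      then show "i \<in> (\<lambda>k. w k - 1) ` {1..n}" by blast
    qed
  qed
qed

lemma chart_carrier: "chart a \<in> carrier_mat n n"
  by (simp add: chart_def)

lemma chart_entry:
  assumes "k \<in> {1..n}" "j < n"
  shows "chart a $$ (w k - 1, j) = unipotent a k (Suc j)"
  using assms w_row[OF assms(1)] by (simp add: chart_def inv_w_row del: One_nat_def)

lemma unipotent_below_diag: "k < j \<Longrightarrow> unipotent a k j = 0"
  by (simp add: unipotent_def cell_pairs_def)

lemma unipotent_w_less:
  assumes "k \<in> {1..n}" "j \<in> {1..n}" "w j < w k"
  shows "unipotent a k j = 0"
proof (rule unipotent_zero)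
  show "pos j \<le> pos k" using pos_less[OF assms(2,1)] assms(3) by simp
qed (use assms(3) in auto)

text \<open>Undoing the column permutation gives the matrix with entry
  \<open>unipotent a k l\<close> in row \<open>w k\<close> and column \<open>w l\<close>. It is
  upper triangular because a nonzero entry requires \<open>w k \<le> w l\<close>.\<close>

lemma chart_cell:
  obtains b where "b \<in> Borel n" "chart a = b * perm_mat n w"
proof
  let ?b = "mat n n (\<lambda>(i, j). unipotent a (inv_into UNIV w (Suc i)) (inv_into UNIV w (Suc j)))"
  have c: "?b \<in> carrier_mat n n" by simp
  have ut: "upper_triangular ?b"
  proof (rule upper_triangularI)
    fix i j assume ij: "j < i" "i < dim_row ?b"
    then have "i < n" "j < n" by simp_all
    then obtain k l where kl: "k \<in> {1..n}" "i = w k - 1" "l \<in> {1..n}" "j = w l - 1"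
      using row_cases by metis
    have "unipotent a k l = 0" using ij kl by (intro unipotent_w_less) auto
    then show "?b $$ (i, j) = 0" using kl w_row by (simp add: inv_w_row del: One_nat_def)
  qed
  have "det ?b = prod_list (diag_mat ?b)" using ut c by (rule det_upper_triangular)
  also have "\<dots> = 1" by (simp add: prod_list_diag_prod unipotent_def)
  finally have det: "det ?b = 1" .
  then show "?b \<in> Borel n" using ut c by (simp add: Borel_def GL_iff_det)
  show "chart a = ?b * perm_mat n w"
  proof (rule eq_matI)
    fix i j assume "i < dim_row (?b * perm_mat n w)" "j < dim_col (?b * perm_mat n w)"
    then have ij: "i < n" "j < n" by (simp_all add: perm_mat_def)
    have j: "Suc j \<in> {1..n}" using ij by simp
    have "(?b * perm_mat n w) $$ (i, j) = ?b $$ (i, w (Suc j) - 1)"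
      using mult_perm_mat_entry[OF w c ij] .
    also have "\<dots> = unipotent a (inv_into UNIV w (Suc i)) (Suc j)"
      using ij w_row[OF j] inv_w_row[OF j] by simp
    finally show "chart a $$ (i, j) = (?b * perm_mat n w) $$ (i, j)" using ij by (simp add: chart_def)
  qed (simp_all add: chart_def perm_mat_def)
qed

lemma chart_GL: "chart a \<in> GL n"
  using chart_cell[of a] GL_mult[OF Borel_GL perm_mat_GL[OF w]] by metis

text \<open>The submatrix is lower triangular, as \<open>v_j\<close> involves no \<open>f_k\<close>
  with \<open>k < j\<close>. Its diagonal entries are 1 except possibly the last one, which is the
  coordinate.\<close>

lemma left_minor_chart:
  assumes "k \<in> {1..n}" "j \<in> {1..n}" "j \<le> k"
  shows "left_minor w (k, j) (chart a) = unipotent a k j"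
proof -
  let ?row = "\<lambda>r. if Suc r < j then Suc r else k"
  let ?M = "mat j j (\<lambda>(r, c). chart a $$ (w (?row r) - 1, c))"
  have row: "?row r \<in> {1..n}" if "r < j" for r using that assms by auto
  have entry: "?M $$ (r, c) = unipotent a (?row r) (Suc c)" if "r < j" "c < j" for r c
    using that chart_entry[OF row[OF that(1)], of c] assms(2) by simp
  have "det ?M = prod_list (diag_mat ?M)"
  proof (rule det_lower_triangular)
    fix r c assume rc: "r < c" "c < j"
    then have "?row r < Suc c" by auto
    then show "?M $$ (r, c) = 0" using entry[of r c] rc unipotent_below_diag by simp
  qed simp
  also have "\<dots> = (\<Prod>r\<in>{0..<j}. ?M $$ (r, r))" by (simp add: prod_list_diag_prod)
  also have "\<dots> = (\<Prod>r\<in>{0..<j}. unipotent a (?row r) (Suc r))"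
    by (rule prod.cong) (use entry in auto)
  also have "{0..<j} = insert (j - 1) {0..<j - 1}" using assms(2) by auto
  also have "(\<Prod>r\<in>\<dots>. unipotent a (?row r) (Suc r)) =
      unipotent a k j * (\<Prod>r\<in>{0..<j - 1}. unipotent a (?row r) (Suc r))"
    using assms(2) by (subst prod.insert) auto
  also have "(\<Prod>r\<in>{0..<j - 1}. unipotent a (?row r) (Suc r)) = 1"
    by (rule prod.neutral) (auto simp: unipotent_def)
  finally show ?thesis by (simp add: left_minor_def)
qed

definition hess_mat :: "(nat \<times> nat \<Rightarrow> complex) \<Rightarrow> complex mat" where
  "hess_mat a = mat n n (\<lambda>(k, r). hess_entry a (Suc r) (Suc k))"

lemma hess_mat_entry:
  assumes "k \<in> {1..n}" "r \<in> {1..n}"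
  shows "hess_mat a $$ (k - 1, r - 1) = hess_entry a r k"
proof -
  have "k - 1 < n" "r - 1 < n" "Suc (k - 1) = k" "Suc (r - 1) = r" using assms by auto
  then show ?thesis unfolding hess_mat_def by (subst index_mat) simp_all
qed

text \<open>Rows indexed by labels make the chart lower unitriangular, and the recursion of
  \<open>hess_entry\<close> is forward substitution for the system that expresses
  \<open>X v_r\<close> by the \<open>v_k\<close>.\<close>

lemma chart_mult_hess_mat: "chart a * hess_mat a = X * chart a"
proof (rule eq_matI)
  fix i j assume "i < dim_row (X * chart a)" "j < dim_col (X * chart a)"
  then have ij: "i < n" "j < n" using X by (simp_all add: chart_def)
  obtain k where k: "k \<in> {1..n}" "i = w k - 1" using row_cases[OF ij(1)] .
  let ?r = "Suc j"
  have r: "?r \<in> {1..n}" using ij by simp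
  have "(chart a * hess_mat a) $$ (i, j) = (\<Sum>m\<in>{0..<n}. chart a $$ (i, m) * hess_mat a $$ (m, j))"
    using ij by (auto simp: scalar_prod_def chart_def hess_mat_def)
  also have "\<dots> = (\<Sum>m\<in>{0..<n}. unipotent a k (Suc m) * hess_entry a ?r (Suc m))"
    using ij k(1) chart_entry[OF k(1)] unfolding k(2) by (intro sum.cong) (auto simp: hess_mat_def)
  also have "\<dots> = (\<Sum>m\<in>{1..n}. unipotent a k m * hess_entry a ?r m)"
    by (rule sum.reindex_bij_witness[of _ "\<lambda>m. m - 1" Suc]) auto
  also have "\<dots> = (\<Sum>m\<in>{1..k}. unipotent a k m * hess_entry a ?r m)"
    using k(1) by (intro sum.mono_neutral_right) (auto simp: unipotent_below_diag)
  also have "{1..k} = insert k {1..<k}" using k(1) by auto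
  also have "(\<Sum>m\<in>\<dots>. unipotent a k m * hess_entry a ?r m) =
      hess_entry a ?r k + (\<Sum>m\<in>{1..<k}. hess_entry a ?r m * unipotent a k m)"
    by (subst sum.insert) (auto simp: unipotent_def[of a k k] mult.commute)
  also have "\<dots> = shifted a k ?r" by (subst (1) hess_entry.simps) simp
  also have "\<dots> = (\<Sum>s\<in>{1..n}. if adj k s then unipotent a s ?r else 0)"
    unfolding shifted_def by (rule sum.mono_neutral_cong_left) auto
  also have "\<dots> = (\<Sum>s\<in>{1..n}. X $$ (i, w s - 1) * chart a $$ (w s - 1, j))"
    using X_entry[OF k(1)] chart_entry[OF _ ij(2)] unfolding k(2) by (intro sum.cong) auto
  also have "\<dots> = (\<Sum>s\<in>{0..<n}. X $$ (i, s) * chart a $$ (s, j))"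
    by (rule sum.reindex_bij_betw[OF bij_betw_rows])
  also have "\<dots> = (X * chart a) $$ (i, j)"
    using ij X by (auto simp: scalar_prod_def chart_def)
  finally show "(chart a * hess_mat a) $$ (i, j) = (X * chart a) $$ (i, j)" .
qed (use X in \<open>simp_all add: chart_def hess_mat_def\<close>)

text \<open>
  Column reduction: the vectors of the reduced basis are found one after the other, the earlier ones
  being used to clear the coordinates \<open>1, \<dots>, j - 1\<close> of the \<open>j\<close>-th one in increasing order.
\<close>

lemma reduced_column_exists:
  assumes b: "b \<in> Borel n" and M: "M = b * perm_mat n w" and "j \<in> {1..n}"
  shows "\<exists>v. v \<in> std_space n j \<and> (M *\<^sub>v v) $ (w j - 1) = 1 \<and>
    (\<forall>k\<in>{1..n}. w j < w k \<or> k < j \<longrightarrow> (M *\<^sub>v v) $ (w k - 1) = 0)"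
  using assms(3)
proof (induction j rule: less_induct)
  case (less j)
  define reduced where "reduced t v \<longleftrightarrow> v \<in> std_space n j \<and> (M *\<^sub>v v) $ (w j - 1) = 1 \<and>
    (\<forall>k\<in>{1..n}. w j < w k \<or> k < t \<longrightarrow> (M *\<^sub>v v) $ (w k - 1) = 0)" for t v
  have bc: "b \<in> carrier_mat n n" using b by (simp add: Borel_GL GL_carrier)
  have Mc: "M \<in> carrier_mat n n" using bc by (simp add: M perm_mat_def)
  have "\<exists>v. reduced t v" if "t \<le> j" for t
    using that
  proof (induction t)
    case 0
    have j: "j - 1 < n" "Suc (j - 1) = j" using less.prems by auto
    let ?d = "b $$ (w j - 1, w j - 1)"
    have d: "?d \<noteq> 0" using Borel_diag_nonzero[OF b w_row[OF less.prems]] .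
    \<comment> \<open>Column \<open>j\<close> of \<open>M\<close> is column \<open>w j\<close> of
      \<open>b\<close>; scaling makes its diagonal entry 1. It vanishes below row
      \<open>w j\<close>, and for \<open>t = 0\<close> no further coordinate must vanish.\<close>
    let ?v = "inverse ?d \<cdot>\<^sub>v unit_vec n (j - 1)"
    have v: "(M *\<^sub>v ?v) $ (w k - 1) = inverse ?d * b $$ (w k - 1, w j - 1)" if k: "k \<in> {1..n}" for k
    proof -
      have "M *\<^sub>v ?v = inverse ?d \<cdot>\<^sub>v col M (j - 1)"
        using mult_mat_vec[OF Mc unit_vec_carrier] mult_unit_vec[OF Mc j(1)] by simp
      then have "(M *\<^sub>v ?v) $ (w k - 1) = inverse ?d * M $$ (w k - 1, j - 1)"
        using Mc w_row[OF k] j(1) by simp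
      then show ?thesis
        using mult_perm_mat_entry[OF w bc w_row[OF k] j(1)] j(2) by (simp add: M)
    qed
    have "(M *\<^sub>v ?v) $ (w k - 1) = 0" if k: "k \<in> {1..n}" "w j < w k" for k
    proof -
      have "w j - 1 < w k - 1" using k w_range[OF less.prems] by auto
      then have "b $$ (w k - 1, w j - 1) = 0"
        using b bc w_row[OF k(1)] by (auto simp: Borel_def upper_triangularD)
      then show ?thesis using v[OF k(1)] by simp
    qed
    moreover have "?v \<in> std_space n j"
      using unit_vec_std_space[of "j - 1" j n] less.prems by (auto simp: std_space_def)
    moreover have "(M *\<^sub>v ?v) $ (w j - 1) = 1" using v[OF less.prems] d by simp
    ultimately have "reduced 0 ?v" unfolding reduced_def by simp
    then show ?case by (rule exI)
  next
    case (Suc t)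
    then obtain v where v': "reduced t v" by auto
    then have v: "v \<in> std_space n j" "(M *\<^sub>v v) $ (w j - 1) = 1"
      "\<And>k. k \<in> {1..n} \<Longrightarrow> w j < w k \<or> k < t \<Longrightarrow> (M *\<^sub>v v) $ (w k - 1) = 0"
      unfolding reduced_def by blast+
    show ?case
    proof (cases "t \<in> {1..n} \<and> w t < w j")
      case True
      have t: "t < j" "t \<in> {1..n}" using Suc.prems True by auto
      from less.IH[OF t] obtain u where u': "u \<in> std_space n t \<and> (M *\<^sub>v u) $ (w t - 1) = 1 \<and>
          (\<forall>k\<in>{1..n}. w t < w k \<or> k < t \<longrightarrow> (M *\<^sub>v u) $ (w k - 1) = 0)" ..
      then have u: "u \<in> std_space n t" "(M *\<^sub>v u) $ (w t - 1) = 1"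
        "\<And>k. k \<in> {1..n} \<Longrightarrow> w t < w k \<or> k < t \<Longrightarrow> (M *\<^sub>v u) $ (w k - 1) = 0"
        by blast+
      \<comment> \<open>Since \<open>w t < w j\<close>, the vector \<open>M u\<close> vanishes in
        row \<open>w j\<close>, in all lower rows, and at the labels before \<open>t\<close>.
        Subtracting a multiple of \<open>u\<close> thus clears the coordinate of \<open>t\<close>
        without spoiling what was achieved.\<close>
      define c where "c = (M *\<^sub>v v) $ (w t - 1)"
      define x where "x = v - c \<cdot>\<^sub>v u"
      have uj: "u \<in> std_space n j" using u(1) std_space_mono[of t j n] t(1) by auto
      have carr: "v \<in> carrier_vec n" "u \<in> carrier_vec n" using v(1) u(1) by (simp_all add: std_space_carrier)
      have "M *\<^sub>v x = M *\<^sub>v v - c \<cdot>\<^sub>v (M *\<^sub>v u)"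
        unfolding x_def using Mc carr by (simp add: mult_minus_distrib_mat_vec mult_mat_vec)
      then have entry: "(M *\<^sub>v x) $ (w k - 1) = (M *\<^sub>v v) $ (w k - 1) - c * (M *\<^sub>v u) $ (w k - 1)"
        if "k \<in> {1..n}" for k
        using Mc w_row[OF that] by simp
      have "(M *\<^sub>v x) $ (w k - 1) = 0" if k: "k \<in> {1..n}" "w j < w k \<or> k < Suc t" for k
      proof (cases "k = t")
        case True
        then show ?thesis using entry[OF k(1)] u(2) by (simp add: c_def)
      next
        case False
        then have "w j < w k \<or> k < t" using k(2) by auto
        then show ?thesis
          using entry[OF k(1)] v(3)[OF k(1)] u(3)[OF k(1)] \<open>t \<in> {1..n} \<and> w t < w j\<close> by auto
      qed
      moreover have "(M *\<^sub>v x) $ (w j - 1) = 1"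
        using entry[OF less.prems] v(2) u(3)[OF less.prems] True by simp
      moreover have "x \<in> std_space n j" using v(1) uj by (auto simp: std_space_def x_def)
      ultimately have "reduced (Suc t) x" unfolding reduced_def by blast
      then show ?thesis by (rule exI)
    next
      case False
      have "(M *\<^sub>v v) $ (w k - 1) = 0" if k: "k \<in> {1..n}" "w j < w k \<or> k < Suc t" for k
      proof (cases "k = t")
        case True
        \<comment> \<open>In this case nothing needs clearing: 0 is not a label, and a label
          \<open>t\<close> with \<open>w j < w t\<close> has coordinate zero already.\<close>
        have "w t \<noteq> w j" using injD[OF permutes_inj[OF w], of t j] Suc.prems by auto
        then have "w j < w k" using True False k(1) by auto
        then show ?thesis using v(3)[OF k(1)] by blast
      qed (use v(3)[OF k(1)] k(2) in auto)
      then have "reduced (Suc t) v" unfolding reduced_def using v(1,2) by blast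
      then show ?thesis by (rule exI)
    qed
  qed
  from this[of j] show ?case by (simp add: reduced_def)
qed

text \<open>For surjectivity, the reduced vectors are the images under \<open>M\<close> of vectors
  \<open>v j\<close> in \<open>std_space n j\<close>. Hence the chart they form is \<open>M\<close>
  times a Borel element and defines the same flag.\<close>

lemma schubert_cell_eq: "schubert_cell n w = (\<lambda>a. flag_of n (chart a)) ` coord_space cell_pairs"
proof
  show "(\<lambda>a. flag_of n (chart a)) ` coord_space cell_pairs \<subseteq> schubert_cell n w"
  proof (rule image_subsetI)
    fix a
    obtain b where "b \<in> Borel n" "chart a = b * perm_mat n w" by (rule chart_cell)
    then show "flag_of n (chart a) \<in> schubert_cell n w"
      unfolding schubert_cell_def flag_of_def by (intro CollectI exI[of _ b]) simp
  qed
  show "schubert_cell n w \<subseteq> (\<lambda>a. flag_of n (chart a)) ` coord_space cell_pairs"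
  proof
    fix V assume "V \<in> schubert_cell n w"
    then obtain b where b: "b \<in> Borel n" "V = flag_of n (b * perm_mat n w)"
      by (auto simp: schubert_cell_def flag_of_def)
    let ?M = "b * perm_mat n w"
    have M: "?M \<in> GL n" using GL_mult[OF Borel_GL[OF b(1)] perm_mat_GL[OF w]] .
    have "\<forall>j\<in>{1..n}. \<exists>v. v \<in> std_space n j \<and> (?M *\<^sub>v v) $ (w j - 1) = 1 \<and>
        (\<forall>k\<in>{1..n}. w j < w k \<or> k < j \<longrightarrow> (?M *\<^sub>v v) $ (w k - 1) = 0)"
      using reduced_column_exists[OF b(1) refl] by (rule ballI)
    from bchoice[OF this] obtain v where
      v': "\<forall>j\<in>{1..n}. v j \<in> std_space n j \<and> (?M *\<^sub>v v j) $ (w j - 1) = 1 \<and>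
        (\<forall>k\<in>{1..n}. w j < w k \<or> k < j \<longrightarrow> (?M *\<^sub>v v j) $ (w k - 1) = 0)" ..
    have v: "v j \<in> std_space n j" "(?M *\<^sub>v v j) $ (w j - 1) = 1" if "j \<in> {1..n}" for j
      using bspec[OF v' that] by simp_all
    have v0: "(?M *\<^sub>v v j) $ (w k - 1) = 0"
      if "j \<in> {1..n}" "k \<in> {1..n}" "w j < w k \<or> k < j" for j k
      using bspec[OF v' that(1)] that(2,3) by blast
    define a where "a = (\<lambda>(k, j). if (k, j) \<in> cell_pairs then (?M *\<^sub>v v j) $ (w k - 1) else 0)"
    have uni: "unipotent a k j = (?M *\<^sub>v v j) $ (w k - 1)" if k: "k \<in> {1..n}" and j: "j \<in> {1..n}" for k j
    proof -
      consider "k = j" | "k < j" | "w j < w k" | "j < k" "w k < w j"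
        using injD[OF permutes_inj[OF w], of k j] by fastforce
      then show ?thesis
      proof cases
        case 1
        then show ?thesis using v(2)[OF j] by (simp add: unipotent_def)
      next
        case 2
        then show ?thesis using v0[OF j k] by (simp add: unipotent_below_diag)
      next
        case 3
        then show ?thesis using v0[OF j k] unipotent_w_less[OF k j] by simp
      next
        case 4
        then have "(k, j) \<in> cell_pairs" using k j pos_less[OF k j] by (simp add: cell_pairs_def)
        then show ?thesis using 4 by (simp add: unipotent_def a_def)
      qed
    qed
    note Mc = GL_carrier[OF M]
    have col: "col (chart a) j = ?M *\<^sub>v v (Suc j)" if j: "j < n" for j
    proof (rule eq_vecI)
      have vj: "v (Suc j) \<in> carrier_vec n" using v(1)[of "Suc j"] j by (simp add: std_space_carrier)
      show "dim_vec (col (chart a) j) = dim_vec (?M *\<^sub>v v (Suc j))"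
        using carrier_matD(1)[OF Mc] by (simp add: chart_def)
      fix i assume "i < dim_vec (?M *\<^sub>v v (Suc j))"
      then have i: "i < n" using carrier_matD(1)[OF Mc] by simp
      then obtain k where k: "k \<in> {1..n}" "i = w k - 1" by (rule row_cases)
      have "col (chart a) j $ i = chart a $$ (i, j)" using i j chart_carrier[of a] by simp
      also have "\<dots> = unipotent a k (Suc j)" unfolding k(2) using k(1) j by (rule chart_entry)
      also have "\<dots> = (?M *\<^sub>v v (Suc j)) $ i" unfolding k(2) using k(1) j by (intro uni) auto
      finally show "col (chart a) j $ i = (?M *\<^sub>v v (Suc j)) $ i" .
    qed
    obtain k where k: "k \<in> GL n" "?M * k = 1\<^sub>m n" "k * ?M = 1\<^sub>m n" using GL_inverse[OF M] by blast
    note kc = GL_carrier[OF k(1)]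
    have "k * chart a \<in> Borel n"
    proof (rule BorelI_columns)
      show "k * chart a \<in> GL n" using k(1) chart_GL by (rule GL_mult)
      fix j assume j: "j < n"
      have vj: "v (Suc j) \<in> std_space n (Suc j)" using v(1)[of "Suc j"] j by simp
      have "col (k * chart a) j = k *\<^sub>v col (chart a) j"
        using kc chart_carrier j by (intro col_mult2) auto
      also have "\<dots> = v (Suc j)"
        unfolding col[OF j] using assoc_mult_mat_vec[OF kc Mc std_space_carrier[OF vj]] k(3)
          std_space_carrier[OF vj] by simp
      finally show "col (k * chart a) j \<in> std_space n (Suc j)" using vj by simp
    qed
    moreover have "chart a = ?M * (k * chart a)"
      using assoc_mult_mat[OF Mc kc chart_carrier] k(2) chart_carrier by (metis left_mult_one_mat)
    ultimately have "flag_of n ?M = flag_of n (chart a)"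
      using flag_of_eq_iff[OF M chart_GL] by blast
    moreover have "a \<in> coord_space cell_pairs" by (auto simp: coord_space_def a_def)
    ultimately show "V \<in> (\<lambda>a. flag_of n (chart a)) ` coord_space cell_pairs" using b(2) by blast
  qed
qed

text \<open>Two charts of one flag differ by a Borel element, which scales all minors with the same
  \<open>j\<close> alike; the minor at \<open>(j, j)\<close> is 1 in both, so the factor is
  1.\<close>

lemma inj_flag_of_chart: "inj_on (\<lambda>a. flag_of n (chart a)) (coord_space cell_pairs)"
proof (rule inj_onI)
  fix a a' assume a: "a \<in> coord_space cell_pairs" "a' \<in> coord_space cell_pairs"
    and eq: "flag_of n (chart a) = flag_of n (chart a')"
  obtain b where b: "b \<in> Borel n" "chart a' = chart a * b"
    using eq flag_of_eq_iff[OF chart_GL chart_GL] by blast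
  have "a (k, j) = a' (k, j)" if "(k, j) \<in> cell_pairs" for k j
  proof -
    have kj: "k \<in> {1..n}" "j \<in> {1..n}" "j < k" using that by (auto simp: cell_pairs_def)
    have "unipotent a' m j = unipotent a m j * (\<Prod>c<j. b $$ (c, c))" if "m \<in> {1..n}" "j \<le> m" for m
    proof -
      have "left_minor w (m, j) (chart a') = left_minor w (m, j) (chart a) * (\<Prod>c<j. b $$ (c, c))"
        unfolding b(2) by (rule left_minor_mult_Borel[OF w that(1) _ chart_carrier b(1)]) (use kj in simp)
      then show ?thesis using left_minor_chart[OF that(1) kj(2) that(2)] by simp
    qed
    from this[of j] this[of k] show ?thesis
      using kj that by (simp add: unipotent_def)
  qed
  then have "a p = a' p" if "p \<in> cell_pairs" for p using that by (cases p) simp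
  moreover have "a p = a' p" if "p \<notin> cell_pairs" for p using a that by (cases p) (simp add: coord_space_def)
  ultimately show "a = a'" by blast
qed

lemma cell_Int_Hess:
  assumes h: "h \<in> {1..n} \<rightarrow> {0..n - 1}" and mono: "mono_on {1..n} h"
  shows "schubert_cell n w \<inter> Hess n X h = (\<lambda>a. flag_of n (chart a)) ` hess_points"
proof -
  have C: "hess_mat a \<in> carrier_mat n n" for a by (simp add: hess_mat_def)
  have "flag_of n (chart a) \<in> Hess n X h \<longleftrightarrow>
      (\<forall>r\<in>{1..n}. \<forall>k\<in>{1..n}. h r < k \<longrightarrow> hess_entry a r k = 0)" for a
    unfolding flag_of_Hess_iff[OF chart_GL X C chart_mult_hess_mat h mono]
    by (intro ball_cong refl imp_cong) (simp only: hess_mat_entry)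
  then show ?thesis unfolding schubert_cell_eq hess_points_def by blast
qed

text \<open>Its nonvanishing locus is the translate by \<open>w\<close> of the opposite big cell, an
  open set containing all charts.\<close>

definition cell_denominator :: "complex mat \<Rightarrow> complex" where
  "cell_denominator g = (\<Prod>j\<in>{1..n}. left_minor w (j, j) g)"

text \<open>Extends the coordinates beyond the cell. Closed subsets of the cell are traces of closed
  sets of flags, so functions on the cell alone would not produce them.\<close>

definition cell_coords :: "complex mat \<Rightarrow> nat \<times> nat \<Rightarrow> complex" where
  "cell_coords g p = left_minor w p g / left_minor w (snd p, snd p) g"

text \<open>Openness is tested by polynomials in the matrix entries, whereas the coordinates are
  quotients; a power of the common denominator makes up the difference.\<close>

lemma clear_denominator:
  assumes "f \<in> mpoly_fun I" "I \<subseteq> cell_pairs"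
  shows "\<exists>N. \<exists>p\<in>poly_fun n. \<forall>g. cell_denominator g \<noteq> 0 \<longrightarrow>
    p g = cell_denominator g ^ N * f (cell_coords g)"
  using assms(1)
proof (induction rule: mpoly_fun.induct)
  case (const c)
  show ?case by (rule exI[of _ 0], rule bexI[of _ "\<lambda>_. c"]) (auto intro: poly_fun.const)
next
  case (coord i)
  obtain k j where i: "i = (k, j)" by (cases i)
  have kj: "k \<in> {1..n}" "j \<in> {1..n}" using coord assms(2) by (auto simp: i cell_pairs_def)
  let ?p = "\<lambda>g. left_minor w (k, j) g * (\<Prod>m\<in>{1..n} - {j}. left_minor w (m, m) g)"
  have "?p \<in> poly_fun n"
    using kj by (intro poly_fun.mult poly_fun_prod left_minor_poly[OF w]) auto
  moreover have "\<forall>g. cell_denominator g \<noteq> 0 \<longrightarrow> ?p g = cell_denominator g ^ 1 * cell_coords g i"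
  proof (intro allI impI)
    fix g assume nz: "cell_denominator g \<noteq> 0"
    have "cell_denominator g = left_minor w (j, j) g * (\<Prod>m\<in>{1..n} - {j}. left_minor w (m, m) g)"
      unfolding cell_denominator_def using kj by (intro prod.remove) auto
    then show "?p g = cell_denominator g ^ 1 * cell_coords g i"
      using nz by (simp add: cell_coords_def i)
  qed
  ultimately show ?case by (intro exI[of _ 1] bexI[of _ ?p])
next
  case (add f f')
  then obtain N p N' p' where p: "p \<in> poly_fun n" "p' \<in> poly_fun n"
    and eq: "\<And>g. cell_denominator g \<noteq> 0 \<Longrightarrow> p g = cell_denominator g ^ N * f (cell_coords g)"
      "\<And>g. cell_denominator g \<noteq> 0 \<Longrightarrow> p' g = cell_denominator g ^ N' * f' (cell_coords g)"
    by blast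
  have D: "cell_denominator \<in> poly_fun n"
    unfolding cell_denominator_def by (intro poly_fun_prod left_minor_poly[OF w]) auto
  let ?p = "\<lambda>g. p g * cell_denominator g ^ N' + p' g * cell_denominator g ^ N"
  have "?p \<in> poly_fun n" using p D by (intro poly_fun.add poly_fun.mult poly_fun_power)
  moreover have "\<forall>g. cell_denominator g \<noteq> 0 \<longrightarrow>
      ?p g = cell_denominator g ^ (N + N') * (f (cell_coords g) + f' (cell_coords g))"
    using eq by (simp add: power_add algebra_simps)
  ultimately show ?case by (intro exI[of _ "N + N'"] bexI[of _ ?p])
next
  case (mult f f')
  then obtain N p N' p' where p: "p \<in> poly_fun n" "p' \<in> poly_fun n"
    and eq: "\<And>g. cell_denominator g \<noteq> 0 \<Longrightarrow> p g = cell_denominator g ^ N * f (cell_coords g)"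
      "\<And>g. cell_denominator g \<noteq> 0 \<Longrightarrow> p' g = cell_denominator g ^ N' * f' (cell_coords g)"
    by blast
  have "(\<lambda>g. p g * p' g) \<in> poly_fun n" using p by (rule poly_fun.mult)
  moreover have "\<forall>g. cell_denominator g \<noteq> 0 \<longrightarrow>
      p g * p' g = cell_denominator g ^ (N + N') * (f (cell_coords g) * f' (cell_coords g))"
    using eq by (simp add: power_add algebra_simps)
  ultimately show ?case by (intro exI[of _ "N + N'"] bexI[of _ "\<lambda>g. p g * p' g"])
qed

lemma cell_coords_mult_Borel:
  assumes g: "g \<in> GL n" and b: "b \<in> Borel n"
  shows "cell_denominator (g * b) \<noteq> 0 \<longleftrightarrow> cell_denominator g \<noteq> 0"
    and "p \<in> cell_pairs \<Longrightarrow> cell_coords (g * b) p = cell_coords g p"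
proof -
  have diag: "(\<Prod>c<j. b $$ (c, c)) \<noteq> 0" if "j \<le> n" for j
    using Borel_diag_nonzero[OF b] that by auto
  have minor: "left_minor w (k, j) (g * b) = left_minor w (k, j) g * (\<Prod>c<j. b $$ (c, c))"
    if "k \<in> {1..n}" "j \<le> n" for k j
    using left_minor_mult_Borel[OF w that GL_carrier[OF g] b] .
  show "cell_denominator (g * b) \<noteq> 0 \<longleftrightarrow> cell_denominator g \<noteq> 0"
    unfolding cell_denominator_def using minor diag by auto
  show "p \<in> cell_pairs \<Longrightarrow> cell_coords (g * b) p = cell_coords g p"
    using minor diag[of "snd p"] by (auto simp: cell_coords_def cell_pairs_def)
qed

lemma cell_denominator_chart: "cell_denominator (chart a) = 1"
  unfolding cell_denominator_def using left_minor_chart by (simp add: unipotent_def)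

lemma cell_coords_chart:
  assumes "p \<in> cell_pairs"
  shows "cell_coords (chart a) p = a p"
  using assms left_minor_chart[of "fst p" "snd p" a] left_minor_chart[of "snd p" "snd p" a]
  by (auto simp: cell_coords_def cell_pairs_def unipotent_def)

text \<open>The defining conditions are invariant under the Borel group, so the full preimage of
  \<open>U\<close> in \<open>GL n\<close> is given by them. After clearing denominators it is the
  nonvanishing locus of one polynomial.\<close>

lemma open_cell_coords:
  assumes f: "f \<in> mpoly_fun I" and I: "I \<subseteq> cell_pairs"
  defines "U \<equiv> flag_of n ` {g \<in> GL n. cell_denominator g \<noteq> 0 \<and> f (cell_coords g) \<noteq> 0}"
  shows "openin (flag_variety n) U"
    and "flag_of n (chart a) \<in> U \<longleftrightarrow> f a \<noteq> 0"
proof -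
  have mem: "flag_of n g \<in> U \<longleftrightarrow> cell_denominator g \<noteq> 0 \<and> f (cell_coords g) \<noteq> 0" if g: "g \<in> GL n" for g
  proof
    assume "flag_of n g \<in> U"
    then obtain g' where g': "g' \<in> GL n" "flag_of n g' = flag_of n g"
      "cell_denominator g' \<noteq> 0" "f (cell_coords g') \<noteq> 0" by (auto simp: U_def)
    then obtain b where b: "b \<in> Borel n" "g = g' * b" using flag_of_eq_iff[OF g'(1) g] by blast
    have "f (cell_coords g) = f (cell_coords g')"
      by (rule mpoly_fun_cong[OF f]) (use cell_coords_mult_Borel(2)[OF g'(1) b(1)] I b(2) in auto)
    then show "cell_denominator g \<noteq> 0 \<and> f (cell_coords g) \<noteq> 0"
      using cell_coords_mult_Borel(1)[OF g'(1) b(1)] g'(3,4) b(2) by simp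
  qed (use g in \<open>auto simp: U_def\<close>)
  obtain N p where p: "p \<in> poly_fun n"
    "\<And>g. cell_denominator g \<noteq> 0 \<Longrightarrow> p g = cell_denominator g ^ N * f (cell_coords g)"
    using clear_denominator[OF f I] by blast
  have D: "cell_denominator \<in> poly_fun n"
    unfolding cell_denominator_def by (intro poly_fun_prod left_minor_poly[OF w]) auto
  have "{g \<in> GL n. flag_act n g (std_flag n) \<in> U} =
      {g \<in> GL n. \<exists>q\<in>{\<lambda>g. cell_denominator g * p g}. q g \<noteq> 0}"
    using mem p(2) by (auto simp: flag_of_def[symmetric])
  moreover have "{\<lambda>g. cell_denominator g * p g} \<subseteq> poly_fun n"
    using poly_fun.mult[OF D p(1)] by simp
  ultimately have "openin (zariski_GL n) {g \<in> GL n. flag_act n g (std_flag n) \<in> U}"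
    unfolding openin_zariski_GL by blast
  then show "openin (flag_variety n) U"
    unfolding openin_flag_variety using flag_of_Flags by (auto simp: U_def)
  have "f (cell_coords (chart a)) = f a"
    by (rule mpoly_fun_cong[OF f]) (use cell_coords_chart I in auto)
  then show "flag_of n (chart a) \<in> U \<longleftrightarrow> f a \<noteq> 0"
    using mem[OF chart_GL] cell_denominator_chart by simp
qed

lemma cell_Int_Hess_empty:
  assumes "h \<in> {1..n} \<rightarrow> {0..n - 1}" "mono_on {1..n} h" and "adj l r" "h r < l"
  shows "schubert_cell n w \<inter> Hess n X h = {}"
  using cell_Int_Hess[OF assms(1,2)] hess_points_empty[OF assms(3,4)] by simp

text \<open>The map \<open>\<phi>\<close> matches closed sets in both directions: chart entries are
  polynomials in the free coordinates, and conversely every polynomial in these has a nonvanishing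
  locus that extends to an open set of flags.\<close>

lemma cell_Int_Hess_dim:
  assumes h: "h \<in> {1..n} \<rightarrow> {0..n - 1}" "mono_on {1..n} h"
    and strict: "\<And>l r. adj l r \<Longrightarrow> l \<le> h r"
  shows "schubert_cell n w \<inter> Hess n X h \<noteq> {}"
    and "flag_dim n (schubert_cell n w \<inter> Hess n X h) = enat (card (cell_pairs - bound_pairs))"
proof -
  let ?I = "cell_pairs - bound_pairs" and ?S = "schubert_cell n w \<inter> Hess n X h"
  obtain \<psi> where bij: "bij_betw \<psi> (coord_space ?I) hess_points"
    and poly: "\<And>p. (\<lambda>x. \<psi> x p) \<in> mpoly_fun ?I"
    and free: "\<And>x p. p \<in> ?I \<Longrightarrow> \<psi> x p = x p"
    using hess_points_parametrization[OF strict] by blast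
  define \<phi> where "\<phi> = (\<lambda>x. flag_of n (chart (\<psi> x)))"
  have S: "?S = (\<lambda>a. flag_of n (chart a)) ` hess_points" by (rule cell_Int_Hess[OF h])
  have "inj_on (\<lambda>a. flag_of n (chart a)) hess_points"
    by (rule inj_on_subset[OF inj_flag_of_chart]) (auto simp: hess_points_def)
  then have "bij_betw (\<lambda>a. flag_of n (chart a)) hess_points ?S" unfolding S by (rule inj_on_imp_bij_betw)
  from bij_betw_trans[OF bij this] have bij_\<phi>: "bij_betw \<phi> (coord_space ?I) ?S"
    by (simp add: \<phi>_def comp_def)
  then have img: "\<phi> ` coord_space ?I = ?S" by (simp add: bij_betw_def)
  have "(\<lambda>_. 0) \<in> coord_space ?I" by (simp add: coord_space_def)
  then show "?S \<noteq> {}" using img by blast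
  have "?S \<subseteq> topspace (flag_variety n)"
    unfolding S using topspace_flag_variety_flag_of[OF chart_GL] by blast
  then have top: "topspace (subtopology (flag_variety n) ?S) = ?S"
    unfolding topspace_subtopology by (rule Int_absorb1)
  have chart_poly: "(\<lambda>x. chart (\<psi> x) $$ (r, c)) \<in> mpoly_fun ?I" if rc: "r < n" "c < n" for r c
  proof -
    let ?k = "inv_into UNIV w (Suc r)"
    have "(\<lambda>x. unipotent (\<psi> x) ?k (Suc c)) \<in> mpoly_fun ?I"
      using poly unfolding unipotent_def
      by (cases "?k = Suc c"; cases "(?k, Suc c) \<in> cell_pairs") (simp_all add: mpoly_fun.const)
    then show ?thesis using rc by (simp add: chart_def)
  qed
  show "flag_dim n ?S = enat (card ?I)"
    unfolding flag_dim_def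
  proof (rule krull_dim_coord_space)
    show "finite ?I" using finite_cell_pairs by simp
    show "bij_betw \<phi> (coord_space ?I) (topspace (subtopology (flag_variety n) ?S))"
      using bij_\<phi> top by simp
    fix C assume "C \<subseteq> topspace (subtopology (flag_variety n) ?S)"
    then have C: "C \<subseteq> ?S" using top by simp
    show "closedin (subtopology (flag_variety n) ?S) C \<longleftrightarrow>
      (\<exists>F\<subseteq>mpoly_fun ?I. {x \<in> coord_space ?I. \<phi> x \<in> C} = {x \<in> coord_space ?I. \<forall>f\<in>F. f x = 0})"
    proof
      assume "closedin (subtopology (flag_variety n) ?S) C"
      then obtain T where T: "closedin (flag_variety n) T" "C = T \<inter> ?S"
        by (auto simp: closedin_subtopology)
      have "openin (flag_variety n) (topspace (flag_variety n) - T)" using T(1) by blast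
      then obtain F where F: "F \<subseteq> poly_fun n"
        "{g \<in> GL n. flag_of n g \<in> topspace (flag_variety n) - T} = {g \<in> GL n. \<exists>f\<in>F. f g \<noteq> 0}"
        unfolding openin_flag_variety openin_zariski_GL flag_of_def by blast
      \<comment> \<open>The equations of the preimage of \<open>T\<close> in \<open>GL n\<close>,
        evaluated along the charts.\<close>
      let ?F = "(\<lambda>f x. f (chart (\<psi> x))) ` F"
      have sub: "?F \<subseteq> mpoly_fun ?I" using F(1) poly_fun_compose[OF _ chart_poly] by blast
      have mem: "\<phi> x \<in> C \<longleftrightarrow> (\<forall>f\<in>?F. f x = 0)" if x: "x \<in> coord_space ?I" for x
      proof -
        have "\<phi> x \<in> ?S" using x img by blast
        then have "\<phi> x \<in> C \<longleftrightarrow> \<phi> x \<in> T" using T(2) by blast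
        also have "\<dots> \<longleftrightarrow> chart (\<psi> x) \<notin> {g \<in> GL n. flag_of n g \<in> topspace (flag_variety n) - T}"
          using chart_GL topspace_flag_variety_flag_of[OF chart_GL] by (simp add: \<phi>_def)
        also have "\<dots> \<longleftrightarrow> (\<forall>f\<in>?F. f x = 0)"
          unfolding F(2) using chart_GL by simp
        finally show ?thesis .
      qed
      have "{x \<in> coord_space ?I. \<phi> x \<in> C} = {x \<in> coord_space ?I. \<forall>f\<in>?F. f x = 0}"
        by (intro Collect_cong conj_cong refl mem)
      with sub show "\<exists>F\<subseteq>mpoly_fun ?I. {x \<in> coord_space ?I. \<phi> x \<in> C} = {x \<in> coord_space ?I. \<forall>f\<in>F. f x = 0}"
        by (intro exI[of _ ?F] conjI)
    next
      assume "\<exists>F\<subseteq>mpoly_fun ?I. {x \<in> coord_space ?I. \<phi> x \<in> C} = {x \<in> coord_space ?I. \<forall>f\<in>F. f x = 0}"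
      then obtain F where F: "F \<subseteq> mpoly_fun ?I"
        "{x \<in> coord_space ?I. \<phi> x \<in> C} = {x \<in> coord_space ?I. \<forall>f\<in>F. f x = 0}" by blast
      let ?U = "\<lambda>f. flag_of n ` {g \<in> GL n. cell_denominator g \<noteq> 0 \<and> f (cell_coords g) \<noteq> 0}"
      let ?T = "topspace (flag_variety n) - (\<Union>f\<in>F. ?U f)"
      have I: "?I \<subseteq> cell_pairs" by blast
      have open_U: "openin (flag_variety n) (?U f)" if "f \<in> F" for f
        using open_cell_coords(1)[OF _ I] F(1) that by blast
      then have "closedin (flag_variety n) ?T" by (intro closedin_diff closedin_topspace openin_Union) auto
      moreover have "C = ?T \<inter> ?S"
      proof -
        have mem: "\<phi> x \<in> ?T \<longleftrightarrow> \<phi> x \<in> C" if x: "x \<in> coord_space ?I" for x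
        proof -
          have "\<phi> x \<in> ?U f \<longleftrightarrow> f x \<noteq> 0" if "f \<in> F" for f
          proof -
            have f: "f \<in> mpoly_fun ?I" using that F(1) by blast
            \<comment> \<open>\<open>f\<close> reads only free coordinates, which
              \<open>\<psi>\<close> leaves unchanged.\<close>
            have "f (\<psi> x) = f x" by (rule mpoly_fun_cong[OF f free])
            then show ?thesis using open_cell_coords(2)[OF f I, of "\<psi> x"] by (simp add: \<phi>_def)
          qed
          moreover have "\<phi> x \<in> topspace (flag_variety n)"
            unfolding \<phi>_def using chart_GL by (rule topspace_flag_variety_flag_of)
          ultimately have "\<phi> x \<in> ?T \<longleftrightarrow> (\<forall>f\<in>F. f x = 0)" by blast
          also have "\<dots> \<longleftrightarrow> x \<in> {x \<in> coord_space ?I. \<phi> x \<in> C}" unfolding F(2) using x by simp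
          finally show ?thesis using x by simp
        qed
        have mem_S: "V \<in> C \<longleftrightarrow> V \<in> ?T" if "V \<in> ?S" for V
        proof -
          have "V \<in> \<phi> ` coord_space ?I" unfolding img by (rule that)
          then obtain x where x: "V = \<phi> x" "x \<in> coord_space ?I" by (rule imageE)
          show ?thesis unfolding x(1) using mem[OF x(2)] by (rule sym)
        qed
        show ?thesis
        proof (rule subset_antisym; rule subsetI)
          fix V assume V: "V \<in> C"
          have VS: "V \<in> ?S" using C V by (rule subsetD)
          show "V \<in> ?T \<inter> ?S" by (rule IntI[OF iffD1[OF mem_S[OF VS] V] VS])
        next
          fix V assume V: "V \<in> ?T \<inter> ?S"
          show "V \<in> C" by (rule iffD2[OF mem_S[OF IntD2[OF V]] IntD1[OF V]])
        qed
      qed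
      ultimately show "closedin (subtopology (flag_variety n) ?S) C"
        unfolding closedin_subtopology by (intro exI[of _ ?T] conjI)
    qed
  qed
qed

end

section \<open>Combinatorics of fillings\<close>

lemma finite_diagram: "finite (diagram lam)"
proof -
  have "diagram lam = (SIGMA i:{..<length lam}. {..<lam ! i})" by (auto simp: diagram_def)
  then show ?thesis by simp
qed

lemma card_diagram: "card (diagram lam) = sum_list lam"
proof -
  have "diagram lam = (SIGMA i:{..<length lam}. {..<lam ! i})" by (auto simp: diagram_def)
  then show ?thesis by (simp add: sum_list_sum_nth lessThan_atLeast0)
qed

lemma diagram_left: "(i, j) \<in> diagram lam \<Longrightarrow> j' \<le> j \<Longrightarrow> (i, j') \<in> diagram lam"
  by (auto simp: diagram_def)

lemma diagram_up:
  assumes "is_partition lam n" "(i, j) \<in> diagram lam" "i' \<le> i"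
  shows "(i', j) \<in> diagram lam"
proof (cases "i' = i")
  case False
  then have "lam ! i' \<ge> lam ! i"
    using assms by (auto simp: is_partition_def diagram_def sorted_wrt_iff_nth_less)
  then show ?thesis using assms(2,3) by (auto simp: diagram_def)
qed (use assms in simp)

lemma diagram_row_less: "is_partition lam n \<Longrightarrow> (i, j) \<in> diagram lam \<Longrightarrow> i < n"
proof -
  assume lam: "is_partition lam n" and ij: "(i, j) \<in> diagram lam"
  have "(\<lambda>i. (i, j)) ` {..i} \<subseteq> diagram lam" using diagram_up[OF lam ij] by auto
  then have "card ((\<lambda>i. (i, j)) ` {..i}) \<le> n"
    using card_mono[OF finite_diagram] card_diagram[of lam] lam by (fastforce simp: is_partition_def)
  then show "i < n" by (subst (asm) card_image) (auto intro: inj_onI)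
qed

lemma base_filling_strict:
  assumes "p \<in> diagram lam" "q \<in> diagram lam"
    and "snd p < snd q \<or> (snd p = snd q \<and> fst p > fst q)"
  shows "base_filling lam p < base_filling lam q"
proof -
  obtain i j i' j' where pq: "p = (i, j)" "q = (i', j')" by (cases p, cases q)
  let ?S = "\<lambda>i j. {(i', j') \<in> diagram lam. j' < j \<or> (j' = j \<and> i' \<ge> i)}"
  have "?S i j \<subseteq> ?S i' j'" using assms by (auto simp: pq)
  moreover have "(i', j') \<in> ?S i' j' - ?S i j" using assms by (auto simp: pq)
  moreover have "finite (?S i' j')" using finite_diagram by (rule rev_finite_subset) auto
  ultimately have "card (?S i j) < card (?S i' j')" by (intro psubset_card_mono) blast+
  then show ?thesis by (simp add: pq base_filling_def)
qed

lemma base_filling_less_iff: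
  assumes "p \<in> diagram lam" "q \<in> diagram lam"
  shows "base_filling lam p < base_filling lam q \<longleftrightarrow>
    snd p < snd q \<or> (snd p = snd q \<and> fst p > fst q)"
proof (cases "p = q")
  case False
  then have "snd p < snd q \<or> (snd p = snd q \<and> fst p > fst q) \<or>
      snd q < snd p \<or> (snd q = snd p \<and> fst q > fst p)"
    by (auto simp: prod_eq_iff)
  then show ?thesis
    using base_filling_strict[OF assms] base_filling_strict[OF assms(2,1)] by auto
qed simp

lemma bij_betw_base_filling:
  assumes "is_partition lam n"
  shows "bij_betw (base_filling lam) (diagram lam) {1..n}"
proof -
  have inj: "inj_on (base_filling lam) (diagram lam)"
  proof (rule inj_onI)
    fix p q assume pq: "p \<in> diagram lam" "q \<in> diagram lam" "base_filling lam p = base_filling lam q"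
    then show "p = q"
      using base_filling_less_iff[OF pq(1,2)] base_filling_less_iff[OF pq(2,1)]
      by (cases p; cases q) auto
  qed
  have "base_filling lam p \<in> {1..n}" if "p \<in> diagram lam" for p
  proof -
    obtain i j where p: "p = (i, j)" by (cases p)
    let ?S = "{(i', j') \<in> diagram lam. j' < j \<or> (j' = j \<and> i' \<ge> i)}"
    have fin: "finite ?S" using finite_diagram by (rule rev_finite_subset) auto
    have "(i, j) \<in> ?S" using that p by auto
    then have "?S \<noteq> {}" by blast
    then have "card ?S \<ge> 1" using fin by (simp add: Suc_leI card_gt_0_iff)
    moreover have "card ?S \<le> card (diagram lam)" using finite_diagram by (rule card_mono) auto
    ultimately show ?thesis
      using assms by (auto simp: p base_filling_def card_diagram is_partition_def)
  qed
  then have "base_filling lam ` diagram lam = {1..n}"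
    using assms by (intro card_subset_eq)
      (auto simp: card_image[OF inj] card_diagram is_partition_def)
  then show ?thesis using inj by (simp add: bij_betw_def)
qed

lemma bij_betw_filling_of:
  assumes "is_partition lam n" "w permutes {1..n}"
  shows "bij_betw (filling_of lam w) (diagram lam) {1..n}"
  using bij_betw_trans[OF bij_betw_base_filling[OF assms(1)] permutes_imp_bij[OF permutes_inv[OF assms(2)]]]
  by (simp add: filling_of_def comp_def)

text \<open>Sorting produces a filling, while maximality ranges over permutations; this translates
  back. Agreement can be asked only on the diagram, where alone \<open>T\<close> is
  meaningful.\<close>

lemma filling_of_surj:
  assumes lam: "is_partition lam n" and T: "bij_betw T (diagram lam) {1..n}"
  obtains v where "v permutes {1..n}" "\<And>p. p \<in> diagram lam \<Longrightarrow> filling_of lam v p = T p"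
proof -
  define v where "v = (\<lambda>x. if x \<in> {1..n} then base_filling lam (inv_into (diagram lam) T x) else x)"
  have "bij_betw (\<lambda>x. base_filling lam (inv_into (diagram lam) T x)) {1..n} {1..n}"
    using bij_betw_trans[OF bij_betw_inv_into[OF T] bij_betw_base_filling[OF lam]]
    by (simp add: comp_def)
  then have "bij_betw v {1..n} {1..n}"
    by (rule bij_betw_cong[THEN iffD1, rotated]) (simp add: v_def)
  then have v: "v permutes {1..n}"
    by (rule bij_imp_permutes) (simp only: v_def if_False)
  have "filling_of lam v p = T p" if p: "p \<in> diagram lam" for p
  proof -
    have "T p \<in> {1..n}" using T p by (auto simp: bij_betw_def)
    then have "v (T p) = base_filling lam p"
      using T p by (simp only: v_def if_True bij_betw_def inv_into_f_f)
    then show ?thesis unfolding filling_of_def using permutes_inverses(2)[OF v] by metis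
  qed
  with v show thesis using that by blast
qed

section \<open>Counting inversions by columns\<close>

definition right_box :: "nat \<times> nat \<Rightarrow> nat \<times> nat" where
  "right_box p = (fst p, Suc (snd p))"

definition right_bounded :: "nat list \<Rightarrow> (nat \<Rightarrow> nat) \<Rightarrow> (nat \<times> nat \<Rightarrow> nat) \<Rightarrow> nat \<times> nat \<Rightarrow> nat \<times> nat \<Rightarrow> bool" where
  "right_bounded lam h T p q \<longleftrightarrow> (right_box q \<in> diagram lam \<longrightarrow> T p \<le> h (T (right_box q)))"

definition inversion_boxes :: "nat list \<Rightarrow> (nat \<Rightarrow> nat) \<Rightarrow> (nat \<times> nat \<Rightarrow> nat) \<Rightarrow> ((nat \<times> nat) \<times> nat \<times> nat) set" where
  "inversion_boxes lam h T = {(p, q). p \<in> diagram lam \<and> q \<in> diagram lam \<and> T p > T q \<and>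
     ((snd p = snd q \<and> fst p > fst q) \<or> snd p < snd q) \<and> right_bounded lam h T p q}"

text \<open>
  Unlike the inversions themselves, these pairs disregard the order within columns, which makes their
  number depend only on the sets of entries of the columns.
\<close>

definition column_inversion_boxes :: "nat list \<Rightarrow> (nat \<Rightarrow> nat) \<Rightarrow> (nat \<times> nat \<Rightarrow> nat) \<Rightarrow> ((nat \<times> nat) \<times> nat \<times> nat) set" where
  "column_inversion_boxes lam h T = {(p, q). p \<in> diagram lam \<and> q \<in> diagram lam \<and> T p > T q \<and>
     snd p \<le> snd q \<and> right_bounded lam h T p q}"

lemma hess_inversions_eq_image:
  "hess_inversions lam h w =
    map_prod (filling_of lam w) (filling_of lam w) ` inversion_boxes lam h (filling_of lam w)"
  unfolding hess_inversions_def inversion_boxes_def right_bounded_def right_box_def Let_def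
  by (auto simp: image_iff; fastforce)

lemma card_hess_inversions:
  assumes "inj_on (filling_of lam w) (diagram lam)"
  shows "card (hess_inversions lam h w) = card (inversion_boxes lam h (filling_of lam w))"
  unfolding hess_inversions_eq_image
  by (rule card_image) (use assms in \<open>auto simp: inj_on_def inversion_boxes_def\<close>)

lemma right_bounded_cong:
  "(\<And>p. p \<in> diagram lam \<Longrightarrow> T p = T' p) \<Longrightarrow> p \<in> diagram lam \<Longrightarrow>
    right_bounded lam h T p q = right_bounded lam h T' p q"
  by (auto simp: right_bounded_def)

lemma inversion_boxes_cong:
  assumes "\<And>p. p \<in> diagram lam \<Longrightarrow> T p = T' p"
  shows "inversion_boxes lam h T = inversion_boxes lam h T'"
  unfolding inversion_boxes_def using assms right_bounded_cong[of lam T T', OF assms] by auto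

lemma card_pairs_reindex:
  assumes "bij_betw \<sigma> D D"
  shows "card {(p, q). p \<in> D \<and> q \<in> D \<and> R (\<sigma> p) (\<sigma> q)} = card {(p, q). p \<in> D \<and> q \<in> D \<and> R p q}"
proof (rule bij_betw_same_card)
  show "bij_betw (map_prod \<sigma> \<sigma>) {(p, q). p \<in> D \<and> q \<in> D \<and> R (\<sigma> p) (\<sigma> q)}
    {(p, q). p \<in> D \<and> q \<in> D \<and> R p q}"
    unfolding bij_betw_def
  proof
    show "inj_on (map_prod \<sigma> \<sigma>) {(p, q). p \<in> D \<and> q \<in> D \<and> R (\<sigma> p) (\<sigma> q)}"
      using assms by (auto simp: inj_on_def bij_betw_def)
    have "\<sigma> ` D = D" using assms by (simp add: bij_betw_def)
    then show "map_prod \<sigma> \<sigma> ` {(p, q). p \<in> D \<and> q \<in> D \<and> R (\<sigma> p) (\<sigma> q)} =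
      {(p, q). p \<in> D \<and> q \<in> D \<and> R p q}"
      by (auto simp: image_iff set_eq_iff; metis)
  qed
qed

text \<open>Drop the condition \<open>T p > T q\<close> and count the right-bounded pairs: either
  \<open>q\<close> has no right neighbour, or replacing \<open>q\<close> by it gives a pair counted
  by the second term. The pairs with \<open>T p \<le> T q\<close> are then subtracted; strictness
  makes all of them right-bounded, so the subtraction is exact. No term sees the rows of the
  entries.\<close>

lemma card_column_inversion_boxes:
  assumes "h_strict lam h T" and "inj_on T (diagram lam)"
  shows "card (column_inversion_boxes lam h T) =
    card {(p, q). p \<in> diagram lam \<and> q \<in> diagram lam \<and> snd p \<le> snd q \<and> right_box q \<notin> diagram lam} +
    card {(p, q). p \<in> diagram lam \<and> q \<in> diagram lam \<and> snd p < snd q \<and> T p \<le> h (T q)} -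
    card {(p, q). p \<in> diagram lam \<and> q \<in> diagram lam \<and> snd p \<le> snd q \<and> T p \<le> T q}"
    (is "_ = card ?A + card ?B - card ?C")
proof -
  let ?D = "diagram lam"
  let ?B' = "{(p, q). p \<in> ?D \<and> q \<in> ?D \<and> snd p \<le> snd q \<and> right_box q \<in> ?D \<and> T p \<le> h (T (right_box q))}"
  have fin: "finite {(p, q). p \<in> ?D \<and> q \<in> ?D \<and> R p q}" for R
    by (rule finite_subset[of _ "?D \<times> ?D"]) (use finite_diagram in auto)
  have img: "(\<lambda>(p, q). (p, right_box q)) ` ?B' = ?B"
  proof
    show "?B \<subseteq> (\<lambda>(p, q). (p, right_box q)) ` ?B'"
    proof (clarify)
      fix a b i j
      assume *: "(a, b) \<in> ?D" "(i, j) \<in> ?D" "snd (a, b) < snd (i, j)" "T (a, b) \<le> h (T (i, j))"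
      then have "((a, b), (i, j - 1)) \<in> ?B'"
        using diagram_left[of i j lam "j - 1"] by (auto simp: right_box_def)
      then show "((a, b), i, j) \<in> (\<lambda>(p, q). (p, right_box q)) ` ?B'"
        using *(3) by (intro image_eqI[of _ _ "((a, b), (i, j - 1))"]) (auto simp: right_box_def)
    qed
  qed (auto simp: right_box_def)
  have inj: "inj_on (\<lambda>(p, q). (p, right_box q)) ?B'"
    by (auto simp: inj_on_def right_box_def)
  have B: "card ?B = card ?B'" using card_image[OF inj] unfolding img .
  have "column_inversion_boxes lam h T = (?A \<union> ?B') - ?C"
    by (auto simp: column_inversion_boxes_def right_bounded_def)
  moreover have "?C \<subseteq> ?A \<union> ?B'"
    using assms(1) by (auto simp: h_strict_def right_box_def intro: order.trans)
  ultimately have "card (column_inversion_boxes lam h T) = card (?A \<union> ?B') - card ?C"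
    using card_Diff_subset[of ?C] fin by simp
  also have "card (?A \<union> ?B') = card ?A + card ?B'"
    by (rule card_Un_disjoint) (use fin in auto)
  finally show ?thesis using B by simp
qed

lemma card_column_inversion_boxes_rearrange:
  assumes T: "h_strict lam h T" "inj_on T (diagram lam)"
    and T': "h_strict lam h T'" "inj_on T' (diagram lam)"
    and \<sigma>: "bij_betw \<sigma> (diagram lam) (diagram lam)"
    and eq: "\<And>p. p \<in> diagram lam \<Longrightarrow> snd (\<sigma> p) = snd p \<and> T' p = T (\<sigma> p)"
  shows "card (column_inversion_boxes lam h T') = card (column_inversion_boxes lam h T)"
proof -
  let ?D = "diagram lam"
  have reindex: "card {(p, q). p \<in> ?D \<and> q \<in> ?D \<and> R (snd p) (snd q) (T' p) (T' q)} =
      card {(p, q). p \<in> ?D \<and> q \<in> ?D \<and> R (snd p) (snd q) (T p) (T q)}" for R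
  proof -
    have "{(p, q). p \<in> ?D \<and> q \<in> ?D \<and> R (snd p) (snd q) (T' p) (T' q)} =
        {(p, q). p \<in> ?D \<and> q \<in> ?D \<and> R (snd (\<sigma> p)) (snd (\<sigma> q)) (T (\<sigma> p)) (T (\<sigma> q))}"
      using eq by auto
    then show ?thesis
      using card_pairs_reindex[OF \<sigma>, of "\<lambda>p q. R (snd p) (snd q) (T p) (T q)"] by (simp only:)
  qed
  show ?thesis
    unfolding card_column_inversion_boxes[OF T] card_column_inversion_boxes[OF T']
    using reindex[of "\<lambda>a b x y. a < b \<and> x \<le> h y"] reindex[of "\<lambda>a b x y. a \<le> b \<and> x \<le> y"]
    by (simp only:)
qed

section \<open>Sorting the columns\<close>

definition column_entries :: "nat list \<Rightarrow> (nat \<times> nat \<Rightarrow> nat) \<Rightarrow> nat \<Rightarrow> nat set" where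
  "column_entries lam T j = T ` {p \<in> diagram lam. snd p = j}"

definition column_sort :: "nat list \<Rightarrow> (nat \<times> nat \<Rightarrow> nat) \<Rightarrow> nat \<times> nat \<Rightarrow> nat" where
  "column_sort lam T = (\<lambda>(i, j). sorted_list_of_set (column_entries lam T j) ! i)"

context
  fixes lam n T and h :: "nat \<Rightarrow> nat"
  assumes lam: "is_partition lam n"
    and T: "bij_betw T (diagram lam) {1..n}"
begin

lemma finite_column_entries: "finite (column_entries lam T j)"
  unfolding column_entries_def using finite_diagram[of lam] by simp

lemma inj_on_entries: "inj_on T (diagram lam)"
  using T by (simp add: bij_betw_def)

lemma length_column:
  assumes "(i, j) \<in> diagram lam"
  shows "i < length (sorted_list_of_set (column_entries lam T j))"
proof -
  have "(\<lambda>i. T (i, j)) ` {..i} \<subseteq> column_entries lam T j"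
    using diagram_up[OF lam assms] by (auto simp: column_entries_def)
  moreover have "inj_on (\<lambda>i. T (i, j)) {..i}"
    using inj_on_entries diagram_up[OF lam assms] by (auto simp: inj_on_def)
  ultimately have "card {..i} \<le> card (column_entries lam T j)"
    by (metis card_image card_mono finite_column_entries)
  then show ?thesis using finite_column_entries by simp
qed

lemma column_sort_in:
  assumes "p \<in> diagram lam"
  shows "column_sort lam T p \<in> column_entries lam T (snd p)"
proof -
  obtain i j where p: "p = (i, j)" by (cases p)
  have "sorted_list_of_set (column_entries lam T j) ! i \<in> set (sorted_list_of_set (column_entries lam T j))"
    using length_column assms p by (intro nth_mem) simp
  then show ?thesis using finite_column_entries by (simp add: p column_sort_def)
qed

lemma column_sort_strict:
  assumes "(i', j) \<in> diagram lam" "i < i'"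
  shows "column_sort lam T (i, j) < column_sort lam T (i', j)"
  unfolding column_sort_def case_prod_conv
  using strict_sorted_list_of_set[of "column_entries lam T j"] length_column[OF assms(1)] assms(2)
  by (simp add: sorted_wrt_iff_nth_less)

text \<open>\<open>\<sigma>\<close> sends a box to the box of the same column that held its new
  entry in \<open>T\<close>; it is injective because sorted columns increase strictly.\<close>

lemma column_sort_rearrange:
  obtains \<sigma> where "bij_betw \<sigma> (diagram lam) (diagram lam)"
    and "\<And>p. p \<in> diagram lam \<Longrightarrow> snd (\<sigma> p) = snd p \<and> column_sort lam T p = T (\<sigma> p)"
proof -
  let ?D = "diagram lam" and ?S = "column_sort lam T"
  have "\<forall>p\<in>?D. \<exists>q. q \<in> ?D \<and> snd q = snd p \<and> ?S p = T q"
    using column_sort_in unfolding column_entries_def by fastforce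
  then obtain \<sigma> where \<sigma>: "\<And>p. p \<in> ?D \<Longrightarrow> \<sigma> p \<in> ?D \<and> snd (\<sigma> p) = snd p \<and> ?S p = T (\<sigma> p)"
    by metis
  have "inj_on \<sigma> ?D"
  proof (rule inj_onI)
    fix p q assume pq: "p \<in> ?D" "q \<in> ?D" "\<sigma> p = \<sigma> q"
    then have col: "snd p = snd q" and S: "?S p = ?S q" using \<sigma> by metis+
    obtain i j i' where p: "p = (i, j)" "q = (i', j)" using col by (cases p; cases q) auto
    then show "p = q"
      using column_sort_strict[of i j i'] column_sort_strict[of i' j i] pq(1,2) S
      by (metis linorder_neqE_nat less_irrefl)
  qed
  moreover have "\<sigma> ` ?D \<subseteq> ?D" using \<sigma> by blast
  ultimately have "bij_betw \<sigma> ?D ?D"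
    using endo_inj_surj[OF finite_diagram] by (simp add: bij_betw_def)
  then show thesis using that \<sigma> by blast
qed

lemma bij_betw_column_sort: "bij_betw (column_sort lam T) (diagram lam) {1..n}"
proof -
  obtain \<sigma> where \<sigma>: "bij_betw \<sigma> (diagram lam) (diagram lam)"
    "\<And>p. p \<in> diagram lam \<Longrightarrow> snd (\<sigma> p) = snd p \<and> column_sort lam T p = T (\<sigma> p)"
    using column_sort_rearrange by blast
  have "bij_betw (T \<circ> \<sigma>) (diagram lam) {1..n}" using \<sigma>(1) T by (rule bij_betw_trans)
  then show ?thesis by (rule bij_betw_cong[THEN iffD1, rotated]) (use \<sigma>(2) in simp)
qed

text \<open>Pigeonhole: let \<open>y\<close> be the sorted entry in row \<open>i\<close> of the
  right column. At least \<open>i + 1\<close> entries there are at most \<open>y\<close>, and by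
  strictness and monotonicity their left neighbours in \<open>T\<close> are at most
  \<open>h y\<close>. If the sorted entry left of \<open>y\<close> exceeded \<open>h y\<close>, only
  \<open>i\<close> entries of its column would be smaller than it.\<close>

lemma h_strict_column_sort:
  assumes mono: "mono_on {1..n} h" and strict: "h_strict lam h T"
  shows "h_strict lam h (column_sort lam T)"
  unfolding h_strict_def
proof (intro allI impI, elim conjE)
  fix i j assume ij: "(i, j) \<in> diagram lam" and ij': "(i, Suc j) \<in> diagram lam"
  let ?L = "sorted_list_of_set (column_entries lam T j)"
  let ?L' = "sorted_list_of_set (column_entries lam T (Suc j))"
  let ?y = "column_sort lam T (i, Suc j)"
  let ?Q = "{r. (r, Suc j) \<in> diagram lam \<and> T (r, Suc j) \<le> ?y}"
  have y: "?y \<in> {1..n}" using bij_betw_column_sort ij' by (auto simp: bij_betw_def)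
  have range: "T p \<in> {1..n}" if "p \<in> diagram lam" for p using T that by (auto simp: bij_betw_def)
  have finQ: "finite ?Q"
    by (rule finite_subset[of _ "{..<n}"]) (use diagram_row_less[OF lam] in auto)
  have len': "i < length ?L'" using ij' by (rule length_column)
  show "column_sort lam T (i, j) \<le> h ?y"
  proof (rule ccontr)
    assume "\<not> ?thesis"
    then have less: "h ?y < ?L ! i" by (simp add: column_sort_def)
    have "set (take (Suc i) ?L') \<subseteq> (\<lambda>r. T (r, Suc j)) ` ?Q"
    proof
      fix x assume x: "x \<in> set (take (Suc i) ?L')"
      then obtain m where m: "m \<le> i" "x = ?L' ! m" using len' by (auto simp: in_set_conv_nth less_Suc_eq_le)
      then have "x \<le> ?y"
        using sorted_nth_mono[OF sorted_sorted_list_of_set, of m i "column_entries lam T (Suc j)"] len'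
        by (simp add: column_sort_def)
      moreover have "x \<in> column_entries lam T (Suc j)"
        using x finite_column_entries by (auto dest: in_set_takeD)
      ultimately show "x \<in> (\<lambda>r. T (r, Suc j)) ` ?Q" by (auto simp: column_entries_def)
    qed
    then have "card (set (take (Suc i) ?L')) \<le> card ?Q"
      using finQ by (meson card_image_le card_mono finite_imageI le_trans)
    then have "Suc i \<le> card ?Q" using len' by (simp add: distinct_card)
    also have "card ?Q = card ((\<lambda>r. T (r, j)) ` ?Q)"
    proof (rule card_image[symmetric], rule inj_onI)
      fix r r' assume "r \<in> ?Q" "r' \<in> ?Q" "T (r, j) = T (r', j)"
      then show "r = r'" using inj_onD[OF inj_on_entries, of "(r, j)" "(r', j)"] diagram_left[of _ "Suc j" lam j] by auto
    qed
    also have "\<dots> \<le> card (set (take i ?L))"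
    proof (rule card_mono)
      show "(\<lambda>r. T (r, j)) ` ?Q \<subseteq> set (take i ?L)"
      proof
        fix x assume "x \<in> (\<lambda>r. T (r, j)) ` ?Q"
        then obtain r where r: "x = T (r, j)" "(r, Suc j) \<in> diagram lam" "T (r, Suc j) \<le> ?y" by auto
        have rj: "(r, j) \<in> diagram lam" using diagram_left[OF r(2), of j] by simp
        have "x \<le> h (T (r, Suc j))" using strict r(1,2) rj by (auto simp: h_strict_def)
        also have "\<dots> \<le> h ?y" using mono_onD[OF mono range[OF r(2)] y r(3)] .
        finally have x: "x < ?L ! i" using less by simp
        have "x \<in> set ?L" using rj r(1) finite_column_entries by (auto simp: column_entries_def)
        then obtain m where m: "m < length ?L" "?L ! m = x" by (auto simp: in_set_conv_nth)
        have "m < i"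
          using sorted_nth_mono[OF sorted_sorted_list_of_set, of i m "column_entries lam T j"] m x
          by (meson leD not_less)
        then show "x \<in> set (take i ?L)" using m by (auto simp: in_set_conv_nth)
      qed
    qed simp
    also have "\<dots> \<le> i" by (metis card_length length_take min.cobounded2 le_trans)
    finally show False by simp
  qed
qed

end

text \<open>The witness is the column-sorted filling. Sorting preserves the number of
  \<open>column_inversion_boxes\<close>; these contain the inversions of \<open>T\<close> strictly,
  because of one descent in a column, and coincide with the inversions after sorting.\<close>

lemma nonstandard_not_maximal:
  assumes lam: "is_partition lam n" and mono: "mono_on {1..n} h" and h: "\<forall>i\<in>{1..n}. h i < i"
    and T: "T \<in> RS n h lam" and "\<not> standard_tableau n lam T"
  shows "\<exists>T'\<in>RS n h lam. card (inversion_boxes lam h T) < card (inversion_boxes lam h T')"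
proof -
  let ?D = "diagram lam" and ?S = "column_sort lam T"
  have bij: "bij_betw T ?D {1..n}" and strict: "h_strict lam h T" using T by (auto simp: RS_def)
  have inj: "inj_on T ?D" and range: "\<And>p. p \<in> ?D \<Longrightarrow> T p \<in> {1..n}"
    using bij by (auto simp: bij_betw_def)
  \<comment> \<open>Strictness and \<open>h i < i\<close> make neighbours in a row increase.\<close>
  have rows: "T (i, j) < T (i, j')" if "(i, j') \<in> ?D" "j < j'" for i j j'
    using that(2,1)
  proof (induction j' rule: less_induct)
    case (less k)
    then obtain m where k: "k = Suc m" by (cases k) auto
    have m: "(i, m) \<in> ?D" using less.prems(2) k diagram_left by auto
    have "T (i, m) \<le> h (T (i, k))" using strict m less.prems(2) k by (auto simp: h_strict_def)
    also have "\<dots> < T (i, k)" using h range[OF less.prems(2)] by blast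
    finally have "T (i, m) < T (i, k)" .
    then show ?case using less.IH[of m] m less.prems(1) k by (cases "j = m") auto
  qed
  let ?bad = "\<lambda>j. \<exists>i. (Suc i, j) \<in> ?D \<and> T (i, j) > T (Suc i, j)"
  have "\<exists>j. ?bad j"
  proof (rule ccontr)
    assume nb: "\<not> ?thesis"
    have cols: "T (i, j) < T (i', j)" if "(i', j) \<in> ?D" "i < i'" for i i' j
      using that(2,1)
    proof (induction i' rule: less_induct)
      case (less k)
      then obtain m where k: "k = Suc m" by (cases k) auto
      have m: "(m, j) \<in> ?D" using less.prems(2) k diagram_up[OF lam, of k j m] by auto
      have "T (m, j) \<noteq> T (k, j)" using inj_onD[OF inj _ m less.prems(2)] k by auto
      then have "T (m, j) < T (k, j)" using nb less.prems(2) k by (metis linorder_neqE_nat)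
      then show ?case using less.IH[of m] m less.prems(1) k by (cases "i = m") auto
    qed
    have "standard_tableau n lam T" unfolding standard_tableau_def using bij rows cols by blast
    then show False using assms(5) by blast
  qed
  then have ne: "{j. ?bad j} \<noteq> {}" by simp
  have fin: "finite {j. ?bad j}"
    by (rule finite_subset[of _ "snd ` ?D"]) (use finite_diagram in \<open>force+\<close>)
  \<comment> \<open>Taking the rightmost column with a descent leaves column \<open>j + 1\<close>
    increasing, so the bound from the right neighbour in row \<open>i\<close> passes to the one in
    row \<open>i + 1\<close>.\<close>
  define j where "j = Max {j. ?bad j}"
  have "?bad j" using Max_in[OF fin ne] unfolding j_def by (rule CollectD)
  have jmax: "j' \<le> j" if "?bad j'" for j'
    unfolding j_def by (rule Max_ge[OF fin]) (use that in simp)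
  from \<open>?bad j\<close> obtain i where i: "(Suc i, j) \<in> ?D" "T (i, j) > T (Suc i, j)" by blast
  have i': "(i, j) \<in> ?D" using diagram_up[OF lam i(1), of i] by simp
  have "right_bounded lam h T (i, j) (Suc i, j)"
    unfolding right_bounded_def right_box_def fst_conv snd_conv
  proof
    assume r: "(Suc i, Suc j) \<in> ?D"
    then have r': "(i, Suc j) \<in> ?D" using diagram_up[OF lam r, of i] by simp
    have "\<not> T (i, Suc j) > T (Suc i, Suc j)" using jmax[of "Suc j"] r by force
    then have "h (T (i, Suc j)) \<le> h (T (Suc i, Suc j))"
      using mono_onD[OF mono range[OF r'] range[OF r]] by simp
    moreover have "T (i, j) \<le> h (T (i, Suc j))" using strict i' r' by (auto simp: h_strict_def)
    ultimately show "T (i, j) \<le> h (T (Suc i, Suc j))" by simp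
  qed
  then have "((i, j), (Suc i, j)) \<in> column_inversion_boxes lam h T - inversion_boxes lam h T"
    using i i' by (auto simp: column_inversion_boxes_def inversion_boxes_def)
  moreover have "inversion_boxes lam h T \<subseteq> column_inversion_boxes lam h T"
    by (auto simp: column_inversion_boxes_def inversion_boxes_def)
  ultimately have "inversion_boxes lam h T \<subset> column_inversion_boxes lam h T" by blast
  moreover have "finite (column_inversion_boxes lam h T)"
    by (rule finite_subset[of _ "?D \<times> ?D"]) (use finite_diagram in \<open>auto simp: column_inversion_boxes_def\<close>)
  ultimately have "card (inversion_boxes lam h T) < card (column_inversion_boxes lam h T)"
    by (simp add: psubset_card_mono)
  also obtain \<sigma> where \<sigma>: "bij_betw \<sigma> ?D ?D"
    "\<And>p. p \<in> ?D \<Longrightarrow> snd (\<sigma> p) = snd p \<and> ?S p = T (\<sigma> p)"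
    using column_sort_rearrange[OF lam bij] by blast
  have S: "bij_betw ?S ?D {1..n}" "h_strict lam h ?S"
    using bij_betw_column_sort[OF lam bij] h_strict_column_sort[OF lam bij mono strict] by auto
  have "card (column_inversion_boxes lam h T) = card (column_inversion_boxes lam h ?S)"
    by (rule card_column_inversion_boxes_rearrange[symmetric, OF strict inj S(2) _ \<sigma>])
      (use S(1) in \<open>auto simp: bij_betw_def\<close>)
  also have "column_inversion_boxes lam h ?S = inversion_boxes lam h ?S"
  proof -
    \<comment> \<open>In a sorted column the larger entry is the lower one, so the order condition
      omitted from \<open>column_inversion_boxes\<close> holds automatically.\<close>
    have less: "fst q < fst p" if "p \<in> ?D" "q \<in> ?D" "?S q < ?S p" "snd p = snd q" for p q
    proof (rule ccontr)
      assume "\<not> fst q < fst p"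
      moreover have "fst p \<noteq> fst q" using that(3,4) prod_eqI[of p q] by auto
      ultimately have "?S (fst p, snd q) < ?S (fst q, snd q)"
        using column_sort_strict[OF lam bij, of "fst q" "snd q" "fst p"] that(2) by simp
      then show False using that(3,4) by (metis order.asym prod.collapse)
    qed
    have "(p, q) \<in> inversion_boxes lam h ?S" if "(p, q) \<in> column_inversion_boxes lam h ?S" for p q
      using that less[of p q] unfolding column_inversion_boxes_def inversion_boxes_def by fastforce
    moreover have "inversion_boxes lam h ?S \<subseteq> column_inversion_boxes lam h ?S"
      by (auto simp: column_inversion_boxes_def inversion_boxes_def)
    ultimately show ?thesis by (intro subset_antisym subrelI) blast+
  qed
  finally show ?thesis using S by (intro bexI[of _ ?S]) (auto simp: RS_def)
qed

section \<open>The main theorem\<close>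

definition label_box :: "nat list \<Rightarrow> (nat \<Rightarrow> nat) \<Rightarrow> nat \<Rightarrow> nat \<times> nat" where
  "label_box lam w = inv_into (diagram lam) (filling_of lam w)"

text \<open>Row indices are below \<open>n\<close>, so the order is that of the base filling: first
  by column, then from bottom to top. Unlike the base labels, whose difference between row
  neighbours is the height of the right column, these values always differ by \<open>n\<close>
  there, as \<open>adj_shift\<close> demands.\<close>

definition label_pos :: "nat \<Rightarrow> nat list \<Rightarrow> (nat \<Rightarrow> nat) \<Rightarrow> nat \<Rightarrow> int" where
  "label_pos n lam w k = int n * int (snd (label_box lam w k)) - int (fst (label_box lam w k))"

definition label_adj :: "nat \<Rightarrow> nat list \<Rightarrow> (nat \<Rightarrow> nat) \<Rightarrow> nat \<Rightarrow> nat \<Rightarrow> bool" where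
  "label_adj n lam w l r \<longleftrightarrow>
     l \<in> {1..n} \<and> r \<in> {1..n} \<and> right_box (label_box lam w l) = label_box lam w r"

context
  fixes n :: nat and lam :: "nat list" and w :: "nat \<Rightarrow> nat"
  assumes lam: "is_partition lam n" and w: "w permutes {1..n}"
begin

lemma label_box_in: "k \<in> {1..n} \<Longrightarrow> label_box lam w k \<in> diagram lam"
  using bij_betw_inv_into[OF bij_betw_filling_of[OF lam w]] by (auto simp: label_box_def bij_betw_def)

lemma filling_label_box: "k \<in> {1..n} \<Longrightarrow> filling_of lam w (label_box lam w k) = k"
  using bij_betw_inv_into_right[OF bij_betw_filling_of[OF lam w]] by (simp add: label_box_def)

lemma label_box_filling: "p \<in> diagram lam \<Longrightarrow> label_box lam w (filling_of lam w p) = p"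
  using bij_betw_inv_into_left[OF bij_betw_filling_of[OF lam w]] by (simp add: label_box_def)

lemma filling_range: "p \<in> diagram lam \<Longrightarrow> filling_of lam w p \<in> {1..n}"
  using bij_betw_filling_of[OF lam w] by (auto simp: bij_betw_def)

lemma base_filling_eq: "base_filling lam p = w (filling_of lam w p)"
  unfolding filling_of_def using permutes_inverses(1)[OF w] by simp

lemma base_filling_label_box: "k \<in> {1..n} \<Longrightarrow> base_filling lam (label_box lam w k) = w k"
  by (simp add: base_filling_eq filling_label_box)

lemma label_pos_less_iff:
  assumes "k \<in> {1..n}" "j \<in> {1..n}"
  shows "label_pos n lam w k < label_pos n lam w j \<longleftrightarrow> w k < w j"
proof -
  let ?p = "label_box lam w k" and ?q = "label_box lam w j"
  have D: "?p \<in> diagram lam" "?q \<in> diagram lam" using assms label_box_in by auto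
  have row: "fst ?p < n" "fst ?q < n"
    using D diagram_row_less[OF lam] by (metis prod.collapse)+
  have less: "int n * int a - int x < int n * int b - int y" if "a < b" "x < n" "y < n" for a b x y
  proof -
    have "int n * (int a + 1) \<le> int n * int b" using that by (intro mult_left_mono) auto
    then show ?thesis using that by (simp add: algebra_simps)
  qed
  have "w k < w j \<longleftrightarrow> snd ?p < snd ?q \<or> (snd ?p = snd ?q \<and> fst ?p > fst ?q)"
    using base_filling_less_iff[OF D] assms by (simp add: base_filling_label_box)
  also have "\<dots> \<longleftrightarrow> label_pos n lam w k < label_pos n lam w j"
    unfolding label_pos_def
    using less[of "snd ?p" "snd ?q" "fst ?p" "fst ?q"] less[of "snd ?q" "snd ?p" "fst ?q" "fst ?p"] row
    by (cases "snd ?p" "snd ?q" rule: linorder_cases) auto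
  finally show ?thesis ..
qed

lemma label_adj_iff:
  "label_adj n lam w l r \<longleftrightarrow> (\<exists>p. p \<in> diagram lam \<and> right_box p \<in> diagram lam \<and>
     l = filling_of lam w p \<and> r = filling_of lam w (right_box p))"
proof
  assume "label_adj n lam w l r"
  then have "l \<in> {1..n}" "r \<in> {1..n}" "right_box (label_box lam w l) = label_box lam w r"
    by (auto simp: label_adj_def)
  then show "\<exists>p. p \<in> diagram lam \<and> right_box p \<in> diagram lam \<and>
      l = filling_of lam w p \<and> r = filling_of lam w (right_box p)"
    using label_box_in filling_label_box by (intro exI[of _ "label_box lam w l"]) simp
next
  assume "\<exists>p. p \<in> diagram lam \<and> right_box p \<in> diagram lam \<and>
     l = filling_of lam w p \<and> r = filling_of lam w (right_box p)"
  then obtain p where p: "p \<in> diagram lam" "right_box p \<in> diagram lam"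
    "l = filling_of lam w p" "r = filling_of lam w (right_box p)" by blast
  show "label_adj n lam w l r"
    unfolding label_adj_def p(3,4)
    using filling_range[OF p(1)] filling_range[OF p(2)] label_box_filling[OF p(1)] label_box_filling[OF p(2)]
    by simp
qed

lemma X_mat_entry:
  assumes "k \<in> {1..n}" "s \<in> {1..n}"
  shows "X_mat n lam $$ (w k - 1, w s - 1) = (if label_adj n lam w k s then 1 else 0)"
proof -
  have wr: "w k \<in> {1..n}" "w s \<in> {1..n}" using permutes_in_image[OF w] assms by blast+
  have "adjacent_labels lam \<subseteq> base_filling lam ` diagram lam \<times> base_filling lam ` diagram lam"
    by (auto simp: adjacent_labels_def)
  then have fin: "finite (adjacent_labels lam)"
    using finite_diagram by (meson finite_SigmaI finite_imageI finite_subset)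
  have "X_mat n lam $$ (w k - 1, w s - 1) =
      (\<Sum>(a, b)\<in>adjacent_labels lam. elem_mat n a b $$ (w k - 1, w s - 1))"
    unfolding X_mat_def using wr by (subst index_mat) auto
  also have "\<dots> = (\<Sum>p\<in>adjacent_labels lam. if p = (w k, w s) then 1 else 0)"
    using wr by (intro sum.cong) (auto simp: elem_mat_def split: if_splits)
  also have "\<dots> = (if (w k, w s) \<in> adjacent_labels lam then 1 else 0)"
    using fin by (simp add: sum.delta)
  also have "(w k, w s) \<in> adjacent_labels lam \<longleftrightarrow> label_adj n lam w k s"
  proof -
    have "(w k, w s) \<in> adjacent_labels lam \<longleftrightarrow> (\<exists>p. p \<in> diagram lam \<and> right_box p \<in> diagram lam \<and>
        w k = w (filling_of lam w p) \<and> w s = w (filling_of lam w (right_box p)))"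
      by (auto simp: adjacent_labels_def base_filling_eq right_box_def)
    then show ?thesis unfolding label_adj_iff by (simp add: inj_eq[OF permutes_inj[OF w]])
  qed
  finally show ?thesis .
qed

lemma label_pos_adj:
  assumes "label_adj n lam w l r"
  shows "label_pos n lam w r = label_pos n lam w l + int n"
proof -
  have "label_box lam w r = right_box (label_box lam w l)" using assms by (simp add: label_adj_def)
  then show ?thesis by (simp add: label_pos_def right_box_def algebra_simps)
qed

lemma schubert_chart_filling:
  "schubert_chart n (label_pos n lam w) (label_adj n lam w) w (X_mat n lam)"
proof
  let ?pos = "label_pos n lam w" and ?adj = "label_adj n lam w"
  show less: "?pos k < ?pos j \<longleftrightarrow> w k < w j" if "k \<in> {1..n}" "j \<in> {1..n}" for k j
    using that by (rule label_pos_less_iff)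
  show "inj_on ?pos {1..n}"
  proof (rule inj_onI)
    fix k j assume "k \<in> {1..n}" "j \<in> {1..n}" "?pos k = ?pos j"
    then have "w k = w j" using less[of k j] less[of j k] by auto
    then show "k = j" using injD[OF permutes_inj[OF w]] by blast
  qed
  show "?adj l r \<Longrightarrow> l \<in> {1..n} \<and> r \<in> {1..n}" for l r by (simp add: label_adj_def)
  show "?adj l r \<Longrightarrow> ?adj l r' \<Longrightarrow> r = r'" for l r r'
    using filling_label_box by (metis label_adj_def)
  show "?pos l < ?pos r" if "?adj l r" for l r
    using label_pos_adj[OF that] that by (auto simp: label_adj_def)
  show "?pos s - ?pos k = ?pos r - ?pos l" if "?adj k s" "?adj l r" for k s l r
    using label_pos_adj[OF that(1)] label_pos_adj[OF that(2)] by simp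
  show "?pos r < ?pos s" if ks: "?adj k s" and r: "r \<in> {1..n}" and no_left: "\<And>l. \<not> ?adj l r" for k s r
  proof -
    let ?p = "label_box lam w r" and ?q = "label_box lam w s"
    have p: "?p \<in> diagram lam" using r by (rule label_box_in)
    \<comment> \<open>A box without left neighbour lies in the first column, whereas
      \<open>s\<close> has the left neighbour \<open>k\<close> and so lies in a later one.\<close>
    have "snd ?p = 0"
    proof (rule ccontr)
      assume "snd ?p \<noteq> 0"
      then have eq: "right_box (fst ?p, snd ?p - 1) = ?p" by (simp add: right_box_def)
      have "(fst ?p, snd ?p) \<in> diagram lam" using p by simp
      then have "(fst ?p, snd ?p - 1) \<in> diagram lam" by (rule diagram_left) simp
      moreover have "right_box (fst ?p, snd ?p - 1) \<in> diagram lam" unfolding eq by (rule p)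
      moreover have "r = filling_of lam w (right_box (fst ?p, snd ?p - 1))"
        unfolding eq using filling_label_box[OF r] by (rule sym)
      ultimately have "?adj (filling_of lam w (fst ?p, snd ?p - 1)) r"
        unfolding label_adj_iff by (intro exI[of _ "(fst ?p, snd ?p - 1)"] conjI refl)
      then show False using no_left by blast
    qed
    have s: "s \<in> {1..n}" "right_box (label_box lam w k) = ?q" using ks by (simp_all add: label_adj_def)
    have "snd ?q > 0" unfolding s(2)[symmetric] by (simp add: right_box_def)
    then have q: "?q \<in> diagram lam" "snd ?q > 0" using label_box_in[OF s(1)] by simp_all
    have "snd ?p < snd ?q" using \<open>snd ?p = 0\<close> q(2) by simp
    then have "base_filling lam ?p < base_filling lam ?q" using base_filling_less_iff[OF p q(1)] by simp
    then show ?thesis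
      using less[OF r s(1)] by (simp only: base_filling_label_box[OF r] base_filling_label_box[OF s(1)])
  qed
  show "X_mat n lam \<in> carrier_mat n n" by (simp add: X_mat_def)
  show "X_mat n lam $$ (w k - 1, w s - 1) = (if ?adj k s then 1 else 0)"
    if "k \<in> {1..n}" "s \<in> {1..n}" for k s using that by (rule X_mat_entry)
qed (rule w)

interpretation schubert_chart n "label_pos n lam w" "label_adj n lam w" h w "X_mat n lam" for h
  by (rule schubert_chart_filling)

text \<open>Condition (i) on an inversion says that \<open>k\<close> precedes \<open>l\<close> in
  the base filling, which with \<open>k > l\<close> gives \<open>cell_pairs\<close>; failure of
  condition (ii) is membership in \<open>bound_pairs\<close>.\<close>

lemma hess_inversions_eq_pairs: "hess_inversions lam h w = cell_pairs - bound_pairs h"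
proof -
  let ?T = "filling_of lam w"
  have "map_prod ?T ?T ` inversion_boxes lam h ?T = cell_pairs - bound_pairs h"
  proof
    show "map_prod ?T ?T ` inversion_boxes lam h ?T \<subseteq> cell_pairs - bound_pairs h"
    proof (rule image_subsetI)
      fix x assume "x \<in> inversion_boxes lam h ?T"
      then obtain p q where x: "x = (p, q)" and pq: "(p, q) \<in> inversion_boxes lam h ?T" by (cases x) simp
      from pq have D: "p \<in> diagram lam" "q \<in> diagram lam" and T: "?T q < ?T p"
        and less: "base_filling lam p < base_filling lam q" and rb: "right_bounded lam h ?T p q"
        using base_filling_less_iff[of p lam q] by (auto simp: inversion_boxes_def)
      have "(?T p, ?T q) \<in> cell_pairs"
        using less T filling_range D label_pos_less_iff[of "?T p" "?T q"]
        by (simp add: cell_pairs_def base_filling_eq del: atLeastAtMost_iff)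
      moreover have "(?T p, ?T q) \<notin> bound_pairs h"
      proof
        assume "(?T p, ?T q) \<in> bound_pairs h"
        then obtain r where r: "label_adj n lam w (?T q) r" "h r < ?T p" by (auto simp: bound_pairs_def)
        then have "label_box lam w r = right_box q" "r \<in> {1..n}"
          using label_box_filling[OF D(2)] by (auto simp: label_adj_def)
        then have "right_box q \<in> diagram lam" "r = ?T (right_box q)"
          using label_box_in[of r] filling_label_box[of r] by auto
        then show False using rb r(2) by (simp add: right_bounded_def)
      qed
      ultimately show "map_prod ?T ?T x \<in> cell_pairs - bound_pairs h" by (simp add: x)
    qed
    show "cell_pairs - bound_pairs h \<subseteq> map_prod ?T ?T ` inversion_boxes lam h ?T"
    proof (clarify)
      fix k l assume kl: "(k, l) \<in> cell_pairs" "(k, l) \<notin> bound_pairs h"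
      then have kl': "k \<in> {1..n}" "l \<in> {1..n}" "l < k" "w k < w l"
        using label_pos_less_iff[of k l] by (auto simp: cell_pairs_def)
      let ?p = "label_box lam w k" and ?q = "label_box lam w l"
      have D: "?p \<in> diagram lam" "?q \<in> diagram lam" using kl' label_box_in by auto
      have T: "?T ?p = k" "?T ?q = l" using kl' filling_label_box by auto
      have "snd ?p < snd ?q \<or> (snd ?p = snd ?q \<and> fst ?p > fst ?q)"
        using base_filling_less_iff[OF D] kl' by (simp add: base_filling_label_box)
      moreover have "right_bounded lam h ?T ?p ?q"
        unfolding right_bounded_def
      proof (rule impI, rule ccontr)
        assume r: "right_box ?q \<in> diagram lam" and "\<not> ?T ?p \<le> h (?T (right_box ?q))"
        moreover have "label_adj n lam w l (?T (right_box ?q))"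
          unfolding label_adj_iff using D(2) r T(2) by metis
        ultimately show False using kl T(1) by (auto simp: bound_pairs_def)
      qed
      ultimately have "(?p, ?q) \<in> inversion_boxes lam h ?T"
        using D T kl'(3) by (auto simp: inversion_boxes_def)
      then show "(k, l) \<in> map_prod ?T ?T ` inversion_boxes lam h ?T"
        using T by (intro image_eqI[of _ _ "(?p, ?q)"]) auto
    qed
  qed
  then show ?thesis by (simp only: hess_inversions_eq_image)
qed

lemma h_strict_iff_adj:
  "h_strict lam h (filling_of lam w) \<longleftrightarrow> (\<forall>l r. label_adj n lam w l r \<longrightarrow> l \<le> h r)"
  unfolding h_strict_def label_adj_iff by (auto simp: right_box_def)

lemma cell_Int_Hess_nonempty_iff:
  assumes h: "h \<in> {1..n} \<rightarrow> {0..n - 1}" "mono_on {1..n} h"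
  shows "schubert_cell n w \<inter> Hess n (X_mat n lam) h \<noteq> {} \<longleftrightarrow> filling_of lam w \<in> RS n h lam"
proof -
  have "filling_of lam w \<in> RS n h lam \<longleftrightarrow> (\<forall>l r. label_adj n lam w l r \<longrightarrow> l \<le> h r)"
    using bij_betw_filling_of[OF lam w] by (simp add: RS_def h_strict_iff_adj)
  then show ?thesis
    using cell_Int_Hess_dim(1)[OF h] cell_Int_Hess_empty[OF h] by (metis not_le)
qed

lemma flag_dim_cell_Int_Hess:
  assumes h: "h \<in> {1..n} \<rightarrow> {0..n - 1}" "mono_on {1..n} h"
    and "filling_of lam w \<in> RS n h lam"
  shows "flag_dim n (schubert_cell n w \<inter> Hess n (X_mat n lam) h) = enat (card (hess_inversions lam h w))"
  unfolding hess_inversions_eq_pairs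
  by (rule cell_Int_Hess_dim(2)[OF h]) (use assms(3) in \<open>simp add: RS_def h_strict_iff_adj\<close>)

end

text \<open>The first two conjuncts establish the facts that the English statement recalls in
  passing. They also reduce maximality of the dimension to maximality of the number of
  inversions.\<close>

theorem theorem6p3:
  fixes n :: nat and lam :: "nat list" and h w :: "nat \<Rightarrow> nat"
  assumes "n > 0"
    and "is_partition lam n"
    and "h \<in> {1..n} \<rightarrow> {0..n - 1}"
    and "mono_on {1..n} h"
    and "\<forall>i\<in>{1..n}. h i < i"
    and "w permutes {1..n}"
  shows
    "(schubert_cell n w \<inter> Hess n (X_mat n lam) h \<noteq> {} \<longleftrightarrow> filling_of lam w \<in> RS n h lam)
   \<and> (schubert_cell n w \<inter> Hess n (X_mat n lam) h \<noteq> {} \<longrightarrow>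
        flag_dim n (schubert_cell n w \<inter> Hess n (X_mat n lam) h)
          = enat (card (hess_inversions lam h w)))
   \<and> (schubert_cell n w \<inter> Hess n (X_mat n lam) h \<noteq> {} \<and>
        (\<forall>v. v permutes {1..n} \<and> schubert_cell n v \<inter> Hess n (X_mat n lam) h \<noteq> {} \<longrightarrow>
             flag_dim n (schubert_cell n v \<inter> Hess n (X_mat n lam) h)
               \<le> flag_dim n (schubert_cell n w \<inter> Hess n (X_mat n lam) h)) \<longrightarrow>
        standard_tableau n lam (filling_of lam w))"
proof (intro conjI impI)
  note lam = assms(2) and h = assms(3,4) and w = assms(6)
  show ne: "schubert_cell n w \<inter> Hess n (X_mat n lam) h \<noteq> {} \<longleftrightarrow> filling_of lam w \<in> RS n h lam"
    by (rule cell_Int_Hess_nonempty_iff[OF lam w h])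
  show "flag_dim n (schubert_cell n w \<inter> Hess n (X_mat n lam) h) = enat (card (hess_inversions lam h w))"
    if "schubert_cell n w \<inter> Hess n (X_mat n lam) h \<noteq> {}"
    by (rule flag_dim_cell_Int_Hess[OF lam w h]) (use that ne in blast)
  assume max: "schubert_cell n w \<inter> Hess n (X_mat n lam) h \<noteq> {} \<and>
    (\<forall>v. v permutes {1..n} \<and> schubert_cell n v \<inter> Hess n (X_mat n lam) h \<noteq> {} \<longrightarrow>
       flag_dim n (schubert_cell n v \<inter> Hess n (X_mat n lam) h)
         \<le> flag_dim n (schubert_cell n w \<inter> Hess n (X_mat n lam) h))"
  then have RS: "filling_of lam w \<in> RS n h lam" using ne by blast
  show "standard_tableau n lam (filling_of lam w)"
  proof (rule ccontr)
    assume "\<not> standard_tableau n lam (filling_of lam w)"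
    from nonstandard_not_maximal[OF lam h(2) assms(5) RS this]
    obtain T' where T': "T' \<in> RS n h lam"
      "card (inversion_boxes lam h (filling_of lam w)) < card (inversion_boxes lam h T')" by blast
    have "bij_betw T' (diagram lam) {1..n}" using T'(1) by (simp add: RS_def)
    then obtain v where v: "v permutes {1..n}" "\<And>p. p \<in> diagram lam \<Longrightarrow> filling_of lam v p = T' p"
      using filling_of_surj[OF lam] by blast
    have "h_strict lam h (filling_of lam v)"
      using T'(1) v(2) by (auto simp: RS_def h_strict_def)
    then have RSv: "filling_of lam v \<in> RS n h lam"
      using bij_betw_filling_of[OF lam v(1)] by (simp add: RS_def)
    have card: "card (hess_inversions lam h u) = card (inversion_boxes lam h (filling_of lam u))"
      if "u permutes {1..n}" for u
      by (rule card_hess_inversions) (use bij_betw_filling_of[OF lam that] in \<open>simp add: bij_betw_def\<close>)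
    have "schubert_cell n v \<inter> Hess n (X_mat n lam) h \<noteq> {}"
      using cell_Int_Hess_nonempty_iff[OF lam v(1) h] RSv by blast
    then have "flag_dim n (schubert_cell n v \<inter> Hess n (X_mat n lam) h)
        \<le> flag_dim n (schubert_cell n w \<inter> Hess n (X_mat n lam) h)"
      using max v(1) by blast
    then have "card (hess_inversions lam h v) \<le> card (hess_inversions lam h w)"
      unfolding flag_dim_cell_Int_Hess[OF lam v(1) h RSv] flag_dim_cell_Int_Hess[OF lam w h RS] by simp
    then show False
      using T'(2) card[OF v(1)] card[OF w] inversion_boxes_cong[of lam "filling_of lam v" T' h] v(2)
      by simp
  qed
qed

end
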